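(* Given a tree-shaped CQ ${\boldsymbol q}(\vec{x})$, an ontology $\mathcal{T}$, a data instance $\mathcal{A}$ and a tuple $\vec{a}\subseteq\mathsf{ind}(\mathcal{A})$, the problem of deciding whether $\mathcal{T},\mathcal{A}\models{\boldsymbol q}(\vec{a})$ is fixed-parameter tractable, with parameter $|{\boldsymbol q}|$.
   Context: An ontology $\mathcal{T}$ is a finite set of tgds $\forall \vec{x}\,(\varphi(\vec{x}) \to \exists \vec{y} \bigwedge_i \psi_i(\vec{x},\vec{y}))$ with $\varphi,\psi_i$ unary or binary atoms without constants and $|\vec{x}\cup\vec{y}|\le 2$. A data instance $\mathcal{A}$ is a finite set of ground atoms with constants $\mathsf{ind}(\mathcal{A})$. A CQ ${\boldsymbol q}(\vec{x})=\exists\vec{y}\,\varphi(\vec{x},\vec{y})$ has $\varphi$ a conjunction of unary/binary atoms over variables (no constants); $|{\boldsymbol q}|$ is the number of atoms. ${\boldsymbol q}$ is tree-shaped if its Gaifman graph (vertices: variables; edges: pairs of distinct variables co-occurring in an atom) is a tree. $\mathcal{T},\mathcal{A}\models{\boldsymbol q}(\vec{a})$ means ${\boldsymbol q}(\vec{a})$ is true in every model of $\mathcal{T}\cup\mathcal{A}$. Fixed-parameter tractable: decidable in time $f(|{\boldsymbol q}|)\cdot\text{poly}(|{\boldsymbol q}|+|\mathcal{T}|+|\mathcal{A}|)$ for some computable $f$. *)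

theory Defs
  imports Main "HOL-Library.Countable" "HOL-Computational_Algebra.Polynomial"
begin

section \<open>Atoms, ontologies, data instances and conjunctive queries\<close>

text \<open>Predicate names, variables and constants are natural numbers; unary and binary predicate
  names are kept apart by the constructors. The same type of atoms serves for atoms over variables
  (in tgds and queries) and for ground atoms (in data instances). Finite sets and conjunctions
  are given as lists, the form in which they are presented to an algorithm.\<close>

type_synonym var = nat
type_synonym const = nat

datatype 'a atom = Unary nat 'a | Binary nat 'a 'a

primrec terms_of :: "'a atom \<Rightarrow> 'a set" where
  "terms_of (Unary A s) = {s}"
| "terms_of (Binary P s t) = {s, t}"

datatype tgd = TGD (body: "var atom") (head: "var atom list")

definition tgd_vars :: "tgd \<Rightarrow> var set" where
  "tgd_vars \<tau> = terms_of (body \<tau>) \<union> (\<Union>\<psi>\<in>set (head \<tau>). terms_of \<psi>)"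

type_synonym ontology = "tgd list"

definition is_ontology :: "ontology \<Rightarrow> bool" where
  "is_ontology T \<longleftrightarrow> (\<forall>\<tau>\<in>set T. card (tgd_vars \<tau>) \<le> 2)"

type_synonym data = "const atom list"

definition ind :: "data \<Rightarrow> const set" where
  "ind D = (\<Union>\<alpha>\<in>set D. terms_of \<alpha>)"

datatype cq = CQ (ans_vars: "var list") (atoms: "var atom list")

definition cq_vars :: "cq \<Rightarrow> var set" where
  "cq_vars q = (\<Union>\<alpha>\<in>set (atoms q). terms_of \<alpha>)"

definition is_cq :: "cq \<Rightarrow> bool" where
  "is_cq q \<longleftrightarrow> distinct (ans_vars q) \<and> set (ans_vars q) \<subseteq> cq_vars q"

definition cq_size :: "cq \<Rightarrow> nat" where
  "cq_size q = length (atoms q)"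

section \<open>Tree-shaped queries\<close>

definition gaifman :: "cq \<Rightarrow> (var \<times> var) set" where
  "gaifman q = {(u, v). u \<noteq> v \<and> (\<exists>\<alpha>\<in>set (atoms q). u \<in> terms_of \<alpha> \<and> v \<in> terms_of \<alpha>)}"

text \<open>In the following two definitions \<open>E\<close> is the symmetric, irreflexive adjacency relation of
  a simple undirected graph.\<close>

definition is_cycle :: "('v \<times> 'v) set \<Rightarrow> 'v list \<Rightarrow> bool" where
  "is_cycle E c \<longleftrightarrow> 3 \<le> length c \<and> distinct c \<and>
     (\<forall>i. Suc i < length c \<longrightarrow> (c ! i, c ! Suc i) \<in> E) \<and> (last c, hd c) \<in> E"

definition is_tree :: "'v set \<Rightarrow> ('v \<times> 'v) set \<Rightarrow> bool" where
  "is_tree V E \<longleftrightarrow> V \<noteq> {} \<and> (\<forall>u\<in>V. \<forall>v\<in>V. (u, v) \<in> E\<^sup>*) \<and> (\<nexists>c. is_cycle E c)"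

definition tree_shaped :: "cq \<Rightarrow> bool" where
  "tree_shaped q \<longleftrightarrow> is_tree (cq_vars q) (gaifman q)"

section \<open>Semantics\<close>

record 'd interp =
  univ :: "'d set"
  cint :: "const \<Rightarrow> 'd"
  uint :: "nat \<Rightarrow> 'd set"
  bint :: "nat \<Rightarrow> ('d \<times> 'd) set"

definition is_interp :: "'d interp \<Rightarrow> bool" where
  "is_interp I \<longleftrightarrow> univ I \<noteq> {} \<and> (\<forall>c. cint I c \<in> univ I) \<and>
     (\<forall>A. uint I A \<subseteq> univ I) \<and> (\<forall>P. bint I P \<subseteq> univ I \<times> univ I)"

primrec holds :: "'d interp \<Rightarrow> ('a \<Rightarrow> 'd) \<Rightarrow> 'a atom \<Rightarrow> bool" where
  "holds I s (Unary A x) \<longleftrightarrow> s x \<in> uint I A"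
| "holds I s (Binary P x y) \<longleftrightarrow> (s x, s y) \<in> bint I P"

definition sat_tgd :: "'d interp \<Rightarrow> tgd \<Rightarrow> bool" where
  "sat_tgd I \<tau> \<longleftrightarrow>
     (\<forall>s. (\<forall>x. s x \<in> univ I) \<and> holds I s (body \<tau>) \<longrightarrow>
       (\<exists>s'. (\<forall>x. s' x \<in> univ I) \<and> (\<forall>x\<in>terms_of (body \<tau>). s' x = s x) \<and>
         (\<forall>\<psi>\<in>set (head \<tau>). holds I s' \<psi>)))"

definition is_model :: "'d interp \<Rightarrow> ontology \<Rightarrow> data \<Rightarrow> bool" where
  "is_model I T D \<longleftrightarrow> is_interp I \<and> (\<forall>\<tau>\<in>set T. sat_tgd I \<tau>) \<and>
     (\<forall>\<alpha>\<in>set D. holds I (cint I) \<alpha>)"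

definition sat_cq :: "'d interp \<Rightarrow> cq \<Rightarrow> const list \<Rightarrow> bool" where
  "sat_cq I q as \<longleftrightarrow>
     (\<exists>s. (\<forall>x. s x \<in> univ I) \<and> map s (ans_vars q) = map (cint I) as \<and>
       (\<forall>\<alpha>\<in>set (atoms q). holds I s \<alpha>))"

text \<open>HOL cannot quantify over all types of domain elements inside a definition. The models here
  have a domain that is an arbitrary nonempty set of natural numbers; the lemma
  \<open>entails_sat_cq\<close> below shows that nothing is lost: an entailed query is true in
  every model over every type.\<close>

definition entails :: "ontology \<Rightarrow> data \<Rightarrow> cq \<Rightarrow> const list \<Rightarrow> bool" where
  "entails T D q as \<longleftrightarrow> (\<forall>I :: nat interp. is_model I T D \<longrightarrow> sat_cq I q as)"

datatype skolem = Con const | Sk nat skolem skolem var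

instance skolem :: countable
  by countable_datatype

primrec arg1 :: "'a atom \<Rightarrow> 'a" where
  "arg1 (Unary A s) = s"
| "arg1 (Binary P s t) = s"

primrec arg2 :: "'a atom \<Rightarrow> 'a" where
  "arg2 (Unary A s) = s"
| "arg2 (Binary P s t) = t"

lemma terms_of_args: "terms_of \<alpha> = {arg1 \<alpha>, arg2 \<alpha>}"
  by (cases \<alpha>) auto

lemma entails_sat_cq:
  fixes I :: "'d interp"
  assumes ent: "entails T D q as" and mod: "is_model I T D"
  shows "sat_cq I q as"
proof -
  define good where "good i d e s' \<longleftrightarrow> (\<forall>x. s' x \<in> univ I) \<and>
      s' (arg1 (body (T ! i))) = d \<and> s' (arg2 (body (T ! i))) = e \<and>
      (\<forall>\<psi>\<in>set (head (T ! i)). holds I s' \<psi>)" for i d e and s' :: "var \<Rightarrow> 'd"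
  define w where "w i d e = (if \<exists>s'. good i d e s' then SOME s'. good i d e s'
      else (\<lambda>_. cint I 0))" for i d e
  have w: "good i d e (w i d e)" if "good i d e s'" for i d e s'
    using that unfolding w_def by (metis someI)
  have cdom: "cint I c \<in> univ I" for c
    using mod by (auto simp: is_model_def is_interp_def)
  have wdom: "w i d e x \<in> univ I" for i d e x
  proof (cases "\<exists>s'. good i d e s'")
    case True
    then show ?thesis using w good_def by blast
  next
    case False
    then show ?thesis by (simp add: w_def cdom)
  qed
  define ev where "ev = rec_skolem (cint I) (\<lambda>i _ _ x d e. w i d e x)"
  have ev: "ev (Con c) = cint I c" "ev (Sk i t u x) = w i (ev t) (ev u) x" for c i t u x
    by (simp_all add: ev_def)
  have evdom: "ev t \<in> univ I" for t
    by (cases t) (simp_all add: ev cdom wdom)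
  define g where "g n = ev (from_nat n)" for n
  have g_to: "g (to_nat t) = ev t" for t
    by (simp add: g_def)
  define J where "J = \<lparr>univ = UNIV, cint = (\<lambda>c. to_nat (Con c)),
      uint = (\<lambda>A. {n. g n \<in> uint I A}), bint = (\<lambda>P. {(m, n). (g m, g n) \<in> bint I P})\<rparr>"
  have holdsJ: "holds J s \<alpha> \<longleftrightarrow> holds I (\<lambda>x. g (s x)) \<alpha>" for s and \<alpha> :: "nat atom"
    by (cases \<alpha>) (auto simp: J_def)
  have gc: "g (cint J c) = cint I c" for c
    by (simp add: J_def g_to ev)
  have domJ: "univ J = UNIV" by (simp add: J_def)
  have "sat_tgd J \<tau>" if \<tau>: "\<tau> \<in> set T" for \<tau>
    unfolding sat_tgd_def
  proof (intro allI impI, elim conjE)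
    fix s assume s: "holds J s (body \<tau>)"
    obtain i where i: "i < length T" "T ! i = \<tau>"
      using \<tau> by (metis in_set_conv_nth)
    let ?a = "arg1 (body \<tau>)" and ?b = "arg2 (body \<tau>)"
    have "\<forall>x. g (s x) \<in> univ I" by (simp add: g_def evdom)
    moreover have "holds I (\<lambda>x. g (s x)) (body \<tau>)" using s by (simp add: holdsJ)
    moreover have "sat_tgd I \<tau>" using mod \<tau> by (auto simp: is_model_def)
    ultimately obtain s' where s': "\<forall>x. s' x \<in> univ I" "\<forall>x\<in>terms_of (body \<tau>). s' x = g (s x)"
        "\<forall>\<psi>\<in>set (head \<tau>). holds I s' \<psi>"
      unfolding sat_tgd_def by (auto dest!: spec[of _ "\<lambda>x. g (s x)"])
    then have "good i (g (s ?a)) (g (s ?b)) s'"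
      by (simp add: good_def i terms_of_args)
    then have W: "good i (g (s ?a)) (g (s ?b)) (w i (g (s ?a)) (g (s ?b)))"
      by (rule w)
    define r where "r x = (if x \<in> terms_of (body \<tau>) then s x
        else to_nat (Sk i (from_nat (s ?a)) (from_nat (s ?b)) x))" for x
    have "g (r x) = w i (g (s ?a)) (g (s ?b)) x" for x
      using W unfolding r_def good_def
      by (auto simp: terms_of_args i g_to ev simp flip: g_def)
    then have "(\<lambda>x. g (r x)) = w i (g (s ?a)) (g (s ?b))" by blast
    then have "\<forall>\<psi>\<in>set (head \<tau>). holds J r \<psi>"
      using W unfolding holdsJ good_def i by simp
    then show "\<exists>s'. (\<forall>x. s' x \<in> univ J) \<and> (\<forall>x\<in>terms_of (body \<tau>). s' x = s x) \<and>
        (\<forall>\<psi>\<in>set (head \<tau>). holds J s' \<psi>)"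
      by (intro exI[of _ r]) (auto simp: domJ r_def)
  qed
  moreover have "\<forall>\<alpha>\<in>set D. holds J (cint J) \<alpha>"
    using mod by (simp add: holdsJ gc is_model_def)
  moreover have "is_interp J" by (auto simp: is_interp_def domJ)
  ultimately have "is_model J T D" by (simp add: is_model_def)
  then obtain s where s: "map s (ans_vars q) = map (cint J) as"
      "\<forall>\<alpha>\<in>set (atoms q). holds J s \<alpha>"
    using ent unfolding entails_def sat_cq_def by blast
  have "map g (map s (ans_vars q)) = map g (map (cint J) as)"
    using s(1) by (rule arg_cong)
  then have "map (\<lambda>x. g (s x)) (ans_vars q) = map (cint I) as"
    by (simp add: comp_def gc)
  moreover have "\<forall>x. g (s x) \<in> univ I" by (simp add: g_def evdom)
  ultimately show ?thesis
    using s(2) unfolding holdsJ sat_cq_def by (intro exI[of _ "\<lambda>x. g (s x)"]) simp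
qed

section \<open>Model of computation\<close>

text \<open>Programs are systems of mutually recursive first-order functions over binary trees (pure
  first-order Lisp with one atom), evaluated call-by-value at unit cost for each evaluated
  expression. As each step creates at most one new tree node, whose subtrees can be shared, a run
  of \<open>t\<close> steps is simulated by a Turing machine in time polynomial in \<open>t\<close> and the size of the input,
  and vice versa. See N. D. Jones, Computability and Complexity from a Programming Perspective.

  \<open>Arg i\<close> is the \<open>i\<close>-th argument of the function whose body is being evaluated; \<open>Call f es\<close> calls
  the \<open>f\<close>-th function of the program.\<close>

datatype tree = Lf | Nd tree tree

datatype expr =
    Arg nat
  | Leaf
  | Node expr expr
  | Left expr
  | Right expr
  | Cond expr expr expr
  | Call nat "expr list"

type_synonym program = "expr list"

primrec left :: "tree \<Rightarrow> tree" where
  "left Lf = Lf"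
| "left (Nd l r) = l"

primrec right :: "tree \<Rightarrow> tree" where
  "right Lf = Lf"
| "right (Nd l r) = r"

inductive eval :: "program \<Rightarrow> tree list \<Rightarrow> expr \<Rightarrow> tree \<Rightarrow> nat \<Rightarrow> bool"
  and evals :: "program \<Rightarrow> tree list \<Rightarrow> expr list \<Rightarrow> tree list \<Rightarrow> nat \<Rightarrow> bool"
  for \<Pi> :: program where
  eval_Arg: "i < length \<rho> \<Longrightarrow> eval \<Pi> \<rho> (Arg i) (\<rho> ! i) 1"
| eval_Leaf: "eval \<Pi> \<rho> Leaf Lf 1"
| eval_Node: "eval \<Pi> \<rho> a u m \<Longrightarrow> eval \<Pi> \<rho> b v n \<Longrightarrow> eval \<Pi> \<rho> (Node a b) (Nd u v) (m + n + 1)"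
| eval_Left: "eval \<Pi> \<rho> a u m \<Longrightarrow> eval \<Pi> \<rho> (Left a) (left u) (m + 1)"
| eval_Right: "eval \<Pi> \<rho> a u m \<Longrightarrow> eval \<Pi> \<rho> (Right a) (right u) (m + 1)"
| eval_Cond_Node: "eval \<Pi> \<rho> c u m \<Longrightarrow> u \<noteq> Lf \<Longrightarrow> eval \<Pi> \<rho> a v n \<Longrightarrow>
    eval \<Pi> \<rho> (Cond c a b) v (m + n + 1)"
| eval_Cond_Leaf: "eval \<Pi> \<rho> c Lf m \<Longrightarrow> eval \<Pi> \<rho> b v n \<Longrightarrow> eval \<Pi> \<rho> (Cond c a b) v (m + n + 1)"
| eval_Call: "evals \<Pi> \<rho> es us m \<Longrightarrow> f < length \<Pi> \<Longrightarrow> eval \<Pi> us (\<Pi> ! f) v n \<Longrightarrow>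
    eval \<Pi> \<rho> (Call f es) v (m + n + 1)"
| evals_Nil: "evals \<Pi> \<rho> [] [] 0"
| evals_Cons: "eval \<Pi> \<rho> e u m \<Longrightarrow> evals \<Pi> \<rho> es us n \<Longrightarrow> evals \<Pi> \<rho> (e # es) (u # us) (m + n)"

inductive_cases eval_elims:
  "eval \<Pi> \<rho> (Arg i) v t" "eval \<Pi> \<rho> Leaf v t" "eval \<Pi> \<rho> (Node a b) v t"
  "eval \<Pi> \<rho> (Left a) v t" "eval \<Pi> \<rho> (Right a) v t" "eval \<Pi> \<rho> (Cond c a b) v t"
  "eval \<Pi> \<rho> (Call f es) v t"
  "evals \<Pi> \<rho> [] us t" "evals \<Pi> \<rho> (e # es) us t"

lemma eval_deterministic:
  "eval \<Pi> \<rho> e v t \<Longrightarrow> eval \<Pi> \<rho> e v' t' \<Longrightarrow> v = v' \<and> t = t'"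
  "evals \<Pi> \<rho> es vs t \<Longrightarrow> evals \<Pi> \<rho> es vs' t' \<Longrightarrow> vs = vs' \<and> t = t'"
proof (induction arbitrary: v' t' and vs' t' rule: eval_evals.inducts)
  case (eval_Arg i \<rho>)
  from eval_Arg.prems show ?case by (rule eval_elims) simp
next
  case (eval_Leaf \<rho>)
  from eval_Leaf.prems show ?case by (rule eval_elims) simp
next
  case (eval_Node \<rho> a u m b v n)
  from eval_Node.prems show ?case
    by (rule eval_elims) (auto dest: eval_Node.IH(2,4))
next
  case (eval_Left \<rho> a u m)
  from eval_Left.prems show ?case
    by (rule eval_elims) (auto dest: eval_Left.IH(2))
next
  case (eval_Right \<rho> a u m)
  from eval_Right.prems show ?case
    by (rule eval_elims) (auto dest: eval_Right.IH(2))
next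
  case (eval_Cond_Node \<rho> c u m a v n b)
  from eval_Cond_Node.prems show ?case
    by (rule eval_elims) (use eval_Cond_Node.hyps in \<open>auto dest: eval_Cond_Node.IH(2,4)\<close>)
next
  case (eval_Cond_Leaf \<rho> c m b v n a)
  from eval_Cond_Leaf.prems show ?case
    by (rule eval_elims) (auto dest: eval_Cond_Leaf.IH(2,4))
next
  case (eval_Call \<rho> es us m f v n)
  from eval_Call.prems obtain us' m' n' where t: "t' = m' + n' + 1"
      and a: "evals \<Pi> \<rho> es us' m'" and b: "eval \<Pi> us' (\<Pi> ! f) v' n'"
    by (rule eval_elims) simp
  from eval_Call.IH(2)[OF a] have eq: "us = us'" "m = m'" by simp_all
  from eval_Call.IH(5) b eq have "v = v' \<and> n = n'" by simp
  with eq t show ?case by simp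
next
  case (evals_Nil \<rho>)
  from evals_Nil.prems show ?case by (rule eval_elims) simp
next
  case (evals_Cons \<rho> e u m es us n)
  from evals_Cons.prems show ?case
    by (rule eval_elims) (auto dest: evals_Cons.IH(2,4))
qed

text \<open>The main function is the one with index 0.\<close>

definition runs :: "program \<Rightarrow> tree \<Rightarrow> tree \<Rightarrow> nat \<Rightarrow> bool" where
  "runs \<Pi> x y t \<longleftrightarrow> eval \<Pi> [x] (Call 0 [Arg 0]) y t"

section \<open>Encodings\<close>

primrec tree_size :: "tree \<Rightarrow> nat" where
  "tree_size Lf = 1"
| "tree_size (Nd l r) = tree_size l + tree_size r + 1"

definition enc_bool :: "bool \<Rightarrow> tree" where
  "enc_bool b = (if b then Nd Lf Lf else Lf)"

primrec enc_unary :: "nat \<Rightarrow> tree" where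
  "enc_unary 0 = Lf"
| "enc_unary (Suc n) = Nd Lf (enc_unary n)"

text \<open>Names are written in binary, least significant bit first.\<close>

fun enc_nat :: "nat \<Rightarrow> tree" where
  "enc_nat n = (if n = 0 then Lf else Nd (enc_bool (odd n)) (enc_nat (n div 2)))"

declare enc_nat.simps [simp del]

primrec enc_list :: "('a \<Rightarrow> tree) \<Rightarrow> 'a list \<Rightarrow> tree" where
  "enc_list enc [] = Lf"
| "enc_list enc (x # xs) = Nd (enc x) (enc_list enc xs)"

primrec enc_atom :: "nat atom \<Rightarrow> tree" where
  "enc_atom (Unary A x) = Nd (enc_bool False) (Nd (enc_nat A) (enc_nat x))"
| "enc_atom (Binary P x y) = Nd (enc_bool True) (Nd (enc_nat P) (Nd (enc_nat x) (enc_nat y)))"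

definition enc_tgd :: "tgd \<Rightarrow> tree" where
  "enc_tgd \<tau> = Nd (enc_atom (body \<tau>)) (enc_list enc_atom (head \<tau>))"

definition enc_cq :: "cq \<Rightarrow> tree" where
  "enc_cq q = Nd (enc_list enc_nat (ans_vars q)) (enc_list enc_atom (atoms q))"

section \<open>Fixed-parameter tractability\<close>

definition computable :: "(nat \<Rightarrow> nat) \<Rightarrow> bool" where
  "computable f \<longleftrightarrow> (\<exists>\<Pi>. \<forall>k. \<exists>t. runs \<Pi> (enc_unary k) (enc_unary (f k)) t)"

text \<open>A parameterized decision problem is given by its set \<open>X\<close> of instances, the encoding \<open>enc\<close> of
  instances as inputs, the property \<open>Q\<close> to be decided and the parameter \<open>\<kappa>\<close>.\<close>

definition fixed_parameter_tractable ::
    "'i set \<Rightarrow> ('i \<Rightarrow> tree) \<Rightarrow> ('i \<Rightarrow> bool) \<Rightarrow> ('i \<Rightarrow> nat) \<Rightarrow> bool" where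
  "fixed_parameter_tractable X enc Q \<kappa> \<longleftrightarrow>
     (\<exists>\<Pi> f (p :: nat poly). computable f \<and>
       (\<forall>x\<in>X. \<exists>t. runs \<Pi> (enc x) (enc_bool (Q x)) t \<and>
          t \<le> f (\<kappa> x) * poly p (tree_size (enc x))))"

section \<open>Answering tree-shaped queries\<close>

type_synonym omq_instance = "cq \<times> ontology \<times> data \<times> const list"

definition tree_omq_instances :: "omq_instance set" where
  "tree_omq_instances = {(q, T, D, as). is_cq q \<and> tree_shaped q \<and> is_ontology T \<and>
     length as = length (ans_vars q) \<and> set as \<subseteq> ind D}"

definition enc_omq :: "omq_instance \<Rightarrow> tree" where
  "enc_omq = (\<lambda>(q, T, D, as). Nd (enc_cq q) (Nd (enc_list enc_tgd T)
     (Nd (enc_list enc_atom D) (enc_list enc_nat as))))"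

end

theory Submission
  imports Defs
begin

text \<open>The tgds have single-atom bodies and at most two variables, so the chase of the data is a forest of
  nulls hanging off the individuals, in which a null and the part below it are determined up to isomorphism
  by the tgd that created it. Hence all facts of the chase can be read off a finite structure of polynomial
  size, with one null per tgd in each of three levels that are passed through cyclically.

  A homomorphism \<open>h\<close> of a tree-shaped query into the chase can be simplified until no variable is left.
  Take a variable whose image is a null of maximal depth. Either some neighbour has the same image, or two
  neighbours are both sent to the parent of that null, or the variable is a leaf of the query. In the first
  two cases merge the two variables, which keeps the query a tree; in the third case eliminate the leaf.
  If all images are individuals, eliminate any leaf. Conversely, for given merges and a given elimination
  order, the existence of a homomorphism is decided in polynomial time by a semi-join program over the finite
  structure: a leaf is only ever joined with its parent, and the chain of null types found in this way
  unfolds in every model. The merges and the elimination order form a certificate whose size depends on the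
  query only, so all certificates can be tried.\<close>

section \<open>Programs with time bounds\<close>

text \<open>The finite structure is not a universal model. With A(x) -> EX y. P(x,y) and data A(a),
  A(b), the individuals a and b share one null in it, so P(a,z) & P(b,z) maps into it without being
  entailed. A node there may have several parents, and this dictates the direction of the joins. In
  an arbitrary model, an element that realizes the type of a null always has a successor realizing
  the type of each child that the chase provides; a step from a child to a parent recovers only the
  atoms of the creating tgd and says nothing about the type of the parent. Joins therefore fix the
  parent first and then find the child, which is the test \<open>oriented\<close> in
  \<open>compatible\<close>. Two query variables sitting at the parent of the same null would need
  two upward steps that agree, and this cannot be checked by joins; merging them beforehand removes
  the problem. A guessed merge is harmless for soundness, because a match of the merged query
  composed with the merge is a match of the original. Acyclicity enters in completeness, where it
  guarantees that merges and leaves can be found until the query is used up.\<close>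

primrec shift :: "nat \<Rightarrow> expr \<Rightarrow> expr" where
  "shift k (Arg i) = Arg i"
| "shift k Leaf = Leaf"
| "shift k (Node a b) = Node (shift k a) (shift k b)"
| "shift k (Left a) = Left (shift k a)"
| "shift k (Right a) = Right (shift k a)"
| "shift k (Cond c a b) = Cond (shift k c) (shift k a) (shift k b)"
| "shift k (Call f es) = Call (k + f) (map (shift k) es)"

text \<open>Calls name functions by absolute position, so a program placed behind
  \<open>\<Pi>'\<close> runs as before, with the same step count, once its calls are moved by
  \<open>length \<Pi>'\<close>.\<close>

lemma eval_shift:
  "eval \<Pi> \<rho> e v t \<Longrightarrow> eval (\<Pi>' @ map (shift (length \<Pi>')) \<Pi>) \<rho> (shift (length \<Pi>') e) v t"
  "evals \<Pi> \<rho> es vs t \<Longrightarrow>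
     evals (\<Pi>' @ map (shift (length \<Pi>')) \<Pi>) \<rho> (map (shift (length \<Pi>')) es) vs t"
proof (induction rule: eval_evals.inducts)
  case (eval_Call \<rho> es us m f v n)
  then show ?case
    using eval_evals.eval_Call[of "\<Pi>' @ map (shift (length \<Pi>')) \<Pi>" \<rho> "map (shift (length \<Pi>')) es" us m
        "length \<Pi>' + f" v n]
    by (simp add: nth_append)
qed (auto intro: eval_evals.intros simp del: One_nat_def add_Suc_right)

lemma eval_append:
  "eval \<Pi> \<rho> e v t \<Longrightarrow> eval (\<Pi> @ \<Pi>') \<rho> e v t"
  "evals \<Pi> \<rho> es vs t \<Longrightarrow> evals (\<Pi> @ \<Pi>') \<rho> es vs t"
proof (induction rule: eval_evals.inducts)
  case (eval_Call \<rho> es us m f v n)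
  then show ?case
    using eval_evals.eval_Call[of "\<Pi> @ \<Pi>'" \<rho> es us m f v n] by (simp add: nth_append)
qed (auto intro: eval_evals.intros simp del: One_nat_def add_Suc_right)

definition eval_within :: "program \<Rightarrow> tree list \<Rightarrow> expr \<Rightarrow> tree \<Rightarrow> nat \<Rightarrow> bool" where
  "eval_within \<Pi> \<rho> e v k \<longleftrightarrow> (\<exists>t\<le>k. eval \<Pi> \<rho> e v t)"

definition evals_within :: "program \<Rightarrow> tree list \<Rightarrow> expr list \<Rightarrow> tree list \<Rightarrow> nat \<Rightarrow> bool" where
  "evals_within \<Pi> \<rho> es vs k \<longleftrightarrow> (\<exists>t\<le>k. evals \<Pi> \<rho> es vs t)"

lemma eval_within_mono: "eval_within \<Pi> \<rho> e v m \<Longrightarrow> m \<le> n \<Longrightarrow> eval_within \<Pi> \<rho> e v n"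
  unfolding eval_within_def by (meson le_trans)

lemma eval_within_append: "eval_within \<Pi> \<rho> e v k \<Longrightarrow> eval_within (\<Pi> @ \<Pi>') \<rho> e v k"
  unfolding eval_within_def using eval_append by blast

lemma eval_within_shift:
  "eval_within \<Pi> \<rho> e v k \<Longrightarrow>
     eval_within (\<Pi>' @ map (shift (length \<Pi>')) \<Pi>) \<rho> (shift (length \<Pi>') e) v k"
  unfolding eval_within_def using eval_shift by blast

lemma within_Arg: "i < length \<rho> \<Longrightarrow> v = \<rho> ! i \<Longrightarrow> eval_within \<Pi> \<rho> (Arg i) v 1"
  unfolding eval_within_def using eval_Arg by blast

lemma within_Leaf: "eval_within \<Pi> \<rho> Leaf Lf 1"
  unfolding eval_within_def using eval_Leaf by blast

lemma within_Node:
  "eval_within \<Pi> \<rho> a u m \<Longrightarrow> eval_within \<Pi> \<rho> b v n \<Longrightarrow> eval_within \<Pi> \<rho> (Node a b) (Nd u v) (m + n + 1)"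
  unfolding eval_within_def by (metis add_le_mono eval_Node le_refl)

lemma within_Left: "eval_within \<Pi> \<rho> a u m \<Longrightarrow> eval_within \<Pi> \<rho> (Left a) (left u) (m + 1)"
  unfolding eval_within_def by (metis add_le_mono eval_Left le_refl)

lemma within_Right: "eval_within \<Pi> \<rho> a u m \<Longrightarrow> eval_within \<Pi> \<rho> (Right a) (right u) (m + 1)"
  unfolding eval_within_def by (metis add_le_mono eval_Right le_refl)

lemma within_Cond:
  assumes "eval_within \<Pi> \<rho> c u m" "eval_within \<Pi> \<rho> (if u = Lf then b else a) v n"
  shows "eval_within \<Pi> \<rho> (Cond c a b) v (m + n + 1)"
proof -
  from assms obtain t t' where t: "t \<le> m" "eval \<Pi> \<rho> c u t" "t' \<le> n"
      "eval \<Pi> \<rho> (if u = Lf then b else a) v t'"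
    unfolding eval_within_def by blast
  then have "eval \<Pi> \<rho> (Cond c a b) v (t + t' + 1)"
    using eval_Cond_Node[of \<Pi> \<rho> c u t a v t' b] eval_Cond_Leaf[of \<Pi> \<rho> c t b v t' a] by (cases "u = Lf") simp_all
  with t show ?thesis unfolding eval_within_def by (intro exI[of _ "t + t' + 1"]) simp
qed

lemma within_Nil: "evals_within \<Pi> \<rho> [] [] 0"
  unfolding evals_within_def using evals_Nil by blast

lemma within_Cons:
  "eval_within \<Pi> \<rho> e u m \<Longrightarrow> evals_within \<Pi> \<rho> es us n \<Longrightarrow> evals_within \<Pi> \<rho> (e # es) (u # us) (m + n)"
  unfolding eval_within_def evals_within_def by (metis add_le_mono evals_Cons)

lemma within_Call:
  "evals_within \<Pi> \<rho> es us m \<Longrightarrow> f < length \<Pi> \<Longrightarrow> eval_within \<Pi> us (\<Pi> ! f) v n \<Longrightarrow>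
     eval_within \<Pi> \<rho> (Call f es) v (m + n + 1)"
  unfolding eval_within_def evals_within_def by (metis add_le_mono eval_Call le_refl)

lemma within_Arg_0: "evals_within \<Pi> (x # \<rho>) [Arg 0] [x] 1"
  using within_Cons[OF within_Arg within_Nil, of 0 "x # \<rho>" x \<Pi>] by simp

lemmas within_intros = within_Arg within_Leaf within_Node within_Left within_Right within_Nil
  within_Cons

text \<open>Only unary functions are considered: several arguments, including the parameters of an
  iteration, are packed into one tree, so that all combinators compose unary functions.\<close>

definition computes_within :: "(tree \<Rightarrow> tree) \<Rightarrow> (tree \<Rightarrow> nat) \<Rightarrow> bool" where
  "computes_within F \<tau> \<longleftrightarrow> (\<exists>\<Pi> e. \<forall>x. eval_within \<Pi> [x] e (F x) (\<tau> x))"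

text \<open>Both programs are put side by side and their entry expressions are added as functions
  \<open>i\<close> and \<open>j\<close>. The arbitrary extension \<open>\<Pi>'\<close> leaves room
  for a further function that calls them, possibly recursively.\<close>

lemma computes_within_common:
  assumes "computes_within F \<sigma>" "computes_within G \<tau>"
  obtains \<Pi> i j where "i < length \<Pi>" "j < length \<Pi>"
    "\<And>\<Pi>' x. eval_within (\<Pi> @ \<Pi>') [x] (\<Pi> ! i) (F x) (\<sigma> x)"
    "\<And>\<Pi>' x. eval_within (\<Pi> @ \<Pi>') [x] (\<Pi> ! j) (G x) (\<tau> x)"
proof -
  from assms obtain \<Pi>1 e1 \<Pi>2 e2 where
    1: "\<And>x. eval_within \<Pi>1 [x] e1 (F x) (\<sigma> x)" and 2: "\<And>x. eval_within \<Pi>2 [x] e2 (G x) (\<tau> x)"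
    unfolding computes_within_def by metis
  define k where "k = length \<Pi>1"
  define \<Pi> where "\<Pi> = (\<Pi>1 @ map (shift k) \<Pi>2) @ [e1, shift k e2]"
  have "eval_within ((\<Pi>1 @ map (shift k) \<Pi>2) @ ([e1, shift k e2] @ \<Pi>')) [x] e1 (F x) (\<sigma> x)" for \<Pi>' x
    using 1 eval_within_append by simp
  moreover have "eval_within ((\<Pi>1 @ map (shift k) \<Pi>2) @ ([e1, shift k e2] @ \<Pi>')) [x] (shift k e2) (G x) (\<tau> x)"
    for \<Pi>' x
    unfolding k_def by (rule eval_within_append, rule eval_within_shift, rule 2)
  moreover have "\<Pi> ! (length \<Pi> - 2) = e1" "\<Pi> ! (length \<Pi> - 1) = shift k e2"
    by (simp_all add: \<Pi>_def nth_append)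
  ultimately show ?thesis
    by (intro that[of "length \<Pi> - 2" \<Pi> "length \<Pi> - 1"]) (simp_all add: \<Pi>_def)
qed

lemma computes_within_runs:
  assumes "computes_within F \<tau>"
  shows "\<exists>\<Pi>. \<forall>x. \<exists>t\<le>\<tau> x + 2. runs \<Pi> x (F x) t"
proof -
  from assms obtain \<Pi> e where e: "\<And>x. eval_within \<Pi> [x] e (F x) (\<tau> x)"
    unfolding computes_within_def by metis
  \<comment> \<open>The main function must have index 0, so the entry expression goes in front and
    everything moves by one. The two extra steps are the outer call and its argument.\<close>
  define \<Pi>' where "\<Pi>' = [shift 1 e] @ map (shift 1) \<Pi>"
  have "eval_within \<Pi>' [x] (Call 0 [Arg 0]) (F x) (1 + \<tau> x + 1)" for x
  proof (rule within_Call[OF within_Arg_0])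
    show "eval_within \<Pi>' [x] (\<Pi>' ! 0) (F x) (\<tau> x)"
      using eval_within_shift[OF e, of "[shift 1 e]"] by (simp add: \<Pi>'_def)
  qed (simp add: \<Pi>'_def)
  then have "eval_within \<Pi>' [x] (Call 0 [Arg 0]) (F x) (\<tau> x + 2)" for x by simp
  then show ?thesis unfolding eval_within_def runs_def by blast
qed

lemma computes_id: "computes_within (\<lambda>x. x) (\<lambda>x. 1)"
  unfolding computes_within_def by (intro exI[of _ "[]"] exI[of _ "Arg 0"] allI within_Arg) auto

lemma computes_left: "computes_within left (\<lambda>x. 2)"
proof -
  have "eval_within [] [x] (Left (Arg 0)) (left x) (1 + 1)" for x
    by (intro within_intros) auto
  then show ?thesis unfolding computes_within_def by (metis one_add_one)
qed

lemma computes_right: "computes_within right (\<lambda>x. 2)"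
proof -
  have "eval_within [] [x] (Right (Arg 0)) (right x) (1 + 1)" for x
    by (intro within_intros) auto
  then show ?thesis unfolding computes_within_def by (metis one_add_one)
qed

lemma computes_Lf: "computes_within (\<lambda>x. Lf) (\<lambda>x. 1)"
  unfolding computes_within_def by (intro exI[of _ "[]"] exI[of _ "Leaf"] allI within_Leaf)

text \<open>Condition and branches arrive already evaluated in one packed tree. The cost of a
  conditional is thus the sum over both branches, which does no harm to polynomial bounds.\<close>

definition tree_if :: "tree \<Rightarrow> tree" where
  "tree_if x = (if left x = Lf then right (right x) else left (right x))"

lemma computes_tree_if: "computes_within tree_if (\<lambda>x. 6)"
proof -
  have "eval_within [] [x] (Cond (Left (Arg 0)) (Left (Right (Arg 0))) (Right (Right (Arg 0))))
      (tree_if x) ((1 + 1) + (1 + 1 + 1) + 1)" for x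
  proof (rule within_Cond)
    show "eval_within [] [x] (Left (Arg 0)) (left x) (1 + 1)" by (intro within_intros) auto
    have "eval_within [] [x] (Left (Right (Arg 0))) (left (right x)) (1 + 1 + 1)"
      "eval_within [] [x] (Right (Right (Arg 0))) (right (right x)) (1 + 1 + 1)"
      by (intro within_intros; simp)+
    then show "eval_within [] [x] (if left x = Lf then Right (Right (Arg 0)) else Left (Right (Arg 0)))
        (tree_if x) (1 + 1 + 1)" by (simp add: tree_if_def)
  qed
  then have "eval_within [] [x] (Cond (Left (Arg 0)) (Left (Right (Arg 0))) (Right (Right (Arg 0))))
      (tree_if x) 6" for x by (rule eval_within_mono) simp
  then show ?thesis unfolding computes_within_def by blast
qed

lemma computes_Nd:
  assumes "computes_within F \<sigma>" "computes_within G \<tau>"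
  shows "computes_within (\<lambda>x. Nd (F x) (G x)) (\<lambda>x. \<sigma> x + \<tau> x + 5)"
proof -
  from assms obtain \<Pi> i j where \<Pi>: "i < length \<Pi>" "j < length \<Pi>"
    "\<And>\<Pi>' x. eval_within (\<Pi> @ \<Pi>') [x] (\<Pi> ! i) (F x) (\<sigma> x)"
    "\<And>\<Pi>' x. eval_within (\<Pi> @ \<Pi>') [x] (\<Pi> ! j) (G x) (\<tau> x)"
    by (rule computes_within_common) blast
  have "eval_within \<Pi> [x] (Node (Call i [Arg 0]) (Call j [Arg 0])) (Nd (F x) (G x))
      ((1 + \<sigma> x + 1) + (1 + \<tau> x + 1) + 1)" for x
    using \<Pi>(1,2) \<Pi>(3)[of "[]" x] \<Pi>(4)[of "[]" x]
    by (intro within_Node within_Call[OF within_Arg_0]) simp_all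
  then have "eval_within \<Pi> [x] (Node (Call i [Arg 0]) (Call j [Arg 0])) (Nd (F x) (G x))
      (\<sigma> x + \<tau> x + 5)" for x by (rule eval_within_mono) simp
  then show ?thesis unfolding computes_within_def by blast
qed

lemma computes_comp:
  assumes "computes_within F \<sigma>" "computes_within G \<tau>"
  shows "computes_within (\<lambda>x. G (F x)) (\<lambda>x. \<sigma> x + \<tau> (F x) + 3)"
proof -
  from assms obtain \<Pi> i j where \<Pi>: "i < length \<Pi>" "j < length \<Pi>"
    "\<And>\<Pi>' x. eval_within (\<Pi> @ \<Pi>') [x] (\<Pi> ! i) (F x) (\<sigma> x)"
    "\<And>\<Pi>' x. eval_within (\<Pi> @ \<Pi>') [x] (\<Pi> ! j) (G x) (\<tau> x)"
    by (rule computes_within_common) blast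
  have "eval_within \<Pi> [x] (Call j [Call i [Arg 0]]) (G (F x))
      (((1 + \<sigma> x + 1) + 0) + \<tau> (F x) + 1)" for x
  proof (rule within_Call)
    show "evals_within \<Pi> [x] [Call i [Arg 0]] [F x] ((1 + \<sigma> x + 1) + 0)"
      using \<Pi>(1) \<Pi>(3)[of "[]" x]
      by (intro within_Cons within_Nil within_Call[OF within_Arg_0]) simp_all
  qed (use \<Pi> \<Pi>(4)[of "[]" "F x"] in auto)
  then have "eval_within \<Pi> [x] (Call j [Call i [Arg 0]]) (G (F x)) (\<sigma> x + \<tau> (F x) + 3)" for x
    by (rule eval_within_mono) simp
  then show ?thesis unfolding computes_within_def by blast
qed

text \<open>The recursion scheme behind all iterations: the tree is read as a list along its right
  spine, and \<open>p\<close> is a parameter handed to every step. The step function receives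
  element, accumulator and parameter packed as \<open>Nd a (Nd acc p)\<close>.\<close>

fun tree_fold :: "(tree \<Rightarrow> tree) \<Rightarrow> (tree \<Rightarrow> tree) \<Rightarrow> tree \<Rightarrow> tree \<Rightarrow> tree" where
  "tree_fold B S p Lf = B p"
| "tree_fold B S p (Nd a l) = S (Nd a (Nd (tree_fold B S p l) p))"

text \<open>Besides the step function, the program in \<open>computes_fold\<close> spends 12 steps
  on a list cell and 4 on the base case; 20 is a round bound for both.\<close>

fun tree_fold_time ::
    "(tree \<Rightarrow> tree) \<Rightarrow> (tree \<Rightarrow> tree) \<Rightarrow> (tree \<Rightarrow> nat) \<Rightarrow> (tree \<Rightarrow> nat) \<Rightarrow> tree \<Rightarrow> tree \<Rightarrow> nat" where
  "tree_fold_time B S \<beta> \<sigma> p Lf = \<beta> p + 20"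
| "tree_fold_time B S \<beta> \<sigma> p (Nd a l) =
     tree_fold_time B S \<beta> \<sigma> p l + \<sigma> (Nd a (Nd (tree_fold B S p l) p)) + 20"

lemma computes_fold:
  assumes "computes_within B \<beta>" "computes_within S \<sigma>"
  shows "computes_within (\<lambda>x. tree_fold B S (right x) (left x))
    (\<lambda>x. tree_fold_time B S \<beta> \<sigma> (right x) (left x) + 5)"
proof -
  from assms obtain \<Pi>0 i j where \<Pi>0: "i < length \<Pi>0" "j < length \<Pi>0"
    "\<And>\<Pi>' x. eval_within (\<Pi>0 @ \<Pi>') [x] (\<Pi>0 ! i) (B x) (\<beta> x)"
    "\<And>\<Pi>' x. eval_within (\<Pi>0 @ \<Pi>') [x] (\<Pi>0 ! j) (S x) (\<sigma> x)"
    by (rule computes_within_common) blast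
  define f where "f = length \<Pi>0"
  \<comment> \<open>\<open>f\<close> is the position that \<open>e\<close> itself takes at the end
    of \<open>\<Pi>\<close>, so \<open>Call f\<close> is the recursive call.\<close>
  define e where "e = Cond (Arg 0)
      (Call j [Node (Left (Arg 0)) (Node (Call f [Right (Arg 0), Arg 1]) (Arg 1))])
      (Call i [Arg 1])"
  define \<Pi> where "\<Pi> = \<Pi>0 @ [e]"
  have f: "f < length \<Pi>" "\<Pi> ! f = e" by (simp_all add: f_def \<Pi>_def)
  have i: "i < length \<Pi>" "\<And>x. eval_within \<Pi> [x] (\<Pi> ! i) (B x) (\<beta> x)"
    using \<Pi>0 by (simp_all add: \<Pi>_def nth_append)
  have j: "j < length \<Pi>" "\<And>x. eval_within \<Pi> [x] (\<Pi> ! j) (S x) (\<sigma> x)"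
    using \<Pi>0 by (simp_all add: \<Pi>_def nth_append)
  have main: "eval_within \<Pi> [l, p] e (tree_fold B S p l) (tree_fold_time B S \<beta> \<sigma> p l)" for l p
  proof (induction l)
    case Lf
    have "evals_within \<Pi> [Lf, p] [Arg 1] [p] (1 + 0)"
      by (intro within_Cons within_Nil within_Arg) simp_all
    from within_Call[OF this i]
    have "eval_within \<Pi> [Lf, p] e (B p) (1 + ((1 + 0) + \<beta> p + 1) + 1)"
      unfolding e_def by (intro within_Cond[OF within_Arg[OF _ refl]]) simp_all
    then show ?case by (auto elim: eval_within_mono)
  next
    case (Nd a l)
    have 1: "eval_within \<Pi> [Nd a l, p] (Call f [Right (Arg 0), Arg 1]) (tree_fold B S p l)
       (((1 + 1) + (1 + 0)) + tree_fold_time B S \<beta> \<sigma> p l + 1)"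
    proof (rule within_Call)
      show "evals_within \<Pi> [Nd a l, p] [Right (Arg 0), Arg 1] [l, p] ((1 + 1) + (1 + 0))"
        using within_Right[OF within_Arg[of 0 "[Nd a l, p]" "Nd a l" \<Pi>]]
        by (intro within_Cons within_Nil within_Arg) simp_all
    qed (use f Nd.IH(2) in auto)
    have 2: "eval_within \<Pi> [Nd a l, p] (Left (Arg 0)) a (1 + 1)"
      using within_Left[OF within_Arg[of 0 "[Nd a l, p]" "Nd a l" \<Pi>]] by simp
    let ?n = "(1 + 1) + ((((1 + 1) + (1 + 0)) + tree_fold_time B S \<beta> \<sigma> p l + 1) + 1 + 1) + 1 + 0"
    have "eval_within \<Pi> [Nd a l, p]
       (Call j [Node (Left (Arg 0)) (Node (Call f [Right (Arg 0), Arg 1]) (Arg 1))])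
       (S (Nd a (Nd (tree_fold B S p l) p)))
       (?n + \<sigma> (Nd a (Nd (tree_fold B S p l) p)) + 1)"
      by (rule within_Call[OF _ j(1) j(2)], rule within_Cons[OF _ within_Nil],
          rule within_Node[OF 2], rule within_Node[OF 1], rule within_Arg) simp_all
    then have "eval_within \<Pi> [Nd a l, p] e (S (Nd a (Nd (tree_fold B S p l) p)))
       (1 + (?n + \<sigma> (Nd a (Nd (tree_fold B S p l) p)) + 1) + 1)"
      unfolding e_def by (intro within_Cond[OF within_Arg[OF _ refl]]) simp_all
    then show ?case by (auto elim: eval_within_mono)
  qed
  have "eval_within \<Pi> [x] (Call f [Left (Arg 0), Right (Arg 0)]) (tree_fold B S (right x) (left x))
      (((1 + 1) + ((1 + 1) + 0)) + tree_fold_time B S \<beta> \<sigma> (right x) (left x) + 1)" for x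
  proof (rule within_Call[OF _ f(1)])
    show "evals_within \<Pi> [x] [Left (Arg 0), Right (Arg 0)] [left x, right x] ((1 + 1) + ((1 + 1) + 0))"
      by (intro within_intros) auto
  qed (use f main in simp)
  then have "eval_within \<Pi> [x] (Call f [Left (Arg 0), Right (Arg 0)]) (tree_fold B S (right x) (left x))
      (tree_fold_time B S \<beta> \<sigma> (right x) (left x) + 5)" for x by (rule eval_within_mono) simp
  then show ?thesis unfolding computes_within_def by blast
qed

text \<open>Comparison descends into both subtrees and is thus no fold along a list; it gets its own
  program. The recursion follows the left tree, whose size alone bounds the time.\<close>

lemma computes_eq:
  "computes_within (\<lambda>x. enc_bool (left x = right x)) (\<lambda>x. 20 * tree_size (left x) + 20)"
proof -
  define e where "e = Cond (Arg 0)
      (Cond (Arg 1) (Cond (Call 0 [Left (Arg 0), Left (Arg 1)]) (Call 0 [Right (Arg 0), Right (Arg 1)]) Leaf) Leaf)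
      (Cond (Arg 1) Leaf (Node Leaf Leaf))"
  define \<Pi> where "\<Pi> = [e]"
  have arg: "eval_within \<Pi> [a, b] (Arg 0) a 1" "eval_within \<Pi> [a, b] (Arg 1) b 1" for a b
    by (rule within_Arg; simp)+
  have call: "eval_within \<Pi> \<rho> (Call 0 [c, d]) (enc_bool (a = b)) (n + 5)"
    if "eval_within \<Pi> [a, b] e (enc_bool (a = b)) n"
      "eval_within \<Pi> \<rho> c a 2" "eval_within \<Pi> \<rho> d b 2" for a b n \<rho> c d
  proof -
    have "eval_within \<Pi> \<rho> (Call 0 [c, d]) (enc_bool (a = b)) ((2 + (2 + 0)) + n + 1)"
      by (rule within_Call[OF within_Cons[OF that(2) within_Cons[OF that(3) within_Nil]]])
        (use that in \<open>simp_all add: \<Pi>_def\<close>)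
    then show ?thesis by (rule eval_within_mono) simp
  qed
  have main: "eval_within \<Pi> [a, b] e (enc_bool (a = b)) (20 * tree_size a)" for a b
  proof (induction a arbitrary: b)
    case Lf
    have "eval_within \<Pi> [Lf, b] e (enc_bool (Lf = b)) (1 + (1 + 3 + 1) + 1)"
      unfolding e_def
    proof (rule within_Cond[OF arg(1)], simp only: refl if_True, rule within_Cond[OF arg(2)])
      have "eval_within \<Pi> [Lf, b] (Node Leaf Leaf) (Nd Lf Lf) (1 + 1 + 1)"
        by (intro within_Node within_Leaf)
      then show "eval_within \<Pi> [Lf, b] (if b = Lf then Node Leaf Leaf else Leaf) (enc_bool (Lf = b)) 3"
        using eval_within_mono[OF within_Leaf, of 3 \<Pi> "[Lf, b]"] by (auto simp: enc_bool_def numeral_eq_Suc)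
    qed
    then show ?case by (rule eval_within_mono) simp
  next
    case (Nd a1 a2)
    show ?case
    proof (cases b)
      case Lf
      have "eval_within \<Pi> [Nd a1 a2, b] e (enc_bool (Nd a1 a2 = b)) (1 + (1 + 1 + 1) + 1)"
        unfolding e_def Lf
        by (rule within_Cond[OF arg(1)], simp only: tree.distinct if_False, rule within_Cond[OF arg(2)])
          (auto simp: enc_bool_def intro: within_Leaf[unfolded One_nat_def])
      then show ?thesis by (rule eval_within_mono) simp
    next
      case b: (Nd b1 b2)
      have l: "eval_within \<Pi> [Nd a1 a2, b] (Left (Arg 0)) a1 2" "eval_within \<Pi> [Nd a1 a2, b] (Left (Arg 1)) b1 2"
        "eval_within \<Pi> [Nd a1 a2, b] (Right (Arg 0)) a2 2" "eval_within \<Pi> [Nd a1 a2, b] (Right (Arg 1)) b2 2"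
        using within_Left[OF arg(1)[of "Nd a1 a2" b]] within_Left[OF arg(2)[of "Nd a1 a2" b]]
          within_Right[OF arg(1)[of "Nd a1 a2" b]] within_Right[OF arg(2)[of "Nd a1 a2" b]]
        by (simp_all add: b numeral_2_eq_2)
      note c1 = call[OF Nd.IH(1)[of b1] l(1) l(2)] and c2 = call[OF Nd.IH(2)[of b2] l(3) l(4)]
      have 3: "eval_within \<Pi> [Nd a1 a2, b]
          (Cond (Call 0 [Left (Arg 0), Left (Arg 1)]) (Call 0 [Right (Arg 0), Right (Arg 1)]) Leaf)
          (enc_bool (Nd a1 a2 = b)) (20 * tree_size a1 + 5 + (20 * tree_size a2 + 5) + 1)"
      proof (rule within_Cond[OF c1])
        show "eval_within \<Pi> [Nd a1 a2, b]
           (if enc_bool (a1 = b1) = Lf then Leaf else Call 0 [Right (Arg 0), Right (Arg 1)])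
           (enc_bool (Nd a1 a2 = b)) (20 * tree_size a2 + 5)"
          using c2 eval_within_mono[OF within_Leaf, of "20 * tree_size a2 + 5" \<Pi> "[Nd a1 a2, b]"]
          by (auto simp: enc_bool_def b)
      qed
      have "eval_within \<Pi> [Nd a1 a2, b] e (enc_bool (Nd a1 a2 = b))
          (1 + (1 + (20 * tree_size a1 + 5 + (20 * tree_size a2 + 5) + 1) + 1) + 1)"
        unfolding e_def
        by (rule within_Cond[OF arg(1)], simp only: tree.distinct if_False, rule within_Cond[OF arg(2)])
          (use 3 in \<open>simp add: b\<close>)
      then show ?thesis by (rule eval_within_mono) simp
    qed
  qed
  have "eval_within \<Pi> [x] (Call 0 [Left (Arg 0), Right (Arg 0)]) (enc_bool (left x = right x))
      (20 * tree_size (left x) + 5)" for x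
    using within_Left[OF within_Arg[of 0 "[x]" x \<Pi>]] within_Right[OF within_Arg[of 0 "[x]" x \<Pi>]]
    by (intro call main) (simp_all add: numeral_2_eq_2)
  then have "eval_within \<Pi> [x] (Call 0 [Left (Arg 0), Right (Arg 0)]) (enc_bool (left x = right x))
      (20 * tree_size (left x) + 20)" for x
    by (rule eval_within_mono) simp
  then show ?thesis unfolding computes_within_def by blast
qed

section \<open>Polynomial time\<close>

text \<open>The base \<open>A\<close> is the input size for polynomial time; for fixed-parameter tractability it is the
  input size times a function of the parameter.\<close>

definition poly_bounded :: "(tree \<Rightarrow> nat) \<Rightarrow> (tree \<Rightarrow> nat) \<Rightarrow> bool" where
  "poly_bounded A h \<longleftrightarrow> (\<exists>c. \<forall>x. h x \<le> A x ^ c)"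

text \<open>The added 2 keeps the base at least 2. Constants and sums are then absorbed by a larger
  exponent, and polynomial bounds can be bare powers without coefficients.\<close>

definition input_size :: "tree \<Rightarrow> nat" where
  "input_size x = tree_size x + 2"

definition dominates_size :: "(tree \<Rightarrow> nat) \<Rightarrow> bool" where
  "dominates_size A \<longleftrightarrow> (\<forall>x. input_size x \<le> A x)"

lemma dominates_size_input_size [simp]: "dominates_size input_size"
  by (simp add: dominates_size_def)

lemma dominates_size_ge_2: "dominates_size A \<Longrightarrow> 2 \<le> A x"
  unfolding dominates_size_def input_size_def by (metis add_leD2)

lemma power_add_le:
  fixes a :: nat
  assumes "2 \<le> a"
  shows "a ^ c + a ^ d \<le> a ^ (c + d + 1)"
proof -
  have "a ^ c \<le> a ^ (c + d)" "a ^ d \<le> a ^ (c + d)"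
    using assms by (auto intro!: power_increasing)
  then have "a ^ c + a ^ d \<le> 2 * a ^ (c + d)" by simp
  also have "\<dots> \<le> a * a ^ (c + d)" using assms by (intro mult_right_mono) auto
  finally show ?thesis by simp
qed

lemma poly_bounded_mono: "poly_bounded A h \<Longrightarrow> (\<And>x. g x \<le> h x) \<Longrightarrow> poly_bounded A g"
  unfolding poly_bounded_def by (meson le_trans)

lemma poly_bounded_const:
  assumes "dominates_size A"
  shows "poly_bounded A (\<lambda>x. k)"
  unfolding poly_bounded_def
proof (intro exI[of _ k] allI)
  fix x
  have "k \<le> 2 ^ k" by (simp add: less_imp_le)
  also have "\<dots> \<le> A x ^ k" using dominates_size_ge_2[OF assms] by (rule power_mono) simp
  finally show "k \<le> A x ^ k" .
qed

lemma poly_bounded_add: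
  assumes "dominates_size A" "poly_bounded A g" "poly_bounded A h"
  shows "poly_bounded A (\<lambda>x. g x + h x)"
proof -
  from assms obtain c d where "\<And>x. g x \<le> A x ^ c" "\<And>x. h x \<le> A x ^ d"
    unfolding poly_bounded_def by blast
  then have "g x + h x \<le> A x ^ (c + d + 1)" for x
    using power_add_le[OF dominates_size_ge_2[OF assms(1)], of x c d] by (meson add_le_mono le_trans)
  then show ?thesis unfolding poly_bounded_def by blast
qed

lemma poly_bounded_mult:
  assumes "poly_bounded A g" "poly_bounded A h"
  shows "poly_bounded A (\<lambda>x. g x * h x)"
proof -
  from assms obtain c d where "\<And>x. g x \<le> A x ^ c" "\<And>x. h x \<le> A x ^ d"
    unfolding poly_bounded_def by blast
  then have "g x * h x \<le> A x ^ (c + d)" for x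
    by (simp add: power_add mult_le_mono)
  then show ?thesis unfolding poly_bounded_def by blast
qed

lemma poly_bounded_power:
  assumes "poly_bounded A g"
  shows "poly_bounded A (\<lambda>x. g x ^ k)"
proof -
  from assms obtain c where "\<And>x. g x \<le> A x ^ c"
    unfolding poly_bounded_def by blast
  then have "g x ^ k \<le> A x ^ (c * k)" for x
    by (simp add: power_mult power_mono)
  then show ?thesis unfolding poly_bounded_def by blast
qed

lemma poly_bounded_size: "dominates_size A \<Longrightarrow> poly_bounded A tree_size"
  unfolding poly_bounded_def dominates_size_def input_size_def
  by (intro exI[of _ 1]) (metis add_leD1 power_one_right)

lemma poly_bounded_comp:
  assumes A: "dominates_size A" and h: "poly_bounded input_size h"
    and F: "poly_bounded A (\<lambda>x. tree_size (F x))"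
  shows "poly_bounded A (\<lambda>x. h (F x))"
proof -
  from h obtain c where c: "\<And>x. h x \<le> input_size x ^ c" unfolding poly_bounded_def by blast
  have "poly_bounded A (\<lambda>x. (tree_size (F x) + 2) ^ c)"
    by (intro poly_bounded_power poly_bounded_add[OF A F] poly_bounded_const A)
  then show ?thesis by (rule poly_bounded_mono) (use c in \<open>simp add: input_size_def\<close>)
qed

text \<open>The output size is a separate demand because it does not follow from the running time:
  subtrees are shared, and a run of n doubling steps yields a tree of size exponential in n.\<close>

definition tractable :: "(tree \<Rightarrow> nat) \<Rightarrow> (tree \<Rightarrow> tree) \<Rightarrow> bool" where
  "tractable A F \<longleftrightarrow>
     (\<exists>\<tau>. computes_within F \<tau> \<and> poly_bounded A \<tau>) \<and> poly_bounded A (\<lambda>x. tree_size (F x))"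

definition ptime :: "(tree \<Rightarrow> tree) \<Rightarrow> bool" where
  "ptime F \<longleftrightarrow> tractable input_size F"

text \<open>The outer function has to be polynomial in its own input, whose size is polynomial in
  \<open>A\<close>. Tractability relative to \<open>A\<close> would bound it by
  \<open>A (F x)\<close>, about which nothing is known.\<close>

lemma tractable_comp:
  assumes A: "dominates_size A" and G: "ptime G" and F: "tractable A F"
  shows "tractable A (\<lambda>x. G (F x))"
proof -
  from F obtain \<sigma> where F: "computes_within F \<sigma>" "poly_bounded A \<sigma>" "poly_bounded A (\<lambda>x. tree_size (F x))"
    unfolding tractable_def by blast
  from G obtain \<tau> where G: "computes_within G \<tau>" "poly_bounded input_size \<tau>"
      "poly_bounded input_size (\<lambda>x. tree_size (G x))"
    unfolding ptime_def tractable_def by blast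
  show ?thesis unfolding tractable_def
    by (intro conjI exI[of _ "\<lambda>x. \<sigma> x + \<tau> (F x) + 3"] computes_comp[OF F(1) G(1)] poly_bounded_add A F(2)
        poly_bounded_comp[OF A G(2) F(3)] poly_bounded_const[OF A] poly_bounded_comp[OF A G(3) F(3)])
qed

lemma tractable_Nd:
  assumes A: "dominates_size A" and "tractable A F" "tractable A G"
  shows "tractable A (\<lambda>x. Nd (F x) (G x))"
proof -
  from assms obtain \<sigma> where F: "computes_within F \<sigma>" "poly_bounded A \<sigma>" "poly_bounded A (\<lambda>x. tree_size (F x))"
    unfolding tractable_def by blast
  from assms obtain \<tau> where G: "computes_within G \<tau>" "poly_bounded A \<tau>" "poly_bounded A (\<lambda>x. tree_size (G x))"
    unfolding tractable_def by blast
  have "poly_bounded A (\<lambda>x. \<sigma> x + \<tau> x + 5)"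
    by (intro poly_bounded_add[OF A] poly_bounded_const A F G)
  moreover have "poly_bounded A (\<lambda>x. tree_size (F x) + tree_size (G x) + 1)"
    by (intro poly_bounded_add[OF A] poly_bounded_const A F G)
  ultimately show ?thesis unfolding tractable_def using computes_Nd[OF F(1) G(1)] by auto
qed

lemma tractable_id: "dominates_size A \<Longrightarrow> tractable A (\<lambda>x. x)"
  unfolding tractable_def
  by (intro conjI exI[of _ "\<lambda>x. 1"] computes_id poly_bounded_const poly_bounded_size)

lemma ptime_comp: "ptime G \<Longrightarrow> ptime F \<Longrightarrow> ptime (\<lambda>x. G (F x))"
  using tractable_comp unfolding ptime_def by simp

lemma ptime_imp_tractable: "dominates_size A \<Longrightarrow> ptime F \<Longrightarrow> tractable A F"
  by (rule tractable_comp[OF _ _ tractable_id])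

lemma ptime_id: "ptime (\<lambda>x. x)"
  unfolding ptime_def by (simp add: tractable_id)

lemma ptime_Nd: "ptime F \<Longrightarrow> ptime G \<Longrightarrow> ptime (\<lambda>x. Nd (F x) (G x))"
  using tractable_Nd unfolding ptime_def by simp

lemma ptime_const: "ptime (\<lambda>x. c)"
proof (induction c)
  case Lf
  then show ?case
    unfolding ptime_def tractable_def
    by (intro conjI exI[of _ "\<lambda>x. 1"] computes_Lf poly_bounded_const) simp_all
qed (rule ptime_Nd)

lemma tree_size_left: "tree_size (left x) \<le> tree_size x"
  by (cases x) auto

lemma tree_size_right: "tree_size (right x) \<le> tree_size x"
  by (cases x) auto

lemma ptime_of_size_le:
  "computes_within F (\<lambda>x. k) \<Longrightarrow> (\<And>x. tree_size (F x) \<le> tree_size x) \<Longrightarrow> ptime F"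
  unfolding ptime_def tractable_def
  by (intro conjI exI[of _ "\<lambda>x. k"] poly_bounded_const poly_bounded_mono[OF poly_bounded_size]) simp_all

lemma ptime_left: "ptime F \<Longrightarrow> ptime (\<lambda>x. left (F x))"
  by (rule ptime_comp[OF ptime_of_size_le[OF computes_left tree_size_left]])

lemma ptime_right: "ptime F \<Longrightarrow> ptime (\<lambda>x. right (F x))"
  by (rule ptime_comp[OF ptime_of_size_le[OF computes_right tree_size_right]])

lemma ptime_tree_if: "ptime F \<Longrightarrow> ptime (\<lambda>x. tree_if (F x))"
proof (rule ptime_comp[OF ptime_of_size_le[OF computes_tree_if]])
  fix x
  show "tree_size (tree_if x) \<le> tree_size x"
    unfolding tree_if_def using tree_size_left[of "right x"] tree_size_right[of "right x"] tree_size_right[of x]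
    by auto
qed

section \<open>Lists coded along the right spine of trees, and bounded iteration over them\<close>

primrec to_list :: "tree \<Rightarrow> tree list" where
  "to_list Lf = []"
| "to_list (Nd a l) = a # to_list l"

primrec of_list :: "tree list \<Rightarrow> tree" where
  "of_list [] = Lf"
| "of_list (a # l) = Nd a (of_list l)"

lemma to_list_of_list [simp]: "to_list (of_list l) = l"
  by (induction l) auto

lemma of_list_to_list [simp]: "of_list (to_list t) = t"
  by (induction t) auto

lemma of_list_eq_Lf_iff [simp]: "of_list l = Lf \<longleftrightarrow> l = []"
  by (cases l) auto

lemma tree_size_pos: "1 \<le> tree_size t"
  by (cases t) auto

lemma tree_size_of_list: "tree_size (of_list l) = (\<Sum>a\<leftarrow>l. tree_size a + 1) + 1"
  by (induction l) auto

lemma tree_size_of_list_append: "tree_size (of_list (k @ l)) + 1 = tree_size (of_list k) + tree_size (of_list l)"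
  by (simp add: tree_size_of_list)

lemma tree_size_member: "a \<in> set l \<Longrightarrow> tree_size a \<le> tree_size (of_list l)"
  by (induction l) auto

lemma length_le_tree_size: "length l \<le> tree_size (of_list l)"
  by (induction l) auto

lemma tree_size_of_list_le:
  "(\<And>a. a \<in> set l \<Longrightarrow> tree_size a \<le> m) \<Longrightarrow> tree_size (of_list l) \<le> length l * (m + 1) + 1"
proof (induction l)
  case (Cons a l)
  then have "tree_size (of_list l) \<le> length l * (m + 1) + 1" "tree_size a \<le> m" by simp_all
  then show ?case by simp
qed simp

lemma tree_size_filter: "tree_size (of_list (filter P l)) \<le> tree_size (of_list l)"
  by (induction l) auto

text \<open>The fold works from the end of the list, so its accumulators are the values on the
  suffixes \<open>zs\<close>. If all of them have size at most \<open>M\<close>, every packed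
  argument of the step function has input size at most \<open>K\<close>.\<close>

lemma tree_fold_time_le:
  assumes \<sigma>: "\<And>y. \<sigma> y \<le> input_size y ^ c"
    and M: "\<And>ys zs. to_list t = ys @ zs \<Longrightarrow> tree_size (tree_fold B S p (of_list zs)) \<le> M"
    and K: "tree_size t + M + tree_size p + 4 \<le> K"
  shows "tree_fold_time B S \<beta> \<sigma> p t \<le> \<beta> p + 20 + tree_size t * (K ^ c + 20)"
  using M K
proof (induction t)
  case (Nd a l)
  have "tree_fold_time B S \<beta> \<sigma> p l \<le> \<beta> p + 20 + tree_size l * (K ^ c + 20)"
  proof (rule Nd.IH(2))
    show "tree_size (tree_fold B S p (of_list zs)) \<le> M" if "to_list l = ys @ zs" for ys zs
      using Nd.prems(1)[of "a # ys" zs] that by simp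
  qed (use Nd.prems(2) in simp)
  moreover have "\<sigma> (Nd a (Nd (tree_fold B S p l) p)) \<le> K ^ c"
  proof -
    have "tree_size (tree_fold B S p l) \<le> M"
      using Nd.prems(1)[of "[a]" "to_list l"] by simp
    then have "input_size (Nd a (Nd (tree_fold B S p l) p)) \<le> K"
      using Nd.prems(2) tree_size_pos[of l] by (simp add: input_size_def)
    then show ?thesis using \<sigma> by (meson le_trans power_mono zero_le)
  qed
  ultimately show ?case by (simp add: algebra_simps)
qed simp

lemma tractable_tree_fold:
  assumes A: "dominates_size A" and l: "tractable A l" and B: "ptime B" and S: "ptime S"
    and M: "poly_bounded A M"
      "\<And>x ys zs. to_list (l x) = ys @ zs \<Longrightarrow> tree_size (tree_fold B S x (of_list zs)) \<le> M x"
  shows "tractable A (\<lambda>x. tree_fold B S x (l x))"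
proof -
  from B obtain \<beta> where B: "computes_within B \<beta>" "poly_bounded input_size \<beta>"
    unfolding ptime_def tractable_def by blast
  from S obtain \<sigma> c where S: "computes_within S \<sigma>" "\<And>y. \<sigma> y \<le> input_size y ^ c"
    unfolding ptime_def tractable_def poly_bounded_def by blast
  have "tractable A (\<lambda>x. Nd (l x) x)" by (intro tractable_Nd A l tractable_id)
  then obtain \<tau> where \<tau>: "computes_within (\<lambda>x. Nd (l x) x) \<tau>" "poly_bounded A \<tau>"
    unfolding tractable_def by blast
  have l': "poly_bounded A (\<lambda>x. tree_size (l x))" using l unfolding tractable_def by blast
  have "poly_bounded A (\<lambda>x. \<tau> x + ((\<beta> x + 20 + tree_size (l x) *
      ((tree_size (l x) + M x + tree_size x + 4) ^ c + 20)) + 5) + 3)"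
    by (intro poly_bounded_add[OF A] poly_bounded_mult poly_bounded_power poly_bounded_const[OF A]
        \<tau> l' M(1) poly_bounded_size A poly_bounded_comp[OF A B(2)])
  then have "poly_bounded A (\<lambda>x. \<tau> x + (tree_fold_time B S \<beta> \<sigma> x (l x) + 5) + 3)"
    by (rule poly_bounded_mono)
      (intro add_right_mono add_left_mono tree_fold_time_le[OF S(2) M(2) le_refl])
  moreover have "computes_within (\<lambda>x. tree_fold B S x (l x)) (\<lambda>x. \<tau> x + (tree_fold_time B S \<beta> \<sigma> x (l x) + 5) + 3)"
    using computes_comp[OF \<tau>(1) computes_fold[OF B(1) S(1)]] by simp
  moreover have "poly_bounded A (\<lambda>x. tree_size (tree_fold B S x (l x)))"
    using M(1) by (rule poly_bounded_mono) (use M(2)[of _ "[]"] in simp)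
  ultimately show ?thesis unfolding tractable_def by blast
qed

lemma tree_fold_of_list:
  "tree_fold (\<lambda>p. of_list (b p)) (\<lambda>y. of_list (g (left y) (to_list (left (right y))) (right (right y)))) x (of_list l)
     = of_list (foldr (\<lambda>a acc. g a acc x) l (b x))"
  by (induction l) auto

definition ptime_list :: "(tree \<Rightarrow> tree list) \<Rightarrow> bool" where
  "ptime_list l \<longleftrightarrow> ptime (\<lambda>x. of_list (l x))"

definition ptime_pred :: "(tree \<Rightarrow> bool) \<Rightarrow> bool" where
  "ptime_pred P \<longleftrightarrow> ptime (\<lambda>x. enc_bool (P x))"

lemma tractable_foldr:
  assumes A: "dominates_size A" and l: "tractable A (\<lambda>x. of_list (l x))" and b: "ptime_list b"
    and g: "ptime_list (\<lambda>y. g (left y) (to_list (left (right y))) (right (right y)))"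
    and M: "poly_bounded A M"
      "\<And>x ys zs. l x = ys @ zs \<Longrightarrow> tree_size (of_list (foldr (\<lambda>a acc. g a acc x) zs (b x))) \<le> M x"
  shows "tractable A (\<lambda>x. of_list (foldr (\<lambda>a acc. g a acc x) (l x) (b x)))"
proof -
  have "tractable A (\<lambda>x. tree_fold (\<lambda>p. of_list (b p))
      (\<lambda>y. of_list (g (left y) (to_list (left (right y))) (right (right y)))) x (of_list (l x)))"
    using b g unfolding ptime_list_def
    by (intro tractable_tree_fold[OF A l _ _ M(1)]) (simp_all add: tree_fold_of_list[of b g] M(2))
  then show ?thesis by (simp add: tree_fold_of_list[of b g])
qed

lemma ptime_foldr:
  assumes "ptime_list l" "ptime_list b"
    "ptime_list (\<lambda>y. g (left y) (to_list (left (right y))) (right (right y)))"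
    "poly_bounded input_size M"
    "\<And>x ys zs. l x = ys @ zs \<Longrightarrow> tree_size (of_list (foldr (\<lambda>a acc. g a acc x) zs (b x))) \<le> M x"
  shows "ptime_list (\<lambda>x. foldr (\<lambda>a acc. g a acc x) (l x) (b x))"
  unfolding ptime_list_def ptime_def
  by (rule tractable_foldr[OF _ _ assms(2-5)]) (use assms(1) in \<open>simp_all add: ptime_list_def ptime_def\<close>)

section \<open>Closure properties of polynomial time\<close>

lemma ptime_list_to_list: "ptime f \<Longrightarrow> ptime_list (\<lambda>x. to_list (f x))"
  unfolding ptime_list_def by simp

lemma ptime_of_list: "ptime_list f \<Longrightarrow> ptime (\<lambda>x. of_list (f x))"
  unfolding ptime_list_def .

lemma ptime_list_Nil: "ptime_list (\<lambda>x. [])"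
  unfolding ptime_list_def by (simp add: ptime_const)

lemma ptime_list_Cons: "ptime f \<Longrightarrow> ptime_list g \<Longrightarrow> ptime_list (\<lambda>x. f x # g x)"
  unfolding ptime_list_def by (simp add: ptime_Nd)

lemma ptime_if:
  assumes "ptime_pred P" "ptime f" "ptime g"
  shows "ptime (\<lambda>x. if P x then f x else g x)"
proof -
  have eq: "(\<lambda>x. if P x then f x else g x) = (\<lambda>x. tree_if (Nd (enc_bool (P x)) (Nd (f x) (g x))))"
    by (auto simp: tree_if_def enc_bool_def)
  show ?thesis
    unfolding eq by (intro ptime_tree_if ptime_Nd assms(2,3) assms(1)[unfolded ptime_pred_def])
qed

lemma ptime_list_if:
  assumes "ptime_pred P" "ptime_list f" "ptime_list g"
  shows "ptime_list (\<lambda>x. if P x then f x else g x)"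
proof -
  have eq: "(\<lambda>x. of_list (if P x then f x else g x)) = (\<lambda>x. if P x then of_list (f x) else of_list (g x))"
    by auto
  show ?thesis
    unfolding ptime_list_def eq by (rule ptime_if[OF assms(1) assms(2,3)[unfolded ptime_list_def]])
qed

lemma ptime_pred_if:
  assumes "ptime_pred P" "ptime_pred Q" "ptime_pred R"
  shows "ptime_pred (\<lambda>x. if P x then Q x else R x)"
proof -
  have eq: "enc_bool (if P x then Q x else R x) = (if P x then enc_bool (Q x) else enc_bool (R x))" for x
    by (cases "P x") simp_all
  show ?thesis
    unfolding ptime_pred_def eq by (rule ptime_if[OF assms(1) assms(2,3)[unfolded ptime_pred_def]])
qed

lemma ptime_pred_const: "ptime_pred (\<lambda>x. b)"
  unfolding ptime_pred_def by (rule ptime_const)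

lemma ptime_pred_not:
  assumes "ptime_pred P"
  shows "ptime_pred (\<lambda>x. \<not> P x)"
proof -
  have eq: "(\<lambda>x. \<not> P x) = (\<lambda>x. if P x then False else True)" by auto
  show ?thesis unfolding eq by (rule ptime_pred_if[OF assms ptime_pred_const ptime_pred_const])
qed

lemma ptime_pred_conj:
  assumes "ptime_pred P" "ptime_pred Q"
  shows "ptime_pred (\<lambda>x. P x \<and> Q x)"
proof -
  have eq: "(\<lambda>x. P x \<and> Q x) = (\<lambda>x. if P x then Q x else False)" by auto
  show ?thesis unfolding eq by (rule ptime_pred_if[OF assms ptime_pred_const])
qed

lemma ptime_pred_disj:
  assumes "ptime_pred P" "ptime_pred Q"
  shows "ptime_pred (\<lambda>x. P x \<or> Q x)"
proof -
  have eq: "(\<lambda>x. P x \<or> Q x) = (\<lambda>x. if P x then True else Q x)" by auto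
  show ?thesis unfolding eq by (rule ptime_pred_if[OF assms(1) ptime_pred_const assms(2)])
qed

lemma ptime_pred_imp:
  assumes "ptime_pred P" "ptime_pred Q"
  shows "ptime_pred (\<lambda>x. P x \<longrightarrow> Q x)"
  unfolding imp_conv_disj by (rule ptime_pred_disj[OF ptime_pred_not[OF assms(1)] assms(2)])

lemma ptime_pred_eq:
  assumes "ptime f" "ptime g"
  shows "ptime_pred (\<lambda>x. f x = g x)"
proof -
  have "poly_bounded input_size (\<lambda>x. tree_size (left x))"
    by (rule poly_bounded_mono[OF poly_bounded_size tree_size_left]) simp
  then have "poly_bounded input_size (\<lambda>x. 20 * tree_size (left x) + 20)"
    by (intro poly_bounded_add poly_bounded_mult poly_bounded_const) simp_all
  moreover have "poly_bounded input_size (\<lambda>x. tree_size (enc_bool (left x = right x)))"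
    by (rule poly_bounded_mono[OF poly_bounded_const[of _ 3]]) (simp_all add: enc_bool_def)
  ultimately have "ptime (\<lambda>x. enc_bool (left x = right x))"
    unfolding ptime_def tractable_def by (intro conjI exI[of _ "\<lambda>x. 20 * tree_size (left x) + 20"] computes_eq)
  from ptime_comp[OF this ptime_Nd[OF assms]] show ?thesis unfolding ptime_pred_def left.simps right.simps .
qed

lemma ptime_list_append:
  assumes "ptime_list f" "ptime_list g"
  shows "ptime_list (\<lambda>x. f x @ g x)"
proof -
  have "ptime_list (\<lambda>x. foldr (\<lambda>a acc. a # acc) (to_list (left x)) (to_list (right x)))"
  proof (rule ptime_foldr)
    fix x ys zs
    assume l: "to_list (left x) = ys @ zs"
    have "foldr (\<lambda>a acc. a # acc) zs (to_list (right x)) = zs @ to_list (right x)"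
      by (induction zs) auto
    moreover have "tree_size (of_list zs) \<le> tree_size (left x)"
      using tree_size_of_list_append[of ys zs] tree_size_pos[of "of_list ys"]
      unfolding l[symmetric] of_list_to_list by simp
    ultimately show "tree_size (of_list (foldr (\<lambda>a acc. a # acc) zs (to_list (right x)))) \<le> 2 * tree_size x"
      using tree_size_of_list_append[of zs "to_list (right x)"] tree_size_left[of x] tree_size_right[of x] by simp
  qed (auto intro!: ptime_list_to_list ptime_left ptime_right ptime_id ptime_list_Cons
      poly_bounded_mult poly_bounded_const poly_bounded_size)
  moreover have "foldr (\<lambda>a acc. a # acc) k l = k @ l" for k l :: "tree list"
    by (induction k) auto
  ultimately have "ptime (\<lambda>x. of_list (to_list (left x) @ to_list (right x)))"
    by (simp add: ptime_list_def)
  from ptime_comp[OF this ptime_Nd[of "\<lambda>x. of_list (f x)" "\<lambda>x. of_list (g x)"]] assms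
  show ?thesis by (simp add: ptime_list_def)
qed

text \<open>The function is supplied on packed pairs \<open>y\<close>, element on the left and
  parameter on the right. Elements are no larger than the whole list, so each contributes
  polynomially much and the accumulator is bounded by their number times this amount.\<close>

lemma ptime_list_concat_map:
  assumes l: "ptime_list l" and f: "ptime_list (\<lambda>y. f (left y) (right y))"
  shows "ptime_list (\<lambda>x. concat (map (\<lambda>a. f a x) (l x)))"
proof -
  from f obtain c where c: "\<And>y. tree_size (of_list (f (left y) (right y))) \<le> input_size y ^ c"
    unfolding ptime_list_def ptime_def tractable_def poly_bounded_def by blast
  from l have l': "poly_bounded input_size (\<lambda>x. tree_size (of_list (l x)))"
    unfolding ptime_list_def ptime_def tractable_def by blast
  define M where "M x = tree_size (of_list (l x)) * (tree_size (of_list (l x)) + tree_size x + 3) ^ c + 1" for x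
  have "ptime_list (\<lambda>x. foldr (\<lambda>a acc. f a x @ acc) (l x) [])"
  proof (rule ptime_foldr[OF l])
    show "poly_bounded input_size M"
      unfolding M_def
      by (intro poly_bounded_add poly_bounded_mult poly_bounded_power poly_bounded_const l'
          poly_bounded_size) simp_all
    fix x ys zs
    assume lx: "l x = ys @ zs"
    have zs: "\<forall>a\<in>set zs. tree_size a \<le> tree_size (of_list (l x))"
      using tree_size_member lx by simp
    have "tree_size (of_list (foldr (\<lambda>a acc. f a x @ acc) zs [])) \<le>
        length zs * (tree_size (of_list (l x)) + tree_size x + 3) ^ c + 1"
      using zs
    proof (induction zs)
      case (Cons a zs)
      have "tree_size (of_list (f a x)) \<le> input_size (Nd a x) ^ c" using c[of "Nd a x"] by simp
      also have "\<dots> \<le> (tree_size (of_list (l x)) + tree_size x + 3) ^ c"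
        using Cons.prems by (intro power_mono) (simp_all add: input_size_def)
      finally show ?case
        using Cons tree_size_of_list_append[of "f a x" "foldr (\<lambda>a acc. f a x @ acc) zs []"] by simp
    qed simp
    also have "\<dots> \<le> M x"
      using length_le_tree_size[of "l x"] unfolding M_def by (simp add: lx)
    finally show "tree_size (of_list (foldr (\<lambda>a acc. f a x @ acc) zs [])) \<le> M x" .
  next
    show "ptime_list (\<lambda>y. f (left y) (right (right y)) @ to_list (left (right y)))"
      using ptime_comp[OF f[unfolded ptime_list_def], of "\<lambda>y. Nd (left y) (right (right y))"]
      by (intro ptime_list_append ptime_list_to_list ptime_left ptime_right ptime_id)
        (simp add: ptime_list_def ptime_Nd ptime_left ptime_right ptime_id)
  qed (rule ptime_list_Nil)
  moreover have "foldr (\<lambda>a acc. f a x @ acc) zs [] = concat (map (\<lambda>a. f a x) zs)" for x zs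
    by (induction zs) auto
  ultimately show ?thesis by simp
qed

lemma ptime_list_map:
  "ptime_list l \<Longrightarrow> ptime (\<lambda>y. f (left y) (right y)) \<Longrightarrow> ptime_list (\<lambda>x. map (\<lambda>a. f a x) (l x))"
  using ptime_list_concat_map[of l "\<lambda>a x. [f a x]"] by (simp add: ptime_list_Cons ptime_list_Nil)

lemma ptime_list_filter:
  assumes "ptime_list l" "ptime_pred (\<lambda>y. P (left y) (right y))"
  shows "ptime_list (\<lambda>x. filter (\<lambda>a. P a x) (l x))"
proof -
  have "concat (map (\<lambda>a. if P a x then [a] else []) l) = filter (\<lambda>a. P a x) l" for x l
    by (induction l) auto
  with ptime_list_concat_map[of l "\<lambda>a x. if P a x then [a] else []"] assms show ?thesis
    by (simp add: ptime_list_if ptime_list_Cons ptime_list_Nil ptime_left ptime_id)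
qed

lemma ptime_pred_Bex:
  assumes "ptime_list l" "ptime_pred (\<lambda>y. P (left y) (right y))"
  shows "ptime_pred (\<lambda>x. \<exists>a\<in>set (l x). P a x)"
proof -
  have "ptime_pred (\<lambda>x. of_list (filter (\<lambda>a. P a x) (l x)) \<noteq> Lf)"
    by (intro ptime_pred_not ptime_pred_eq ptime_of_list ptime_list_filter ptime_const assms)
  then show ?thesis by (simp add: filter_empty_conv)
qed

lemma ptime_pred_Ball:
  assumes "ptime_list l" "ptime_pred (\<lambda>y. P (left y) (right y))"
  shows "ptime_pred (\<lambda>x. \<forall>a\<in>set (l x). P a x)"
  using ptime_pred_not[OF ptime_pred_Bex[OF assms(1), of "\<lambda>a x. \<not> P a x"]] assms(2)
  by (simp add: ptime_pred_not)

lemma ptime_pred_member: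
  assumes "ptime f" "ptime_list l"
  shows "ptime_pred (\<lambda>x. f x \<in> set (l x))"
proof -
  have "ptime_pred (\<lambda>x. \<exists>a\<in>set (l x). a = f x)"
    by (intro ptime_pred_Bex ptime_pred_eq assms ptime_left ptime_id ptime_comp[OF assms(1)] ptime_right)
  then show ?thesis by simp
qed

text \<open>Every accumulator after the first is a sublist of the fixed list \<open>u x\<close>, so
  nothing can grow, whatever the number of rounds. Both the saturation of facts and the elimination
  of variables are written as filters of a fixed list in order to fit this scheme.\<close>

lemma ptime_list_filter_iteration:
  assumes u: "ptime_list u" and l: "ptime_list l" and b: "ptime_list b"
    and b_le: "\<And>x. tree_size (of_list (b x)) \<le> tree_size (of_list (u x))"
    and P: "ptime_pred (\<lambda>y. P (left y) (left (right y)) (to_list (left (right (right y)))) (right (right (right y))))"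
  shows "ptime_list (\<lambda>x. foldr (\<lambda>a acc. filter (\<lambda>m. P m a acc x) (u x)) (l x) (b x))"
proof (rule ptime_foldr[OF l b])
  have "ptime_list (\<lambda>y. u (right (right y)))"
    using ptime_comp[OF u[unfolded ptime_list_def], of "\<lambda>y. right (right y)"]
    by (simp add: ptime_list_def ptime_right ptime_id)
  then show "ptime_list (\<lambda>y. filter (\<lambda>m. P m (left y) (to_list (left (right y))) (right (right y)))
      (u (right (right y))))"
    by (rule ptime_list_filter) (rule P)
  show "poly_bounded input_size (\<lambda>x. tree_size (of_list (u x)))"
    using u unfolding ptime_list_def ptime_def tractable_def by blast
  fix x and zs :: "tree list"
  show "tree_size (of_list (foldr (\<lambda>a acc. filter (\<lambda>m. P m a acc x) (u x)) zs (b x))) \<le> tree_size (of_list (u x))"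
    using tree_size_filter b_le by (cases zs) auto
qed

lemmas ptime_intros = ptime_id ptime_const ptime_Nd ptime_left ptime_right ptime_if ptime_of_list
  ptime_list_to_list ptime_list_Nil ptime_list_Cons ptime_list_append ptime_list_concat_map
  ptime_list_map ptime_list_filter ptime_list_if
  ptime_pred_const ptime_pred_not ptime_pred_conj ptime_pred_disj ptime_pred_imp ptime_pred_eq
  ptime_pred_Bex ptime_pred_Ball ptime_pred_member ptime_pred_if

section \<open>The chase and its finite quotient\<close>

text \<open>An atom is a tree \<open>Nd key (Nd x y)\<close>; a unary atom has \<open>x = y\<close>. A tgd is a tree
  \<open>Nd body heads\<close> with a list of head atoms.\<close>

abbreviation "key t \<equiv> left t"
abbreviation "arg_l t \<equiv> left (right t)"
abbreviation "arg_r t \<equiv> right (right t)"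

text \<open>All variables outside the body receive the same \<open>c\<close>. Under
  \<open>two_vars\<close> there is at most one of them.\<close>

definition subst :: "tree \<Rightarrow> 'e \<Rightarrow> 'e \<Rightarrow> 'e \<Rightarrow> tree \<Rightarrow> 'e" where
  "subst \<tau> c a b w = (if w = arg_l (left \<tau>) then a else if w = arg_r (left \<tau>) then b else c)"

definition matches :: "tree \<Rightarrow> tree \<Rightarrow> 'e \<Rightarrow> 'e \<Rightarrow> bool" where
  "matches \<tau> K a b \<longleftrightarrow> K = key (left \<tau>) \<and> (arg_l (left \<tau>) = arg_r (left \<tau>) \<longrightarrow> a = b)"

text \<open>The oblivious chase with Skolem terms. The new element depends on \<open>\<tau>\<close>
  and the first body argument only, which suffices because a tgd satisfying \<open>two_vars\<close>
  can introduce an element only if its body has a single variable. The constructor \<open>ch\<close>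
  is left open so that the real chase (\<open>Nul\<close>) and its finite quotient
  (\<open>null_child\<close>) are instances of the same definition.\<close>

inductive_set chase :: "(tree \<Rightarrow> 'e \<Rightarrow> 'e) \<Rightarrow> tree set \<Rightarrow> (tree \<times> 'e \<times> 'e) set \<Rightarrow> (tree \<times> 'e \<times> 'e) set"
  for ch T D where
  chase_data: "f \<in> D \<Longrightarrow> f \<in> chase ch T D"
| chase_step: "(K, a, b) \<in> chase ch T D \<Longrightarrow> \<tau> \<in> T \<Longrightarrow> matches \<tau> K a b \<Longrightarrow> h \<in> set (to_list (right \<tau>)) \<Longrightarrow>
    (key h, subst \<tau> (ch \<tau> a) a b (arg_l h), subst \<tau> (ch \<tau> a) a b (arg_r h)) \<in> chase ch T D"

definition two_vars :: "tree \<Rightarrow> bool" where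
  "two_vars \<tau> \<longleftrightarrow> (\<exists>y. \<forall>h\<in>set (to_list (right \<tau>)). \<forall>w\<in>{arg_l h, arg_r h}.
     w = arg_l (left \<tau>) \<or> w = arg_r (left \<tau>) \<or> (arg_l (left \<tau>) = arg_r (left \<tau>) \<and> w = y))"

text \<open>The level of an individual is \<open>Lf\<close>; nulls have one of three nonempty levels, which are
  traversed cyclically. Three are needed to tell the parent from the child in a pair of adjacent nulls.\<close>

definition next_level :: "tree \<Rightarrow> tree" where
  "next_level l = (if right (right l) = Lf then Nd Lf l else Nd Lf Lf)"

lemma next_level_neq: "next_level l \<noteq> Lf" "next_level l \<noteq> l" "next_level (next_level l) \<noteq> l"
proof -
  have neq: "Nd Lf t \<noteq> t" "Nd Lf (Nd Lf t) \<noteq> t" for t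
    by (rule notI, drule arg_cong[of _ _ tree_size], simp)+
  show "next_level l \<noteq> Lf" "next_level l \<noteq> l" "next_level (next_level l) \<noteq> l"
    using neq by (auto simp: next_level_def)
qed

definition individual :: "tree \<Rightarrow> tree" where
  "individual a = Nd Lf a"

definition null_child :: "tree \<Rightarrow> tree \<Rightarrow> tree" where
  "null_child \<tau> m = Nd (next_level (left m)) \<tau>"

lemma null_child_neq:
  "left (null_child \<tau> m) \<noteq> Lf" "null_child \<tau> m \<noteq> m" "m \<noteq> null_child \<tau> (null_child \<sigma> m)"
  using next_level_neq unfolding null_child_def by (metis left.simps(2))+

text \<open>Only levels are compared. That \<open>b\<close> really is a child of \<open>a\<close>
  follows in \<open>compatible_sound\<close> from the existence of a fact joining the two.\<close>

definition oriented :: "tree \<Rightarrow> tree \<Rightarrow> bool" where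
  "oriented a b \<longleftrightarrow> left b = next_level (left a) \<or> left a = Lf \<and> left b = Lf"

definition covered :: "tree \<Rightarrow> tree \<Rightarrow> tree \<Rightarrow> bool" where
  "covered t x p \<longleftrightarrow> (arg_l t = x \<or> arg_l t = p) \<and> (arg_r t = x \<or> arg_r t = p)"

definition compatible :: "tree list \<Rightarrow> tree list \<Rightarrow> tree \<Rightarrow> tree \<Rightarrow> tree \<Rightarrow> tree \<Rightarrow> bool" where
  "compatible Q F x b p a \<longleftrightarrow> (\<forall>t\<in>set Q. covered t x p \<longrightarrow>
     Nd (key t) (Nd (if arg_l t = x then b else a) (if arg_r t = x then b else a)) \<in> set F \<and>
     (arg_l t \<noteq> arg_r t \<longrightarrow> oriented a b))"

text \<open>A table is a list of rows \<open>Nd v a\<close>, meaning that the variable \<open>v\<close> may be sent to \<open>a\<close>. The entry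
  \<open>Nd x p\<close> of an elimination order removes \<open>x\<close> and joins it with \<open>p\<close>; the case \<open>p = x\<close> is that of the
  last variable of a connected component.\<close>

definition survives :: "tree list \<Rightarrow> tree list \<Rightarrow> tree \<Rightarrow> tree list \<Rightarrow> tree \<Rightarrow> bool" where
  "survives Q F e tb m \<longleftrightarrow> m \<in> set tb \<and>
     (\<exists>r\<in>set tb. left r = left e \<and> (\<exists>r'\<in>set tb. left r' = right e \<and>
        compatible Q F (left e) (right r) (right e) (right r'))) \<and>
     left m \<noteq> left e \<and>
     (left m = right e \<longrightarrow> (\<exists>r\<in>set tb. left r = left e \<and>
        compatible Q F (left e) (right r) (right e) (right m)))"

text \<open>The last entry of \<open>L\<close> is eliminated first. One condition in
  \<open>survives\<close> does not mention the row \<open>m\<close>: if the eliminated variable has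
  no compatible pair of rows, the whole table becomes empty and stays empty. Nonemptiness at the end
  therefore means that all joins succeeded.\<close>

definition eliminate :: "tree list \<Rightarrow> tree list \<Rightarrow> tree list \<Rightarrow> tree list \<Rightarrow> tree list" where
  "eliminate Q F tb0 L = foldr (\<lambda>e tb. filter (\<lambda>m. survives Q F e tb m) tb0) L tb0"

section \<open>The meaning of quotient facts in an arbitrary model\<close>

locale tree_model =
  fixes Rel :: "tree \<Rightarrow> 'd \<Rightarrow> 'd \<Rightarrow> bool" and ci :: "tree \<Rightarrow> 'd" and T :: "tree set"
    and D :: "(tree \<times> tree \<times> tree) set"
  assumes two_vars: "\<tau> \<in> T \<Longrightarrow> two_vars \<tau>"
    and data: "(K, a, b) \<in> D \<Longrightarrow> Rel K (ci a) (ci b)"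
    and tgds: "\<tau> \<in> T \<Longrightarrow> Rel K d e \<Longrightarrow> matches \<tau> K d e \<Longrightarrow>
      \<exists>c. \<forall>h\<in>set (to_list (right \<tau>)). Rel (key h) (subst \<tau> c d e (arg_l h)) (subst \<tau> c d e (arg_r h))"
begin

text \<open>Here \<open>e\<close> plays the null that \<open>\<tau>\<close> creates for
  \<open>d\<close>. Both body arguments are \<open>d\<close>, since only a body with a single
  variable can create a null.\<close>

definition heads :: "tree \<Rightarrow> 'd \<Rightarrow> 'd \<Rightarrow> bool" where
  "heads \<tau> d e \<longleftrightarrow>
     (\<forall>h\<in>set (to_list (right \<tau>)). Rel (key h) (subst \<tau> e d d (arg_l h)) (subst \<tau> e d d (arg_r h)))"

text \<open>No type is demanded of the parent \<open>p\<close>. A definition by recursion along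
  parents is impossible, since in the quotient a node does not determine its parent.\<close>

definition realizes :: "tree \<Rightarrow> 'd \<Rightarrow> bool" where
  "realizes m d \<longleftrightarrow> (if left m = Lf then d = ci (right m) else \<exists>p. heads (right m) p d)"

text \<open>In the last two cases only the child is known to realize its type: a pair fact depends on the
  creating tgd alone, whatever the parent.\<close>

definition realizes2 :: "tree \<Rightarrow> tree \<Rightarrow> 'd \<Rightarrow> 'd \<Rightarrow> bool" where
  "realizes2 a b d e \<longleftrightarrow> (a = b \<and> d = e \<and> realizes a d) \<or>
     (left a = Lf \<and> left b = Lf \<and> d = ci (right a) \<and> e = ci (right b)) \<or>
     (\<exists>\<tau>. b = null_child \<tau> a \<and> heads \<tau> d e) \<or> (\<exists>\<tau>. a = null_child \<tau> b \<and> heads \<tau> e d)"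

lemma realizes2_sym: "realizes2 a b d e \<longleftrightarrow> realizes2 b a e d"
  unfolding realizes2_def by auto

lemma realizes2_refl: "realizes2 a a d e \<longleftrightarrow> d = e \<and> realizes a d"
  unfolding realizes2_def realizes_def using null_child_neq(2) by metis

lemma realizes_null_child: "realizes (null_child \<tau> m) e \<longleftrightarrow> (\<exists>d. heads \<tau> d e)"
  using null_child_neq(1) by (simp add: realizes_def null_child_def)

text \<open>This is what the cyclic levels are for: \<open>a\<close> is neither its own child nor a
  child of its child, so three of the four disjuncts of \<open>realizes2\<close> are
  excluded.\<close>

lemma realizes2_null_child: "realizes2 a (null_child \<tau> a) d e \<longleftrightarrow> heads \<tau> d e"
proof
  have "\<tau>' = \<tau>" if "null_child \<tau> a = null_child \<tau>' a" for \<tau>'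
    using that by (simp add: null_child_def)
  moreover assume "realizes2 a (null_child \<tau> a) d e"
  ultimately show "heads \<tau> d e"
    unfolding realizes2_def using null_child_neq by metis
qed (auto simp: realizes2_def)

text \<open>The last two conjuncts give steps to a neighbour in both directions, because a fact may
  list the child first. They are not equally strong: the element found for the parent of a null
  satisfies \<open>heads\<close> but need not realize the type of the parent.\<close>

definition fact_sound :: "tree \<Rightarrow> tree \<Rightarrow> tree \<Rightarrow> bool" where
  "fact_sound K a b \<longleftrightarrow> (\<forall>d e. realizes2 a b d e \<longrightarrow> Rel K d e) \<and>
     (\<exists>d. realizes a d) \<and> (\<exists>e. realizes b e) \<and>
     (\<forall>d. realizes a d \<longrightarrow> (\<exists>e. realizes2 a b d e)) \<and>
     (\<forall>e. realizes b e \<longrightarrow> (\<exists>d. realizes2 a b d e))"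

lemma fact_sound_loop:
  assumes "\<exists>d. realizes a d" "\<And>d. realizes a d \<Longrightarrow> Rel K d d"
  shows "fact_sound K a a"
  unfolding fact_sound_def
proof (intro conjI allI impI)
  fix d assume "realizes a d"
  then have "realizes2 a a d d" by (simp add: realizes2_refl)
  then show "\<exists>e. realizes2 a a d e" "\<exists>e. realizes2 a a e d" by (rule exI)+
qed (use assms realizes2_refl in auto)

text \<open>A rule application that stays within the body variables inherits the pairs of the fact
  it was applied to. One that creates a null has a body with one variable, by
  \<open>two_vars\<close>; every element realizing \<open>a\<close> then has a witness
  \<open>e\<close> in the model with \<open>heads \<tau> d e\<close>, and such pairs are exactly
  what \<open>realizes2\<close> allows for the null.\<close>

lemma chase_fact_sound:
  assumes "(K, a, b) \<in> chase null_child T ((\<lambda>(K, a, b). (K, individual a, individual b)) ` D)"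
  shows "fact_sound K a b"
  using assms
proof (induction "(K, a, b)" arbitrary: K a b rule: chase.induct)
  case chase_data
  then obtain a' b' where D: "(K, a', b') \<in> D" "a = Nd Lf a'" "b = Nd Lf b'"
    by (auto simp: individual_def)
  have r: "realizes a d \<longleftrightarrow> d = ci a'" "realizes b d \<longleftrightarrow> d = ci b'" for d
    by (simp_all add: realizes_def D)
  have "realizes2 a b d e \<longleftrightarrow> d = ci a' \<and> e = ci b'" for d e
    unfolding realizes2_def r using null_child_neq(1) D(2,3) by (metis left.simps(2) right.simps(2))
  with r data[OF D(1)] show ?case by (simp add: fact_sound_def)
next
  case (chase_step K a b \<tau> h)
  note \<tau> = \<open>\<tau> \<in> T\<close> and h = \<open>h \<in> set (to_list (right \<tau>))\<close> and m = \<open>matches \<tau> K a b\<close>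
    and IH = \<open>fact_sound K a b\<close>
  let ?x = "arg_l (left \<tau>)" and ?y = "arg_r (left \<tau>)" and ?p = "arg_l h" and ?q = "arg_r h"
  have app: "\<exists>c. \<forall>h\<in>set (to_list (right \<tau>)). Rel (key h) (subst \<tau> c d e (arg_l h)) (subst \<tau> c d e (arg_r h))"
    if "realizes2 a b d e" for d e
  proof (rule tgds[OF \<tau>])
    show "Rel K d e" using IH that unfolding fact_sound_def by blast
    show "matches \<tau> K d e" using m that realizes2_refl unfolding matches_def by blast
  qed
  show ?case
  proof (cases "?p \<in> {?x, ?y} \<and> ?q \<in> {?x, ?y}")
    case True
    have s': "subst \<tau> c d e w = (if w = ?x then d else e)" if "w \<in> {?x, ?y}" for w c and d e :: 'd
      using that by (auto simp: subst_def)
    have R: "Rel (key h) (if ?p = ?x then d else e) (if ?q = ?x then d else e)" if "realizes2 a b d e" for d e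
      using app[OF that] True h s' by fastforce
    have sa: "subst \<tau> (null_child \<tau> a) a b ?p = (if ?p = ?x then a else b)"
      "subst \<tau> (null_child \<tau> a) a b ?q = (if ?q = ?x then a else b)"
      using True by (auto simp: subst_def)
    have loops: "fact_sound (key h) a a" if "\<And>d e. realizes2 a b d e \<Longrightarrow> Rel (key h) d d"
      using fact_sound_loop[of a "key h"] IH that unfolding fact_sound_def by meson
    have loops': "fact_sound (key h) b b" if "\<And>d e. realizes2 a b d e \<Longrightarrow> Rel (key h) e e"
      using fact_sound_loop[of b "key h"] IH that unfolding fact_sound_def by meson
    have pair: "fact_sound (key h) a b" if "\<And>d e. realizes2 a b d e \<Longrightarrow> Rel (key h) d e"
      using IH that unfolding fact_sound_def by simp
    have pair': "fact_sound (key h) b a" if "\<And>d e. realizes2 a b d e \<Longrightarrow> Rel (key h) e d"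
      using IH that unfolding fact_sound_def realizes2_sym[of b a] by simp
    show ?thesis
      unfolding sa using R loops loops' pair pair' by (cases "?p = ?x"; cases "?q = ?x") simp_all
  next
    case False
    from two_vars[OF \<tau>] h False obtain y where xy: "?x = ?y" and y: "y \<noteq> ?x" "?p \<in> {?x, y}" "?q \<in> {?x, y}"
      unfolding two_vars_def by (metis insertCI insertE singletonD)
    have ab: "a = b" using m xy by (simp add: matches_def)
    define c where "c = null_child \<tau> a"
    have ex: "\<exists>e. heads \<tau> d e" if "realizes a d" for d
      using app[of d d] that realizes2_refl unfolding ab heads_def by blast
    have sa: "subst \<tau> (null_child \<tau> a) a b w = (if w = ?x then a else c)" if "w \<in> {?x, y}" for w
      using that xy y by (auto simp: subst_def c_def)
    have R: "Rel (key h) (if ?p = ?x then d else e) (if ?q = ?x then d else e)" if "heads \<tau> d e" for d e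
    proof -
      have "subst \<tau> e d d ?p = (if ?p = ?x then d else e)" "subst \<tau> e d d ?q = (if ?q = ?x then d else e)"
        using xy y by (auto simp: subst_def)
      with that h show ?thesis unfolding heads_def by auto
    qed
    have c: "realizes2 a c d e \<longleftrightarrow> heads \<tau> d e" "realizes c e \<longleftrightarrow> (\<exists>d. heads \<tau> d e)"
        "realizes2 c a e d \<longleftrightarrow> heads \<tau> d e" for d e
      using realizes2_null_child realizes_null_child realizes2_sym unfolding c_def by blast+
    have a: "\<exists>d. realizes a d" using IH unfolding fact_sound_def by blast
    have loops: "fact_sound (key h) c c" if "\<And>d e. heads \<tau> d e \<Longrightarrow> Rel (key h) e e"
      using fact_sound_loop[of c "key h"] a ex that c(2) by meson
    have pair: "fact_sound (key h) a c" if "\<And>d e. heads \<tau> d e \<Longrightarrow> Rel (key h) d e"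
      using a ex that c unfolding fact_sound_def by meson
    have pair': "fact_sound (key h) c a" if "\<And>d e. heads \<tau> d e \<Longrightarrow> Rel (key h) e d"
      using a ex that c unfolding fact_sound_def by meson
    have "?p \<noteq> ?x \<or> ?q \<noteq> ?x" using False by auto
    then show ?thesis
      unfolding sa[OF y(2)] sa[OF y(3)] using R loops pair pair'
      by (cases "?p = ?x"; cases "?q = ?x") simp_all
  qed
qed

text \<open>If some atom links \<open>x\<close> and \<open>p\<close>, its fact yields a suitable
  \<open>e\<close> for the given \<open>d\<close>; all other facts about the same pair of types hold
  of \<open>d\<close> and \<open>e\<close> as well, because \<open>fact_sound\<close> covers every
  pair related by \<open>realizes2\<close>. Without such an atom any realization of \<open>b\<close>
  will do.\<close>

lemma compatible_sound:
  assumes F: "\<And>K a b. Nd K (Nd a b) \<in> set F \<Longrightarrow> fact_sound K a b"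
    and ok: "compatible Q F x b p a" and d: "x \<noteq> p \<Longrightarrow> realizes a d" and b: "\<exists>e. realizes b e"
  shows "\<exists>e. realizes b e \<and> (\<forall>t\<in>set Q. covered t x p \<longrightarrow>
    Rel (key t) (if arg_l t = x then e else d) (if arg_r t = x then e else d))"
proof -
  have loop: "Rel K e e" if "Nd K (Nd c c) \<in> set F" "realizes c e" for K c e
    using F[OF that(1)] that(2) realizes2_refl unfolding fact_sound_def by blast
  show ?thesis
  proof (cases "\<exists>t\<in>set Q. covered t x p \<and> arg_l t \<noteq> arg_r t")
    case True
    then obtain t where t: "t \<in> set Q" "covered t x p" "arg_l t \<noteq> arg_r t" by blast
    then have xp: "x \<noteq> p" by (auto simp: covered_def)
    have "Nd (key t) (Nd (if arg_l t = x then b else a) (if arg_r t = x then b else a)) \<in> set F"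
      and or: "oriented a b"
      using ok t unfolding compatible_def by auto
    moreover have "arg_l t = x \<and> arg_r t = p \<or> arg_l t = p \<and> arg_r t = x"
      using t by (auto simp: covered_def)
    ultimately have "fact_sound (key t) a b \<or> fact_sound (key t) b a"
      using F[of "key t"] xp by auto
    then have "\<exists>e. realizes2 a b d e"
    proof
      assume "fact_sound (key t) b a"
      then obtain e where "realizes2 b a e d" using d[OF xp] unfolding fact_sound_def by metis
      then show ?thesis using realizes2_sym by metis
    qed (use d[OF xp] in \<open>simp add: fact_sound_def\<close>)
    then obtain e where e: "realizes2 a b d e" ..
    \<comment> \<open>The orientation is used here: it makes \<open>b\<close> the child, or both
      types individuals, so that \<open>e\<close> realizes its own type and can serve as the parent
      in further joins.\<close>
    have "realizes b e"
      using or unfolding oriented_def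
    proof
      assume next_level: "left b = next_level (left a)"
      then have "b \<noteq> a" "left b \<noteq> Lf" "\<And>\<sigma>. a \<noteq> null_child \<sigma> b"
        using next_level_neq by (metis left.simps(2) null_child_def)+
      with e obtain \<sigma> where "b = null_child \<sigma> a" "heads \<sigma> d e" unfolding realizes2_def by auto
      then show ?thesis using realizes_null_child by auto
    next
      assume ab: "left a = Lf \<and> left b = Lf"
      then have "\<And>\<sigma>. a \<noteq> null_child \<sigma> b" "\<And>\<sigma>. b \<noteq> null_child \<sigma> a" using null_child_neq(1) by metis+
      with e ab show ?thesis unfolding realizes2_def realizes_def by auto
    qed
    moreover have "Rel (key s) (if arg_l s = x then e else d) (if arg_r s = x then e else d)"
      if s: "s \<in> set Q" "covered s x p" for s
    proof -
      have "Nd (key s) (Nd (if arg_l s = x then b else a) (if arg_r s = x then b else a)) \<in> set F"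
        using ok s unfolding compatible_def by blast
      moreover have "Rel K d e" if "Nd K (Nd a b) \<in> set F" for K
        using F[OF that] e unfolding fact_sound_def by blast
      moreover have "Rel K e d" if "Nd K (Nd b a) \<in> set F" for K
        using F[OF that] e[unfolded realizes2_sym[of a]] unfolding fact_sound_def by blast
      ultimately show ?thesis
        using loop[of "key s" a d] loop[of "key s" b e] d[OF xp] \<open>realizes b e\<close>
        by (cases "arg_l s = x"; cases "arg_r s = x") auto
    qed
    ultimately show ?thesis by blast
  next
    case False
    from b obtain e where e: "realizes b e" by blast
    have "Rel (key s) (if arg_l s = x then e else d) (if arg_r s = x then e else d)"
      if s: "s \<in> set Q" "covered s x p" for s
    proof -
      have "arg_l s = arg_r s" using False s by blast
      moreover have "Nd (key s) (Nd (if arg_l s = x then b else a) (if arg_r s = x then b else a)) \<in> set F"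
        using ok s unfolding compatible_def by blast
      ultimately show ?thesis using loop d e s(2) by (auto simp: covered_def)
    qed
    with e show ?thesis by blast
  qed
qed

text \<open>Values are assigned in the reverse order of elimination: the head of \<open>L\<close>
  was eliminated last and is treated first. \<open>A\<close> holds the variables already assigned,
  and the invariant is that their values realize a row still in the table.\<close>

lemma eliminate_sound:
  assumes F: "\<And>K a b. Nd K (Nd a b) \<in> set F \<Longrightarrow> fact_sound K a b"
    and tb0: "\<And>r. r \<in> set tb0 \<Longrightarrow> \<exists>d. realizes (right r) d"
    and "eliminate Q F tb0 L \<noteq> []"
    and "\<And>v. v \<in> A \<Longrightarrow> \<exists>r\<in>set (eliminate Q F tb0 L). left r = v \<and> realizes (right r) (s v)"
  shows "\<exists>s'. (\<forall>v\<in>A. s' v = s v) \<and> (\<forall>e\<in>set L. \<forall>t\<in>set Q. covered t (left e) (right e) \<longrightarrow>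
    Rel (key t) (s' (arg_l t)) (s' (arg_r t)))"
  using assms(3,4)
proof (induction L arbitrary: A s)
  case (Cons l L)
  define tb where "tb = eliminate Q F tb0 L"
  have el: "eliminate Q F tb0 (l # L) = filter (survives Q F l tb) tb0"
    by (simp add: eliminate_def tb_def)
  have sub: "set tb \<subseteq> set tb0" unfolding tb_def eliminate_def by (cases L) auto
  let ?x = "left l" and ?p = "right l"
  from Cons.prems(1) obtain m where "survives Q F l tb m"
    unfolding el by (metis (no_types, lifting) filter_False)
  then obtain r r' where r: "r \<in> set tb" "left r = ?x" "r' \<in> set tb" "left r' = ?p"
      "compatible Q F ?x (right r) ?p (right r')"
    unfolding survives_def by blast
  have A: "v \<noteq> ?x \<and> (\<exists>r\<in>set tb. left r = v \<and> realizes (right r) (s v))" if "v \<in> A" for v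
    using Cons.prems(2)[OF that] unfolding el survives_def by auto
  obtain d0 where d0: "realizes (right r') d0" using r sub tb0 by blast
  obtain d b where d: "?x \<noteq> ?p \<Longrightarrow> ?p \<in> A \<Longrightarrow> d = s ?p" and b: "b \<in> set tb" "left b = ?x" and
      "\<exists>a\<in>set tb. left a = ?p \<and> realizes (right a) d \<and> compatible Q F ?x (right b) ?p (right a)"
  \<comment> \<open>If \<open>p\<close> already has a value, that value realizes a row which
    survived the join and so has a partner row for \<open>x\<close>. Otherwise \<open>p\<close>
    takes any realization of the row \<open>r'\<close>.\<close>
  proof (cases "?p \<in> A")
    case True
    then obtain a where "a \<in> set tb" "left a = ?p" "realizes (right a) (s ?p)"
        "\<exists>b\<in>set tb. left b = ?x \<and> compatible Q F ?x (right b) ?p (right a)"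
      using Cons.prems(2) unfolding el survives_def by fastforce
    then show ?thesis using that by blast
  next
    case False
    then show ?thesis using that r d0 by blast
  qed
  then obtain a where a: "a \<in> set tb" "left a = ?p" "realizes (right a) d" "compatible Q F ?x (right b) ?p (right a)"
    by blast
  from compatible_sound[OF F a(4)] a(3) b tb0 sub obtain e where e: "realizes (right b) e"
      "\<And>t. t \<in> set Q \<Longrightarrow> covered t ?x ?p \<Longrightarrow> Rel (key t) (if arg_l t = ?x then e else d) (if arg_r t = ?x then e else d)"
    by blast
  \<comment> \<open>The order of the updates matters when \<open>?x = ?p\<close>: the value
    \<open>e\<close> must then prevail.\<close>
  define s2 where "s2 = s(?p := d, ?x := e)"
  have "\<exists>s'. (\<forall>v\<in>insert ?x (insert ?p A). s' v = s2 v) \<and> (\<forall>e\<in>set L. \<forall>t\<in>set Q. covered t (left e) (right e) \<longrightarrow>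
    Rel (key t) (s' (arg_l t)) (s' (arg_r t)))"
  proof (rule Cons.IH, unfold tb_def[symmetric])
    show "tb \<noteq> []" using r by auto
    fix v assume "v \<in> insert ?x (insert ?p A)"
    then show "\<exists>r\<in>set tb. left r = v \<and> realizes (right r) (s2 v)"
      using A a b e(1) unfolding s2_def by (cases "v = ?x"; cases "v = ?p") auto
  qed
  then obtain s' where s': "\<forall>v\<in>insert ?x (insert ?p A). s' v = s2 v"
    "\<forall>e\<in>set L. \<forall>t\<in>set Q. covered t (left e) (right e) \<longrightarrow> Rel (key t) (s' (arg_l t)) (s' (arg_r t))"
    by blast
  have "v \<noteq> ?x" if "v \<in> A" for v using A that by blast
  then have "\<forall>v\<in>A. s' v = s v" using s'(1) d unfolding s2_def by (metis fun_upd_apply insertCI)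
  moreover have "Rel (key t) (s' (arg_l t)) (s' (arg_r t))" if t: "t \<in> set Q" "covered t ?x ?p" for t
  proof -
    have "s' (arg_l t) = (if arg_l t = ?x then e else d)" "s' (arg_r t) = (if arg_r t = ?x then e else d)"
      using s'(1) t(2) unfolding s2_def covered_def by auto
    with e(2)[OF t] show ?thesis by simp
  qed
  ultimately show ?case using s'(2) by auto
qed auto

end

section \<open>Elimination orders for homomorphisms into the chase\<close>

text \<open>Elements of the real chase. A null is named by its creating tgd and its parent, so the
  forest structure is built into the terms.\<close>

datatype elem = Ind tree | Nul tree elem

primrec depth :: "elem \<Rightarrow> nat" where
  "depth (Ind a) = 0"
| "depth (Nul \<tau> d) = Suc (depth d)"

primrec proj :: "elem \<Rightarrow> tree" where
  "proj (Ind a) = individual a"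
| "proj (Nul \<tau> d) = null_child \<tau> (proj d)"

lemma chase_proj:
  assumes "(K, d, e) \<in> chase Nul T ((\<lambda>(K, a, b). (K, Ind a, Ind b)) ` D)"
  shows "(K, proj d, proj e) \<in> chase null_child T ((\<lambda>(K, a, b). (K, individual a, individual b)) ` D)"
  using assms
proof (induction "(K, d, e)" arbitrary: K d e rule: chase.induct)
  case chase_data
  then obtain a b where "(K, a, b) \<in> D" "d = Ind a" "e = Ind b" by auto
  then show ?case by (intro chase.chase_data) (force simp: image_iff)
next
  case (chase_step K a b \<tau> h)
  have "proj (subst \<tau> (Nul \<tau> a) a b w) = subst \<tau> (null_child \<tau> (proj a)) (proj a) (proj b) w" for w
    by (simp add: subst_def)
  moreover have "matches \<tau> K (proj a) (proj b)"
    using chase_step by (auto simp: matches_def)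
  ultimately show ?case
    using chase.chase_step[of K "proj a" "proj b" null_child T _ \<tau> h] chase_step by simp
qed

definition linked :: "elem \<Rightarrow> elem \<Rightarrow> bool" where
  "linked d e \<longleftrightarrow> d = e \<or> depth d = 0 \<and> depth e = 0 \<or> (\<exists>\<tau>. e = Nul \<tau> d) \<or> (\<exists>\<tau>. d = Nul \<tau> e)"

definition downward :: "elem \<Rightarrow> elem \<Rightarrow> bool" where
  "downward d e \<longleftrightarrow> depth d = 0 \<and> depth e = 0 \<or> (\<exists>\<tau>. e = Nul \<tau> d)"

lemma linked_sym: "linked d e \<longleftrightarrow> linked e d"
  unfolding linked_def by auto

text \<open>The arguments of a derived fact are among the arguments \<open>a\<close>,
  \<open>b\<close> of the previous one, or the new null occurs, and then \<open>a = b\<close> is its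
  parent.\<close>

lemma chase_linked:
  assumes "(K, d, e) \<in> chase Nul T ((\<lambda>(K, a, b). (K, Ind a, Ind b)) ` D)" "\<forall>\<tau>\<in>T. two_vars \<tau>"
  shows "linked d e"
  using assms(1)
proof (induction "(K, d, e)" arbitrary: K d e rule: chase.induct)
  case chase_data
  then show ?case by (auto simp: linked_def)
next
  case (chase_step K a b \<tau> h)
  let ?x = "arg_l (left \<tau>)" and ?y = "arg_r (left \<tau>)" and ?p = "arg_l h" and ?q = "arg_r h"
  from chase_step assms(2) obtain y where
    y: "\<And>w. w \<in> {?p, ?q} \<Longrightarrow> w = ?x \<or> w = ?y \<or> (?x = ?y \<and> w = y)"
    unfolding two_vars_def by metis
  have ab: "?x = ?y \<Longrightarrow> a = b" using chase_step by (simp add: matches_def)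
  have s: "subst \<tau> (Nul \<tau> a) a b w \<in> {a, b} \<or> a = b \<and> subst \<tau> (Nul \<tau> a) a b w = Nul \<tau> a" if "w \<in> {?p, ?q}" for w
    using y[OF that] ab by (auto simp: subst_def)
  show ?case
    using s[of ?p] s[of ?q] chase_step(2) linked_sym[of a b] unfolding linked_def by auto
qed

lemma downward_oriented: "downward d e \<Longrightarrow> oriented (proj d) (proj e)"
  unfolding downward_def oriented_def
  by (cases d; cases e) (auto simp: individual_def null_child_def)

text \<open>Acyclicity in a form that deletions preserve and merges can preserve: each edge joins a
  vertex to a parent of smaller rank. Loops are exempt, as they come from unary atoms and from
  merged neighbours.\<close>

definition forest_like :: "('v \<times> 'v) set \<Rightarrow> ('v \<Rightarrow> 'v) \<Rightarrow> ('v \<Rightarrow> nat) \<Rightarrow> bool" where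
  "forest_like E par rank \<longleftrightarrow> (\<forall>u v. (u, v) \<in> E \<longrightarrow> u \<noteq> v \<longrightarrow>
     v = par u \<and> rank v < rank u \<or> u = par v \<and> rank u < rank v)"

lemma forest_like_inj_image:
  assumes "forest_like E par rank" "inj f"
  shows "forest_like (map_prod f f ` E) (f \<circ> par \<circ> inv f) (rank \<circ> inv f)"
  using assms unfolding forest_like_def by (auto simp: inj_eq) blast+

text \<open>The merged vertex keeps the parent and rank of \<open>y\<close>. Children of
  \<open>z\<close> can be attached to it since \<open>rank y \<le> rank z\<close>; only the edge
  from \<open>z\<close> to its own parent needs an explanation, which the last hypothesis
  gives.\<close>

lemma forest_like_merge:
  assumes E: "forest_like E par rank" and yz: "y \<noteq> z" "rank y \<le> rank z"
    and z: "\<And>v. (z, v) \<in> E \<or> (v, z) \<in> E \<Longrightarrow> v = par z \<Longrightarrow> rank v < rank z \<Longrightarrow>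
      v = y \<or> v = par y \<and> rank v < rank y \<or> y = par v \<and> rank y < rank v"
  defines "r \<equiv> id(z := y)"
  shows "forest_like (map_prod r r ` E) (r \<circ> par) rank"
proof -
  have main: "r v = (r \<circ> par) (r u) \<and> rank (r v) < rank (r u) \<or> r u = (r \<circ> par) (r v) \<and> rank (r u) < rank (r v)"
    if uv: "(u, v) \<in> E \<or> (v, u) \<in> E" "v = par u" "rank v < rank u" "r u \<noteq> r v" for u v
  proof -
    consider "u \<noteq> z" "v \<noteq> z" | "v = z" "u \<noteq> z" | "u = z" "v \<noteq> z" using uv(4) by blast
    then show ?thesis
    proof cases
      case 3
      then show ?thesis using z[of v] uv yz unfolding r_def by auto
    qed (use uv yz in \<open>auto simp: r_def\<close>)
  qed
  show ?thesis unfolding forest_like_def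
  proof (intro allI impI)
    fix u' v'
    assume "(u', v') \<in> map_prod r r ` E" "u' \<noteq> v'"
    then obtain u v where uv: "(u, v) \<in> E" "u' = r u" "v' = r v" "r u \<noteq> r v" by auto
    then have "u \<noteq> v" by auto
    with uv E have "v = par u \<and> rank v < rank u \<or> u = par v \<and> rank u < rank v"
      unfolding forest_like_def by blast
    then show "v' = (r \<circ> par) u' \<and> rank v' < rank u' \<or> u' = (r \<circ> par) v' \<and> rank u' < rank v'"
      using main[of u v] main[of v u] uv by auto
  qed
qed

fun valid_plan :: "('v \<Rightarrow> elem) \<Rightarrow> ('v \<times> 'v) set \<Rightarrow> 'v set \<Rightarrow> ('v \<times> 'v) list \<Rightarrow> bool" where
  "valid_plan h E W [] = True"
| "valid_plan h E W ((x, p) # L) \<longleftrightarrow> x \<in> W \<and> p \<in> W \<and>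
     (x \<noteq> p \<longrightarrow> (x, p) \<in> E \<or> (p, x) \<in> E \<longrightarrow> downward (h p) (h x)) \<and> valid_plan h E (W - {x}) L"

lemma valid_plan_mono:
  "valid_plan h E W L \<Longrightarrow> W \<subseteq> W' \<Longrightarrow> valid_plan h E W' L"
proof (induction L arbitrary: W W')
  case (Cons e L)
  obtain x p where e: "e = (x, p)" by (cases e)
  have "valid_plan h E (W - {x}) L" using Cons.prems(1) unfolding e by simp
  then have "valid_plan h E (W' - {x}) L" by (rule Cons.IH) (use Cons.prems(2) in blast)
  with Cons.prems show ?case unfolding e valid_plan.simps by blast
qed simp

lemma valid_plan_cong:
  "valid_plan h E W L \<Longrightarrow> (\<And>u v. (u, v) \<in> E' \<Longrightarrow> u \<in> W \<Longrightarrow> v \<in> W \<Longrightarrow> (u, v) \<in> E) \<Longrightarrow> valid_plan h E' W L"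
proof (induction L arbitrary: W)
  case (Cons e L)
  obtain x p where e: "e = (x, p)" by (cases e)
  have "valid_plan h E (W - {x}) L" using Cons.prems(1) unfolding e by simp
  then have "valid_plan h E' (W - {x}) L" by (rule Cons.IH) (use Cons.prems(2) in blast)
  moreover have "x \<in> W" "p \<in> W" using Cons.prems(1) unfolding e by simp_all
  ultimately show ?case using Cons.prems unfolding e valid_plan.simps by blast
qed simp

text \<open>Merges and eliminations alternate when a plan is found, but here all merges are
  collected in one renaming \<open>\<rho>\<close> that is applied beforehand, and \<open>L\<close>
  speaks about representatives. This is the shape of the certificate.\<close>

definition plan_for ::
    "('v \<Rightarrow> elem) \<Rightarrow> 'v set \<Rightarrow> ('v \<times> 'v) set \<Rightarrow> ('v \<Rightarrow> 'v) \<Rightarrow> ('v \<times> 'v) list \<Rightarrow> bool" where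
  "plan_for h V E \<rho> L \<longleftrightarrow> (\<forall>v\<in>V. \<rho> v \<in> V \<and> h (\<rho> v) = h v) \<and> length L \<le> card V \<and>
     valid_plan h (map_prod \<rho> \<rho> ` E) V L \<and>
     (\<forall>u v. (u, v) \<in> E \<longrightarrow> (\<exists>x p. (x, p) \<in> set L \<and> \<rho> u \<in> {x, p} \<and> \<rho> v \<in> {x, p}))"

lemma plan_for_merge:
  assumes "finite V" "E \<subseteq> V \<times> V" "y \<in> V" "z \<in> V" "y \<noteq> z" "h y = h z"
    and plan: "plan_for h (V - {z}) (map_prod (id(z := y)) (id(z := y)) ` E) \<rho> L"
  shows "plan_for h V E (\<rho> \<circ> id(z := y)) L"
  unfolding plan_for_def
proof (intro conjI)
  let ?r = "id(z := y)"
  have im: "map_prod (\<rho> \<circ> ?r) (\<rho> \<circ> ?r) ` E = map_prod \<rho> \<rho> ` map_prod ?r ?r ` E"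
    by (simp add: image_image map_prod.compositionality)
  show "\<forall>v\<in>V. (\<rho> \<circ> ?r) v \<in> V \<and> h ((\<rho> \<circ> ?r) v) = h v"
    using plan assms unfolding plan_for_def by auto
  show "length L \<le> card V"
    using plan card_Diff1_le[of V z] unfolding plan_for_def by simp
  show "valid_plan h (map_prod (\<rho> \<circ> ?r) (\<rho> \<circ> ?r) ` E) V L"
    unfolding im using plan valid_plan_mono[of h _ "V - {z}" L V] unfolding plan_for_def by blast
  show "\<forall>u v. (u, v) \<in> E \<longrightarrow> (\<exists>x p. (x, p) \<in> set L \<and> (\<rho> \<circ> ?r) u \<in> {x, p} \<and> (\<rho> \<circ> ?r) v \<in> {x, p})"
  proof (intro allI impI)
    fix u v assume "(u, v) \<in> E"
    then have uv: "(?r u, ?r v) \<in> map_prod ?r ?r ` E" by (rule map_prod_imageI)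
    have "\<exists>x p. (x, p) \<in> set L \<and> \<rho> u' \<in> {x, p} \<and> \<rho> v' \<in> {x, p}"
      if "(u', v') \<in> map_prod ?r ?r ` E" for u' v'
      using plan that unfolding plan_for_def by blast
    from this[OF uv]
    show "\<exists>x p. (x, p) \<in> set L \<and> (\<rho> \<circ> ?r) u \<in> {x, p} \<and> (\<rho> \<circ> ?r) v \<in> {x, p}"
      unfolding comp_apply .
  qed
qed

lemma plan_for_eliminate:
  assumes "finite V" "E \<subseteq> V \<times> V" "x \<in> V" "p \<in> V"
    and x: "\<And>v. (x, v) \<in> E \<or> (v, x) \<in> E \<Longrightarrow> v = x \<or> v = p"
    and down: "x \<noteq> p \<Longrightarrow> downward (h p) (h x)"
    and plan: "plan_for h (V - {x}) (E \<inter> (V - {x}) \<times> (V - {x})) \<rho> L"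
  shows "\<exists>\<rho> L. plan_for h V E \<rho> L"
proof -
  let ?V = "V - {x}"
  \<comment> \<open>\<open>x\<close> has left the query before any later merge and represents
    itself. Its partner \<open>p\<close> may still be merged, so the new entry names the final
    representative of \<open>p\<close>.\<close>
  define \<rho>' where "\<rho>' = \<rho>(x := x)"
  define L' where "L' = (x, \<rho>' p) # L"
  have \<rho>: "\<rho> v \<in> ?V \<and> h (\<rho> v) = h v" if "v \<in> ?V" for v using plan that unfolding plan_for_def by blast
  have \<rho>': "\<rho>' v \<in> V \<and> h (\<rho>' v) = h v" "\<rho>' v = x \<longleftrightarrow> v = x" if "v \<in> V" for v
    using \<rho>[of v] that assms(3) by (auto simp: \<rho>'_def)
  have "plan_for h V E \<rho>' L'"
    unfolding plan_for_def
  proof (intro conjI)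
    show "\<forall>v\<in>V. \<rho>' v \<in> V \<and> h (\<rho>' v) = h v" using \<rho>' by blast
    have "length L \<le> card ?V" using plan unfolding plan_for_def by blast
    moreover have "card ?V < card V" using assms(1,3) by (rule card_Diff1_less)
    ultimately show "length L' \<le> card V" by (simp add: L'_def)
    have "valid_plan h (map_prod \<rho> \<rho> ` (E \<inter> ?V \<times> ?V)) ?V L"
      using plan unfolding plan_for_def by blast
    then have "valid_plan h (map_prod \<rho>' \<rho>' ` E) ?V L"
    proof (rule valid_plan_cong)
      fix u v assume uv: "(u, v) \<in> map_prod \<rho>' \<rho>' ` E" "u \<in> ?V" "v \<in> ?V"
      then obtain u' v' where u': "(u', v') \<in> E" "u = \<rho>' u'" "v = \<rho>' v'" by auto
      then have "u' \<in> ?V" "v' \<in> ?V" using uv assms(2) \<rho>'(2) by auto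
      with u' show "(u, v) \<in> map_prod \<rho> \<rho> ` (E \<inter> ?V \<times> ?V)" by (force simp: \<rho>'_def)
    qed
    moreover have "downward (h (\<rho>' p)) (h x)" if "x \<noteq> \<rho>' p"
    proof -
      have "x \<noteq> p" using that \<rho>'(2)[OF assms(4)] by auto
      with down \<rho>'(1)[OF assms(4)] show ?thesis by simp
    qed
    ultimately show "valid_plan h (map_prod \<rho>' \<rho>' ` E) V L'"
      using assms(3) \<rho>'(1)[OF assms(4)] unfolding L'_def valid_plan.simps by blast
    show "\<forall>u v. (u, v) \<in> E \<longrightarrow> (\<exists>y q. (y, q) \<in> set L' \<and> \<rho>' u \<in> {y, q} \<and> \<rho>' v \<in> {y, q})"
    proof (intro allI impI)
      fix u v assume uv: "(u, v) \<in> E"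
      show "\<exists>y q. (y, q) \<in> set L' \<and> \<rho>' u \<in> {y, q} \<and> \<rho>' v \<in> {y, q}"
      proof (cases "u = x \<or> v = x")
        case True
        then have "u \<in> {x, p}" "v \<in> {x, p}" using x uv by auto
        then have "\<rho>' u \<in> {x, \<rho>' p}" "\<rho>' v \<in> {x, \<rho>' p}" by (auto simp: \<rho>'_def)
        then show ?thesis unfolding L'_def by (meson list.set_intros(1))
      next
        case False
        then have "(u, v) \<in> E \<inter> ?V \<times> ?V" using uv assms(2) by auto
        then have "\<exists>y q. (y, q) \<in> set L \<and> \<rho> u \<in> {y, q} \<and> \<rho> v \<in> {y, q}"
          using plan unfolding plan_for_def by blast
        moreover have "\<rho>' u = \<rho> u" "\<rho>' v = \<rho> v" using False by (simp_all add: \<rho>'_def)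
        ultimately show ?thesis unfolding L'_def by (metis list.set_intros(2))
      qed
    qed
  qed
  then show ?thesis by blast
qed

text \<open>Both a merge and an elimination remove one vertex. Of two merged vertices the one with
  smaller rank is kept, as \<open>forest_like_merge\<close> requires. A vertex without neighbours is
  eliminated by an entry \<open>(x, x)\<close>.\<close>

lemma plan_exists:
  assumes "finite V" "E \<subseteq> V \<times> V" "forest_like E par rank" "\<And>u v. (u, v) \<in> E \<Longrightarrow> linked (h u) (h v)"
  shows "\<exists>\<rho> L. plan_for h V E \<rho> L"
  using assms
proof (induction "card V" arbitrary: V E par rank)
  case 0
  then have "plan_for h V E id []" by (auto simp: plan_for_def)
  then show ?case by blast
next
  case (Suc n)
  note fin = \<open>finite V\<close> and EV = \<open>E \<subseteq> V \<times> V\<close> and forest = \<open>forest_like E par rank\<close>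
    and linked = Suc.prems(4)
  define nb where "nb u v \<longleftrightarrow> ((u, v) \<in> E \<or> (v, u) \<in> E) \<and> u \<noteq> v" for u v
  have nb: "v = par u \<and> rank v < rank u \<or> u = par v \<and> rank u < rank v" if "nb u v" for u v
    using forest that unfolding nb_def forest_like_def by auto
  have nbV: "u \<in> V" "v \<in> V" "linked (h u) (h v)" "nb v u" if "nb u v" for u v
    using that EV linked[of u v] linked[of v u] linked_sym[of "h u" "h v"] unfolding nb_def by auto
  have merge: "\<exists>\<rho> L. plan_for h V E \<rho> L"
    if "y \<in> V" "z \<in> V" "y \<noteq> z" "h y = h z" "rank y \<le> rank z"
      "\<And>v. nb z v \<Longrightarrow> v = par z \<Longrightarrow> rank v < rank z \<Longrightarrow>
        v = y \<or> v = par y \<and> rank v < rank y \<or> y = par v \<and> rank y < rank v" for y z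
  proof -
    let ?r = "id(z := y)"
    have "\<exists>\<rho> L. plan_for h (V - {z}) (map_prod ?r ?r ` E) \<rho> L"
    proof (rule Suc.hyps(1))
      show "n = card (V - {z})" using Suc.hyps(2) that fin by simp
      have "?r w \<in> V - {z}" if "w \<in> V" for w using that \<open>y \<in> V\<close> \<open>y \<noteq> z\<close> by simp
      then show "map_prod ?r ?r ` E \<subseteq> (V - {z}) \<times> (V - {z})" using EV by blast
      show "forest_like (map_prod ?r ?r ` E) (?r \<circ> par) rank"
      proof (rule forest_like_merge[OF forest that(3,5)])
        fix v assume v: "(z, v) \<in> E \<or> (v, z) \<in> E" "v = par z" "rank v < rank z"
        then have "nb z v" unfolding nb_def by blast
        from that(6)[OF this v(2,3)]
        show "v = y \<or> v = par y \<and> rank v < rank y \<or> y = par v \<and> rank y < rank v" .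
      qed
      fix u v assume "(u, v) \<in> map_prod ?r ?r ` E"
      then obtain u' v' where "(u', v') \<in> E" "u = ?r u'" "v = ?r v'" by auto
      moreover have "h (?r w) = h w" for w using that by simp
      ultimately show "linked (h u) (h v)" using linked by metis
    qed (use fin in simp)
    then show ?thesis using plan_for_merge[OF fin EV that(1,2,3,4)] by blast
  qed
  have elim: "\<exists>\<rho> L. plan_for h V E \<rho> L"
    if "x \<in> V" "p \<in> V" "\<And>v. nb x v \<Longrightarrow> v = p" "x \<noteq> p \<Longrightarrow> downward (h p) (h x)" for x p
  proof -
    have "\<exists>\<rho> L. plan_for h (V - {x}) (E \<inter> (V - {x}) \<times> (V - {x})) \<rho> L"
    proof (rule Suc.hyps(1))
      show "n = card (V - {x})" using Suc.hyps(2) that fin by simp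
      show "forest_like (E \<inter> (V - {x}) \<times> (V - {x})) par rank"
        using forest unfolding forest_like_def by blast
    qed (use fin linked in auto)
    then obtain \<rho> L where "plan_for h (V - {x}) (E \<inter> (V - {x}) \<times> (V - {x})) \<rho> L" by blast
    then show ?thesis
      by (intro plan_for_eliminate[OF fin EV that(1,2) _ that(4)]) (use that(3) in \<open>auto simp: nb_def\<close>)
  qed
  have ne: "V \<noteq> {}" using Suc.hyps(2) by auto
  have ex_max: "\<exists>x\<in>V. \<forall>v\<in>V. f v \<le> (f x :: nat)" for f
  proof -
    have "Max (f ` V) \<in> f ` V" using fin ne by simp
    then obtain x where "x \<in> V" "f x = Max (f ` V)" by force
    then show ?thesis using fin by (intro bexI[of _ x]) auto
  qed
  show ?case
  proof (cases "\<forall>x\<in>V. depth (h x) = 0")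
    case True
    \<comment> \<open>A vertex of maximal rank has no child, so its parent is its only possible
      neighbour.\<close>
    obtain x where x: "x \<in> V" "\<And>v. v \<in> V \<Longrightarrow> rank v \<le> rank x"
      using ex_max[of rank] by blast
    have par: "v = par x" if "nb x v" for v
      using nb[OF that] x(2)[OF nbV(2)[OF that]] by auto
    show ?thesis
    proof (cases "\<exists>v. nb x v")
      case True
      then obtain v where v: "nb x v" by blast
      show ?thesis
        using \<open>\<forall>x\<in>V. depth (h x) = 0\<close> x(1) nbV(2)[OF v] par par[OF v]
        by (intro elim[of x v]) (auto simp: downward_def)
    next
      case False
      then show ?thesis using x(1) by (intro elim[of x x]) auto
    qed
  next
    case False
    obtain x where x: "x \<in> V" "\<And>v. v \<in> V \<Longrightarrow> depth (h v) \<le> depth (h x)"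
      using ex_max[of "\<lambda>v. depth (h v)"] by blast
    have d: "depth (h x) \<noteq> 0" using False x(2) by (metis le_zero_eq)
    show ?thesis
    proof (cases "\<exists>y. nb x y \<and> h y = h x")
      case True
      then obtain y where y: "nb x y" "h y = h x" by blast
      have step: "\<exists>\<rho> L. plan_for h V E \<rho> L" if "nb z y" "h y = h z" "y = par z" "rank y < rank z" for y z
        using that nbV[OF that(1)] by (intro merge[of y z]) (auto simp: nb_def)
      from nb[OF y(1)] show ?thesis
        using step[of x y] step[of y x] y nbV(4)[OF y(1)] by auto
    next
      case False
      \<comment> \<open>The image of a neighbour is linked to a null and differs from it. A child of
        the null would be deeper, so only its parent remains.\<close>
      have up: "\<exists>\<tau>. h x = Nul \<tau> (h y)" if "nb x y" for y
      proof -
        have "h y \<noteq> h x" "depth (h y) \<le> depth (h x)" using False that x(2) nbV[OF that] by auto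
        moreover have "linked (h x) (h y)" by (rule nbV(3)[OF that])
        ultimately show ?thesis using d unfolding linked_def by auto
      qed
      show ?thesis
      proof (cases "\<exists>y z. nb x y \<and> nb x z \<and> y \<noteq> z")
        case True
        then obtain y z where yz: "nb x y" "nb x z" "y \<noteq> z" "rank y \<le> rank z"
          by (metis linear)
        have "h y = h z" using up[OF yz(1)] up[OF yz(2)] by auto
        \<comment> \<open>At most one of \<open>y\<close> and \<open>z\<close> is the parent of
          \<open>x\<close>, and it cannot be \<open>z\<close>, because the other one would then be a
          child of \<open>x\<close> with a larger rank than \<open>z\<close>. Hence the upward edge
          of \<open>z\<close> leads to \<open>x\<close>, which is adjacent to \<open>y\<close>
          too.\<close>
        moreover have xz: "x = par z" "rank x < rank z" and
          "y = par x \<and> rank y < rank x \<or> x = par y \<and> rank x < rank y"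
          using nb[OF yz(1)] nb[OF yz(2)] yz(3,4) by auto
        ultimately show ?thesis
          using yz nbV by (intro merge[of y z]) auto
      next
        case False
        show ?thesis
        proof (cases "\<exists>v. nb x v")
          case True
          then obtain v where v: "nb x v" by blast
          then show ?thesis
            using False x(1) nbV(2)[OF v] up[OF v] by (intro elim[of x v]) (auto simp: downward_def)
        next
          case False
          then show ?thesis using x(1) by (intro elim[of x x]) auto
        qed
      qed
    qed
  qed
qed

text \<open>The rows given by \<open>h\<close> for the remaining variables are never filtered out,
  since they are compatible with each other. The row \<open>m0\<close> belongs to no variable and
  outlives them all. The list is reversed because \<open>eliminate\<close> starts from its
  end.\<close>

lemma eliminate_complete:
  assumes F: "\<And>t. t \<in> set Q \<Longrightarrow> Nd (key t) (Nd (proj (h (arg_l t))) (proj (h (arg_r t)))) \<in> set F"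
    and E: "E = (\<lambda>t. (arg_l t, arg_r t)) ` set Q"
    and tb0: "m0 \<in> set tb0" "left m0 \<notin> V" "\<And>v. v \<in> V \<Longrightarrow> Nd v (proj (h v)) \<in> set tb0"
    and plan: "valid_plan h E V L"
  shows "m0 \<in> set (eliminate Q F tb0 (rev (map (\<lambda>(x, p). Nd x p) L)))"
proof -
  let ?step = "\<lambda>e tb. filter (\<lambda>m. survives Q F e tb m) tb0"
  have "m0 \<in> set (fold ?step (map (\<lambda>(x, p). Nd x p) L) tb)"
    if "m0 \<in> set tb" "W \<subseteq> V" "\<And>v. v \<in> W \<Longrightarrow> Nd v (proj (h v)) \<in> set tb" "valid_plan h E W L" for tb W
    using that
  proof (induction L arbitrary: tb W)
    case (Cons e L)
    obtain x p where e: "e = (x, p)" by (cases e)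
    have x: "x \<in> W" "p \<in> W" using Cons.prems e by auto
    have ok: "compatible Q F x (proj (h x)) p (proj (h p))"
      unfolding compatible_def
    proof (intro ballI impI conjI)
      fix t assume t: "t \<in> set Q" "covered t x p"
      have "(if w = x then proj (h x) else proj (h p)) = proj (h w)" if "w = x \<or> w = p" for w
        using that by auto
      with t F[OF t(1)] show "Nd (key t) (Nd (if arg_l t = x then proj (h x) else proj (h p))
          (if arg_r t = x then proj (h x) else proj (h p))) \<in> set F"
        unfolding covered_def by simp
      assume "arg_l t \<noteq> arg_r t"
      with t have "x \<noteq> p" "(x, p) \<in> E \<or> (p, x) \<in> E" unfolding E covered_def by (auto simp: image_iff)
      with Cons.prems(4) have "downward (h p) (h x)" unfolding e valid_plan.simps by blast
      then show "oriented (proj (h p)) (proj (h x))" by (rule downward_oriented)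
    qed
    have rows: "Nd x (proj (h x)) \<in> set tb" "Nd p (proj (h p)) \<in> set tb" using x Cons.prems by auto
    have ex: "\<exists>r\<in>set tb. left r = x \<and> (\<exists>r'\<in>set tb. left r' = p \<and> compatible Q F x (right r) p (right r'))"
      using rows ok by force
    have ex': "\<exists>r\<in>set tb. left r = x \<and> compatible Q F x (right r) p (proj (h p))"
      using rows ok by force
    have "m0 \<in> set (fold ?step (map (\<lambda>(x, p). Nd x p) L) (?step (Nd x p) tb))"
    proof (rule Cons.IH[where W = "W - {x}"])
      have "left m0 \<noteq> x" "left m0 \<noteq> p" using tb0 x Cons.prems(2) by auto
      then show "m0 \<in> set (?step (Nd x p) tb)"
        using Cons.prems(1) tb0(1) ex by (simp add: survives_def)
      show "Nd v (proj (h v)) \<in> set (?step (Nd x p) tb)" if "v \<in> W - {x}" for v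
        using that Cons.prems(2,3) tb0(3) ex ex' by (auto simp: survives_def)
    qed (use Cons.prems e in auto)
    then show ?case using e by simp
  qed simp
  from this[OF tb0(1) subset_refl tb0(3) plan] show ?thesis
    by (simp add: eliminate_def foldr_conv_fold)
qed

section \<open>Graphs without cycles as forests of parent pointers\<close>

lemma acyclic_leaf:
  assumes "finite V" "V \<noteq> {}" "E \<subseteq> V \<times> V" "sym E" "irrefl E" "\<nexists>c. is_cycle E c"
  shows "\<exists>x\<in>V. \<exists>p. \<forall>v. (x, v) \<in> E \<longrightarrow> v = p"
proof (rule ccontr)
  assume neg: "\<not> ?thesis"
  define path where "path xs \<longleftrightarrow> distinct xs \<and> xs \<noteq> [] \<and> set xs \<subseteq> V \<and>
    (\<forall>i. Suc i < length xs \<longrightarrow> (xs ! i, xs ! Suc i) \<in> E)" for xs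
  obtain v where "v \<in> V" using assms by blast
  then have "path [v]" by (simp add: path_def)
  moreover have "\<forall>xs. path xs \<longrightarrow> length xs < Suc (card V)"
    unfolding path_def using assms(1) by (metis card_mono distinct_card le_imp_less_Suc)
  \<comment> \<open>The first vertex of a longest path is the leaf: all its neighbours lie on the
    path, and one other than the second vertex would close a cycle.\<close>
  ultimately obtain xs where xs: "path xs" "\<And>ys. path ys \<Longrightarrow> length ys \<le> length xs"
    using ex_has_greatest_nat[of path "[v]" length "Suc (card V)"] by (metis less_imp_le)
  define x where "x = xs ! 0"
  have len: "0 < length xs" using xs(1) by (simp add: path_def)
  have nbs: "v \<in> set xs" if "(x, v) \<in> E" for v
  proof (rule ccontr)
    assume "v \<notin> set xs"
    then have "path (v # xs)"
      using xs(1) that assms(3,4) unfolding path_def x_def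
      by (auto simp: nth_Cons sym_def split: nat.split)
    then show False using xs(2)[of "v # xs"] by simp
  qed
  have "x \<in> V" using xs(1) len unfolding path_def x_def by auto
  with neg obtain v where v: "(x, v) \<in> E" "v \<noteq> xs ! 1" by blast
  then obtain j where j: "j < length xs" "v = xs ! j" using nbs by (metis in_set_conv_nth)
  have "j \<noteq> 0" using v j assms(5) unfolding x_def irrefl_def by metis
  moreover have "j \<noteq> 1" using v j by auto
  ultimately have j2: "2 \<le> j" by simp
  have "is_cycle E (take (Suc j) xs)"
    unfolding is_cycle_def
  proof (intro conjI allI impI)
    show "3 \<le> length (take (Suc j) xs)" using j j2 by simp
    show "distinct (take (Suc j) xs)" using xs(1) by (simp add: path_def)
    show "(take (Suc j) xs ! i, take (Suc j) xs ! Suc i) \<in> E" if "Suc i < length (take (Suc j) xs)" for i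
      using that xs(1) by (simp add: path_def)
    have "last (take (Suc j) xs) = v" using j by (simp add: take_Suc_conv_app_nth)
    moreover have "hd (take (Suc j) xs) = x" using len by (simp add: x_def hd_conv_nth)
    ultimately show "(last (take (Suc j) xs), hd (take (Suc j) xs)) \<in> E"
      using v assms(4) by (simp add: sym_def)
  qed
  with assms(6) show False by blast
qed

lemma is_cycle_mono: "is_cycle E c \<Longrightarrow> E \<subseteq> E' \<Longrightarrow> is_cycle E' c"
  unfolding is_cycle_def by blast

text \<open>Leaves are peeled off one by one. A leaf put back below \<open>p\<close> gets a rank one
  above that of \<open>p\<close>.\<close>

lemma acyclic_forest_like:
  assumes "finite V" "E \<subseteq> V \<times> V" "sym E" "irrefl E" "\<nexists>c. is_cycle E c"
  shows "\<exists>par rank. forest_like E par rank"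
  using assms
proof (induction "card V" arbitrary: V E)
  case 0
  then have "E = {}" by auto
  then show ?case by (simp add: forest_like_def)
next
  case (Suc n)
  then have "V \<noteq> {}" by auto
  from acyclic_leaf[OF Suc.prems(1) this Suc.prems(2-5)] obtain x p where
    x: "x \<in> V" "\<And>v. (x, v) \<in> E \<Longrightarrow> v = p" by blast
  let ?E = "E \<inter> (V - {x}) \<times> (V - {x})"
  have "\<exists>par rank. forest_like ?E par rank"
  proof (rule Suc.hyps(1))
    show "n = card (V - {x})" using Suc x by simp
    show "sym ?E" using Suc.prems(3) by (auto simp: sym_def)
    show "irrefl ?E" using Suc.prems(4) by (auto simp: irrefl_def)
    show "\<nexists>c. is_cycle ?E c" using Suc.prems(5) is_cycle_mono by blast
  qed (use Suc.prems in auto)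
  then obtain par rank where f: "forest_like ?E par rank" by blast
  have "forest_like E (par(x := p)) (rank(x := Suc (rank p)))"
    unfolding forest_like_def
  proof clarify
    fix u v assume uv: "(u, v) \<in> E" "u \<noteq> v"
      and n: "\<not> (u = (par(x := p)) v \<and> (rank(x := Suc (rank p))) u < (rank(x := Suc (rank p))) v)"
    have vu: "(v, u) \<in> E" using uv Suc.prems(3) by (auto simp: sym_def)
    show "v = (par(x := p)) u \<and> (rank(x := Suc (rank p))) v < (rank(x := Suc (rank p))) u"
    proof (cases "u = x \<or> v = x")
      case True
      then show ?thesis using x(2) uv vu n by auto
    next
      case False
      then have "(u, v) \<in> ?E" using uv Suc.prems(2) by auto
      with f uv(2) have "v = par u \<and> rank v < rank u \<or> u = par v \<and> rank u < rank v"
        unfolding forest_like_def by blast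
      then show ?thesis using False n by auto
    qed
  qed
  then show ?case by blast
qed

section \<open>The decision procedure\<close>

text \<open>In the input format the argument positions are shifted: \<open>arg_l t\<close> is the
  predicate name there. The tag is made part of the key, which keeps unary and binary names apart,
  and a unary argument is doubled.\<close>

definition norm_atom :: "tree \<Rightarrow> tree" where
  "norm_atom t = (if left t = Lf then Nd (Nd Lf (arg_l t)) (Nd (arg_r t) (arg_r t))
     else Nd (Nd (left t) (arg_l t)) (arg_r t))"

definition norm_tgd :: "tree \<Rightarrow> tree" where
  "norm_tgd \<tau> = Nd (norm_atom (left \<tau>)) (of_list (map norm_atom (to_list (right \<tau>))))"

text \<open>An answer variable and the constant in the same place of the tuple are tied together by a fresh
  predicate. Places are counted from the end of the list, in unary.\<close>

definition numbered :: "tree list \<Rightarrow> tree list" where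
  "numbered l = foldr (\<lambda>a acc. Nd (of_list (map (\<lambda>_. Lf) (a # acc))) a # acc) l []"

text \<open>The tag differs from \<open>Lf\<close> and \<open>Nd Lf Lf\<close>, the tags in keys of
  ordinary atoms, which makes the predicate fresh.\<close>

definition answer_key :: "tree \<Rightarrow> tree" where
  "answer_key i = Nd (Nd Lf (Nd Lf Lf)) i"

definition answer_atoms :: "tree list \<Rightarrow> tree list" where
  "answer_atoms l = map (\<lambda>e. Nd (answer_key (left e)) (Nd (right e) (right e))) (numbered l)"

abbreviation "ans_part x \<equiv> to_list (left (left x))"
abbreviation "atom_part x \<equiv> to_list (right (left x))"
abbreviation "tgd_part x \<equiv> to_list (left (right x))"
abbreviation "data_part x \<equiv> to_list (left (right (right x)))"
abbreviation "tuple_part x \<equiv> to_list (right (right (right x)))"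

definition query_atoms :: "tree \<Rightarrow> tree list" where
  "query_atoms x = map norm_atom (atom_part x) @ answer_atoms (ans_part x)"

definition data_atoms :: "tree \<Rightarrow> tree list" where
  "data_atoms x = map norm_atom (data_part x) @ answer_atoms (tuple_part x)"

definition tgd_trees :: "tree \<Rightarrow> tree list" where
  "tgd_trees x = map norm_tgd (tgd_part x)"

definition args_of :: "tree list \<Rightarrow> tree list" where
  "args_of l = concat (map (\<lambda>t. [arg_l t, arg_r t]) l)"

lemma set_args_of: "set (args_of l) = (\<Union>t\<in>set l. {arg_l t, arg_r t})"
  by (auto simp: args_of_def)

definition data_facts :: "tree \<Rightarrow> tree list" where
  "data_facts x = map (\<lambda>t. Nd (key t) (Nd (individual (arg_l t)) (individual (arg_r t)))) (data_atoms x)"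

definition elements :: "tree \<Rightarrow> tree list" where
  "elements x = args_of (data_facts x) @ concat (map (\<lambda>\<tau>.
     [Nd (Nd Lf Lf) \<tau>, Nd (Nd Lf (Nd Lf Lf)) \<tau>, Nd (Nd Lf (Nd Lf (Nd Lf Lf))) \<tau>]) (tgd_trees x))"

definition keys :: "tree \<Rightarrow> tree list" where
  "keys x = map (\<lambda>t. key t) (data_facts x) @
     concat (map (\<lambda>\<tau>. map (\<lambda>h. key h) (to_list (right \<tau>))) (tgd_trees x))"

definition candidates :: "tree \<Rightarrow> tree list" where
  "candidates x = concat (map (\<lambda>K. concat (map (\<lambda>a. map (\<lambda>b. Nd K (Nd a b)) (elements x)) (elements x))) (keys x))"

definition consequence :: "tree \<Rightarrow> tree \<Rightarrow> tree \<Rightarrow> tree" where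
  "consequence g \<tau> h = Nd (key h) (Nd (subst \<tau> (null_child \<tau> (arg_l g)) (arg_l g) (arg_r g) (arg_l h))
     (subst \<tau> (null_child \<tau> (arg_l g)) (arg_l g) (arg_r g) (arg_r h)))"

definition derivable :: "tree \<Rightarrow> tree list \<Rightarrow> tree \<Rightarrow> bool" where
  "derivable f S x \<longleftrightarrow> f \<in> set (data_facts x) \<or> (\<exists>g\<in>set S. \<exists>\<tau>\<in>set (tgd_trees x).
     matches \<tau> (key g) (arg_l g) (arg_r g) \<and> (\<exists>h\<in>set (to_list (right \<tau>)). f = consequence g \<tau> h))"

text \<open>The list of candidates also serves as a clock: each round before saturation adds a
  candidate, so this number of rounds suffices.\<close>

definition facts :: "tree \<Rightarrow> tree list" where
  "facts x = foldr (\<lambda>_ S. filter (\<lambda>f. derivable f S x) (candidates x)) (candidates x) []"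

definition ground :: "(tree \<Rightarrow> 'e) \<Rightarrow> tree \<Rightarrow> (tree \<times> 'e \<times> 'e) set" where
  "ground f x = (\<lambda>(K, a, b). (K, f a, f b)) ` (\<lambda>t. (key t, arg_l t, arg_r t)) ` set (data_atoms x)"

lemma data_facts_ground: "f \<in> set (data_facts x) \<longleftrightarrow> (\<exists>K a b. f = Nd K (Nd a b) \<and> (K, a, b) \<in> ground individual x)"
  unfolding data_facts_def ground_def by (auto simp: image_iff)

lemma chase_candidates:
  assumes "(K, a, b) \<in> chase null_child (set (tgd_trees x)) (ground individual x)"
  shows "Nd K (Nd a b) \<in> set (candidates x)"
proof -
  have cand: "Nd K (Nd a b) \<in> set (candidates x) \<longleftrightarrow> K \<in> set (keys x) \<and> a \<in> set (elements x) \<and> b \<in> set (elements x)"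
    for K a b unfolding candidates_def by auto
  have lv: "next_level (left a) \<in> {Nd Lf Lf, Nd Lf (Nd Lf Lf), Nd Lf (Nd Lf (Nd Lf Lf))}" if "a \<in> set (elements x)" for a
  proof -
    have "left a \<in> {Lf, Nd Lf Lf, Nd Lf (Nd Lf Lf), Nd Lf (Nd Lf (Nd Lf Lf))}"
      using that by (auto simp: elements_def args_of_def data_facts_def individual_def)
    then show ?thesis by (auto simp: next_level_def)
  qed
  from assms show ?thesis
  proof (induction "(K, a, b)" arbitrary: K a b rule: chase.induct)
    case chase_data
    then have f: "Nd K (Nd a b) \<in> set (data_facts x)" using data_facts_ground by blast
    have "K \<in> set (keys x)" using f unfolding keys_def by force
    moreover have "a \<in> set (elements x)" "b \<in> set (elements x)"
      using f unfolding elements_def set_append set_args_of by force+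
    ultimately show ?case by (simp add: cand)
  next
    case (chase_step K a b \<tau> h)
    have ab: "a \<in> set (elements x)" "b \<in> set (elements x)" using chase_step(2) cand by auto
    have "null_child \<tau> a \<in> set (elements x)"
      using lv[OF ab(1)] chase_step(3) unfolding null_child_def elements_def by force
    with ab have "subst \<tau> (null_child \<tau> a) a b w \<in> set (elements x)" for w by (simp add: subst_def)
    moreover have "key h \<in> set (keys x)" using chase_step unfolding keys_def by auto
    ultimately show ?case by (simp add: cand)
  qed
qed

text \<open>The rounds form an increasing chain of subsets of the candidates that stops for good as
  soon as two successive members agree. Its limit is closed under the rules because
  \<open>chase_candidates\<close> ensures that no consequence falls outside the candidates.\<close>

lemma set_facts: "set (facts x) = {Nd K (Nd a b) | K a b. (K, a, b) \<in> chase null_child (set (tgd_trees x)) (ground individual x)}"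
  (is "_ = ?C")
proof -
  let ?U = "candidates x"
  define S where "S n = ((\<lambda>S. filter (\<lambda>f. derivable f S x) ?U) ^^ n) []" for n
  have S_Suc: "S (Suc n) = filter (\<lambda>f. derivable f (S n) x) ?U" for n by (simp add: S_def)
  have mono: "set (S n) \<subseteq> set (S (Suc n))" for n
  proof (induction n)
    case (Suc n)
    have "derivable f (S n) x \<Longrightarrow> derivable f (S (Suc n)) x" for f
      using Suc unfolding derivable_def by blast
    then show ?case unfolding S_Suc[of n] S_Suc[of "Suc n"] by auto
  qed (simp add: S_def)
  have sub: "set (S n) \<subseteq> set ?U" for n by (cases n) (auto simp: S_def)
  have stable: "set (S (Suc n)) = set (S (Suc (Suc n)))" if "set (S n) = set (S (Suc n))" for n
    using that unfolding S_Suc[of n] S_Suc[of "Suc n"] derivable_def by auto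
  have "\<exists>N. (\<forall>n\<le>N. \<forall>m\<le>N. m < n \<longrightarrow> set (S m) \<subset> set (S n)) \<and> (\<forall>n\<ge>N. set (S N) = set (S n))"
  proof (rule finite_mono_remains_stable_implies_strict_prefix)
    show "finite (range (\<lambda>n. set (S n)))"
    proof (rule finite_subset)
      show "range (\<lambda>n. set (S n)) \<subseteq> Pow (set ?U)" using sub by blast
    qed simp
    show "mono (\<lambda>n. set (S n))" by (rule monoI) (rule lift_Suc_mono_le[of "\<lambda>n. set (S n)", OF mono])
    show "\<forall>n. set (S n) = set (S (Suc n)) \<longrightarrow> set (S (Suc n)) = set (S (Suc (Suc n)))"
      using stable by blast
  qed
  from finite_mono_strict_prefix_implies_finite_fixpoint[OF sub _ this]
  have fp: "set (S (card (set ?U))) = (\<Union>n. set (S n))" by simp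
  have le: "card (set ?U) \<le> length ?U" by (rule card_length)
  have "foldr (\<lambda>_ S. filter (\<lambda>f. derivable f S x) ?U) l [] = S (length l)" for l :: "tree list"
    by (induction l) (auto simp: S_def)
  then have "facts x = S (length ?U)" by (simp add: facts_def)
  moreover have "set (S (card (set ?U))) \<subseteq> set (S (length ?U))"
    using mono le by (rule lift_Suc_mono_le[of "\<lambda>n. set (S n)"])
  ultimately have facts: "set (facts x) = (\<Union>n. set (S n))" using fp by auto
  have "set (S n) \<subseteq> ?C" for n
  proof (induction n)
    case (Suc n)
    show ?case
    proof
      fix f assume "f \<in> set (S (Suc n))"
      then have "derivable f (S n) x" by (simp add: S_Suc)
      then consider "f \<in> set (data_facts x)" | g \<tau> h where "g \<in> set (S n)" "\<tau> \<in> set (tgd_trees x)"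
          "matches \<tau> (key g) (arg_l g) (arg_r g)" "h \<in> set (to_list (right \<tau>))" "f = consequence g \<tau> h"
        unfolding derivable_def by blast
      then show "f \<in> ?C"
      proof cases
        case 1
        then show ?thesis unfolding data_facts_ground by (auto intro: chase_data)
      next
        case (2 g \<tau> h)
        then obtain K a b where g: "g = Nd K (Nd a b)" "(K, a, b) \<in> chase null_child (set (tgd_trees x)) (ground individual x)"
          using Suc by blast
        have "matches \<tau> K a b" using 2(3) g by simp
        from chase_step[OF g(2) 2(2) this 2(4)] 2(5) g(1) show ?thesis
          unfolding consequence_def by auto
      qed
    qed
  qed (simp add: S_def)
  moreover have "?C \<subseteq> (\<Union>n. set (S n))"
  proof -
    have "Nd K (Nd a b) \<in> (\<Union>n. set (S n))"
    if "(K, a, b) \<in> chase null_child (set (tgd_trees x)) (ground individual x)" for K a b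
    using that
  proof (induction "(K, a, b)" arbitrary: K a b rule: chase.induct)
    case chase_data
    then have "Nd K (Nd a b) \<in> set (S (Suc 0))"
      using data_facts_ground chase_candidates[OF chase.chase_data] unfolding S_Suc derivable_def by auto
    then show ?case by blast
  next
    case (chase_step K a b \<tau> h)
    then obtain n where n: "Nd K (Nd a b) \<in> set (S n)" by blast
    let ?f = "consequence (Nd K (Nd a b)) \<tau> h"
    have "?f \<in> set ?U"
      using chase_candidates[OF chase.chase_step[OF chase_step(1,3,4,5)]] by (simp add: consequence_def)
    moreover have "derivable ?f (S n) x"
      using n chase_step(3,4,5) unfolding derivable_def by force
    ultimately have "?f \<in> set (S (Suc n))" by (simp add: S_Suc)
    then show ?case unfolding consequence_def left.simps right.simps by blast
  qed
    then show ?thesis by (auto simp del: UN_iff)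
  qed
  ultimately show ?thesis unfolding facts by (intro equalityI UN_least)
qed

text \<open>\<open>R\<close> comes from a guess and is read as a relation. A variable with several
  images produces additional atoms, which only makes the test stricter.\<close>

definition renamed :: "tree list \<Rightarrow> tree list \<Rightarrow> tree list" where
  "renamed R Q = concat (map (\<lambda>t. concat (map (\<lambda>e. concat (map (\<lambda>e'.
     if left e = arg_l t \<and> left e' = arg_r t then [Nd (key t) (Nd (right e) (right e'))] else []) R)) R)) Q)"

lemma set_renamed: "set (renamed R Q) = {Nd (key t) (Nd (right e) (right e')) | t e e'.
    t \<in> set Q \<and> e \<in> set R \<and> e' \<in> set R \<and> left e = arg_l t \<and> left e' = arg_r t}"
  unfolding renamed_def by (auto split: if_splits)

text \<open>The first row belongs to no variable. It keeps the table nonempty when all variables have been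
  eliminated.\<close>

definition start_table :: "tree \<Rightarrow> tree list" where
  "start_table x = Nd (Nd (Nd Lf (Nd Lf Lf)) Lf) Lf # concat (map (\<lambda>v. map (\<lambda>a. Nd v a) (args_of (facts x)))
     (args_of (query_atoms x)))"

text \<open>The elimination order is checked implicitly: an entry that names a variable already
  removed finds no row for it and empties the table.\<close>

definition accepts :: "tree list \<Rightarrow> tree list \<Rightarrow> tree \<Rightarrow> bool" where
  "accepts R L x \<longleftrightarrow>
     (\<forall>t\<in>set (query_atoms x). (\<exists>e\<in>set R. left e = arg_l t) \<and> (\<exists>e\<in>set R. left e = arg_r t)) \<and>
     (\<forall>t\<in>set (renamed R (query_atoms x)). \<exists>l\<in>set L. covered t (left l) (right l)) \<and>
     eliminate (renamed R (query_atoms x)) (facts x) (start_table x) L \<noteq> []"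

lemma accepts_sound:
  assumes "tree_model Rel ci (set (tgd_trees x)) ((\<lambda>t. (key t, arg_l t, arg_r t)) ` set (data_atoms x))"
    and acc: "accepts R L x"
  shows "\<exists>s. \<forall>t\<in>set (query_atoms x). Rel (key t) (s (arg_l t)) (s (arg_r t))"
proof -
  interpret tree_model Rel ci "set (tgd_trees x)" "(\<lambda>t. (key t, arg_l t, arg_r t)) ` set (data_atoms x)"
    by fact
  let ?Q = "renamed R (query_atoms x)"
  have F: "fact_sound K a b" if "Nd K (Nd a b) \<in> set (facts x)" for K a b
    using that chase_fact_sound unfolding set_facts ground_def by auto
  have el: "\<exists>d. realizes a d" if "a \<in> set (args_of (facts x))" for a
  proof -
    from that obtain f where f: "f \<in> set (facts x)" "a = arg_l f \<or> a = arg_r f"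
      unfolding set_args_of by blast
    from f(1) obtain K b c where "f = Nd K (Nd b c)" unfolding set_facts by blast
    with f F show ?thesis unfolding fact_sound_def by auto
  qed
  have "\<exists>d. realizes Lf d" by (simp add: realizes_def)
  then have "\<exists>d. realizes (right r) d" if "r \<in> set (start_table x)" for r
    using that el unfolding start_table_def by auto
  from eliminate_sound[where F = "facts x" and ?tb0.0 = "start_table x" and Q = ?Q and L = L and A = "{}", OF F this] acc
  obtain s where s: "\<And>e t. e \<in> set L \<Longrightarrow> t \<in> set ?Q \<Longrightarrow> covered t (left e) (right e) \<Longrightarrow>
      Rel (key t) (s (arg_l t)) (s (arg_r t))"
    unfolding accepts_def by auto
  then have s: "Rel (key t) (s (arg_l t)) (s (arg_r t))" if "t \<in> set ?Q" for t
    using acc that unfolding accepts_def by blast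
  \<comment> \<open>Any choice of images will do, as \<open>renamed\<close> contains the atoms for
    all choices.\<close>
  define \<rho> where "\<rho> v = (SOME e. e \<in> set R \<and> left e = v)" for v
  have \<rho>: "\<rho> v \<in> set R \<and> left (\<rho> v) = v" if "\<exists>e\<in>set R. left e = v" for v
    using that unfolding \<rho>_def by (metis (mono_tags, lifting) someI)
  have "Rel (key t) (s (right (\<rho> (arg_l t)))) (s (right (\<rho> (arg_r t))))" if t: "t \<in> set (query_atoms x)" for t
  proof -
    have "\<exists>e\<in>set R. left e = arg_l t" "\<exists>e\<in>set R. left e = arg_r t"
      using acc t unfolding accepts_def by blast+
    from this[THEN \<rho>] t have "Nd (key t) (Nd (right (\<rho> (arg_l t))) (right (\<rho> (arg_r t)))) \<in> set ?Q"
      unfolding set_renamed by blast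
    from s[OF this] show ?thesis by simp
  qed
  then show ?thesis by (intro exI[of _ "\<lambda>v. s (right (\<rho> v))"]) blast
qed

text \<open>The bounds on lengths and the shape of the entries place the certificate inside the
  search space, whose size depends on the query.\<close>

lemma accepts_complete:
  assumes two: "\<forall>\<tau>\<in>set (tgd_trees x). two_vars \<tau>"
    and h: "\<And>t. t \<in> set (query_atoms x) \<Longrightarrow>
      (key t, h (arg_l t), h (arg_r t)) \<in> chase Nul (set (tgd_trees x)) (ground Ind x)"
    and forest: "forest_like ((\<lambda>t. (arg_l t, arg_r t)) ` set (query_atoms x)) par rank"
    and V: "V = set (args_of (query_atoms x))"
    and dummy: "Nd (Nd Lf (Nd Lf Lf)) Lf \<notin> V"
  shows "\<exists>R L. accepts R L x \<and> length R \<le> card V \<and> length L \<le> card V \<and>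
    (\<forall>e\<in>set R \<union> set L. \<exists>u\<in>V. \<exists>v\<in>V. e = Nd u v)"
proof -
  let ?E = "(\<lambda>t. (arg_l t, arg_r t)) ` set (query_atoms x)"
  have fin: "finite V" by (simp add: V)
  have EV: "?E \<subseteq> V \<times> V" unfolding V set_args_of by auto
  have "linked (h u) (h v)" if "(u, v) \<in> ?E" for u v
    using that h chase_linked[OF _ two] unfolding ground_def by fastforce
  from plan_exists[where h = h, OF fin EV forest this] obtain \<rho> P where "plan_for h V ?E \<rho> P" by blast
  then have \<rho>: "\<And>v. v \<in> V \<Longrightarrow> \<rho> v \<in> V \<and> h (\<rho> v) = h v" and len: "length P \<le> card V"
    and valid: "valid_plan h (map_prod \<rho> \<rho> ` ?E) V P"
    and cov: "\<And>u v. (u, v) \<in> ?E \<Longrightarrow> \<exists>x p. (x, p) \<in> set P \<and> \<rho> u \<in> {x, p} \<and> \<rho> v \<in> {x, p}"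
    unfolding plan_for_def by blast+
  obtain vs where vs: "set vs = V" "distinct vs" using fin finite_distinct_list by blast
  define R where "R = map (\<lambda>v. Nd v (\<rho> v)) vs"
  define L where "L = rev (map (\<lambda>(x, p). Nd x p) P)"
  let ?Q = "renamed R (query_atoms x)"
  have argV: "arg_l t \<in> V" "arg_r t \<in> V" if "t \<in> set (query_atoms x)" for t
    using that unfolding V set_args_of by auto
  have Q: "set ?Q = (\<lambda>t. Nd (key t) (Nd (\<rho> (arg_l t)) (\<rho> (arg_r t)))) ` set (query_atoms x)"
    unfolding set_renamed R_def set_map vs(1) using argV by (auto simp: image_iff) force+
  have F: "Nd (key t) (Nd (proj (h (arg_l t))) (proj (h (arg_r t)))) \<in> set (facts x)"
    if "t \<in> set (query_atoms x)" for t
    using chase_proj h[OF that] unfolding set_facts ground_def by blast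
  let ?m0 = "Nd (Nd (Nd Lf (Nd Lf Lf)) Lf) Lf"
  have "?m0 \<in> set (eliminate ?Q (facts x) (start_table x) L)"
    unfolding L_def
  proof (rule eliminate_complete[OF _ refl _ _ _ , where h = h and V = V])
    show "Nd (key t) (Nd (proj (h (arg_l t))) (proj (h (arg_r t)))) \<in> set (facts x)" if "t \<in> set ?Q" for t
      using that F \<rho> argV unfolding Q by auto
    show "?m0 \<in> set (start_table x)" by (simp add: start_table_def)
    show "left ?m0 \<notin> V" using dummy by simp
    show "Nd v (proj (h v)) \<in> set (start_table x)" if v: "v \<in> V" for v
    proof -
      obtain t where t: "t \<in> set (query_atoms x)" "v = arg_l t \<or> v = arg_r t"
        using v unfolding V set_args_of by blast
      then have "proj (h v) \<in> set (args_of (facts x))" using F[OF t(1)] unfolding set_args_of by force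
      then show ?thesis using v unfolding start_table_def V by auto
    qed
    have "(\<lambda>t. (arg_l t, arg_r t)) ` set ?Q = map_prod \<rho> \<rho> ` ?E"
      unfolding Q image_image by simp
    with valid show "valid_plan h ((\<lambda>t. (arg_l t, arg_r t)) ` set ?Q) V P" by simp
  qed
  then have "eliminate ?Q (facts x) (start_table x) L \<noteq> []" by auto
  moreover have "\<exists>l\<in>set L. covered t (left l) (right l)" if t: "t \<in> set ?Q" for t
  proof -
    from t obtain t0 where t0: "t0 \<in> set (query_atoms x)" "t = Nd (key t0) (Nd (\<rho> (arg_l t0)) (\<rho> (arg_r t0)))"
      unfolding Q by blast
    then have "(arg_l t0, arg_r t0) \<in> ?E" by blast
    from cov[OF this] obtain y p where "(y, p) \<in> set P" "\<rho> (arg_l t0) \<in> {y, p}" "\<rho> (arg_r t0) \<in> {y, p}" by blast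
    then show ?thesis unfolding L_def covered_def t0(2) by force
  qed
  moreover have "(\<exists>e\<in>set R. left e = arg_l t) \<and> (\<exists>e\<in>set R. left e = arg_r t)" if "t \<in> set (query_atoms x)" for t
    using argV[OF that] unfolding R_def set_map vs(1) by auto
  ultimately have "accepts R L x" unfolding accepts_def by blast
  moreover have "length R \<le> card V" using vs distinct_card[of vs] by (simp add: R_def)
  moreover have "length L \<le> card V" using len by (simp add: L_def)
  moreover have "\<exists>u\<in>V. \<exists>v\<in>V. e = Nd u v" if "e \<in> set R" for e
    using that \<rho> vs(1) unfolding R_def by auto
  moreover have "\<exists>u\<in>V. \<exists>v\<in>V. e = Nd u v" if "e \<in> set L" for e
  proof -
    have "fst l \<in> V \<and> snd l \<in> V" if "valid_plan h E W P" "W \<subseteq> V" "l \<in> set P" for E W l P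
      using that
    proof (induction P arbitrary: W)
      case (Cons a P)
      obtain y p where a: "a = (y, p)" by (cases a)
      have "valid_plan h E (W - {y}) P" "y \<in> W" "p \<in> W" using Cons.prems(1) unfolding a by simp_all
      with Cons.IH[of "W - {y}"] Cons.prems(2,3) show ?case unfolding a by auto
    qed simp
    from this[OF valid] that show ?thesis unfolding L_def by force
  qed
  ultimately show ?thesis by blast
qed

section \<open>Encoded instances\<close>

lemma enc_nat_eq_iff [simp]: "enc_nat m = enc_nat n \<longleftrightarrow> m = n"
proof
  show "enc_nat m = enc_nat n \<Longrightarrow> m = n"
  proof (induction m arbitrary: n rule: less_induct)
    case (less m)
    show ?case
    proof (cases "m = 0 \<or> n = 0")
      case True
      then show ?thesis
        using less.prems by (subst (asm) enc_nat.simps, subst (asm) (2) enc_nat.simps) (auto split: if_splits)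
    next
      case False
      then have "Nd (enc_bool (odd m)) (enc_nat (m div 2)) = Nd (enc_bool (odd n)) (enc_nat (n div 2))"
        using less.prems enc_nat.simps[of m] enc_nat.simps[of n] by simp
      then have "odd m = odd n" "enc_nat (m div 2) = enc_nat (n div 2)"
        by (auto simp: enc_bool_def split: if_splits)
      moreover have "m div 2 < m" using False by simp
      ultimately have "odd m = odd n" "m div 2 = n div 2" using less.IH by blast+
      then show ?thesis by (metis bit_eq_rec)
    qed
  qed
qed simp

lemma inj_enc_nat: "inj enc_nat"
  by (rule injI) simp

text \<open>A nonzero code starts with a bit, \<open>Lf\<close> or \<open>Nd Lf Lf\<close>. The
  label of the extra row in \<open>start_table\<close> is therefore not a variable.\<close>

lemma enc_nat_neq: "enc_nat n \<noteq> Nd (Nd Lf (Nd Lf Lf)) t"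
  by (subst enc_nat.simps) (auto simp: enc_bool_def)

lemma enc_unary_eq_iff [simp]: "enc_unary m = enc_unary n \<longleftrightarrow> m = n"
proof (induction m arbitrary: n)
  case 0
  then show ?case by (cases n) auto
next
  case (Suc m)
  then show ?case by (cases n) auto
qed

lemma to_list_enc_list [simp]: "to_list (enc_list f l) = map f l"
  by (induction l) auto

primrec atom_key :: "nat atom \<Rightarrow> tree" where
  "atom_key (Unary A x) = Nd Lf (enc_nat A)"
| "atom_key (Binary P x y) = Nd (Nd Lf Lf) (enc_nat P)"

lemma norm_enc_atom:
  "norm_atom (enc_atom \<alpha>) = Nd (atom_key \<alpha>) (Nd (enc_nat (arg1 \<alpha>)) (enc_nat (arg2 \<alpha>)))"
  by (cases \<alpha>) (auto simp: norm_atom_def enc_bool_def)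

lemma of_list_map_Lf: "of_list (map (\<lambda>_. Lf) l) = enc_unary (length l)"
  by (induction l) auto

lemma length_numbered: "length (numbered l) = length l"
  by (induction l) (auto simp: numbered_def)

lemma set_numbered: "set (numbered l) = (\<lambda>i. Nd (enc_unary (length l - i)) (l ! i)) ` {..<length l}"
proof (induction l)
  case (Cons a l)
  have "numbered (a # l) = Nd (enc_unary (Suc (length l))) a # numbered l"
    using length_numbered[of l] by (simp add: numbered_def of_list_map_Lf)
  then show ?case
    using Cons by (simp add: lessThan_Suc_eq_insert_0 image_image)
qed (simp add: numbered_def)

lemma set_answer_atoms:
  "set (answer_atoms l) = (\<lambda>i. Nd (answer_key (enc_unary (length l - i))) (Nd (l ! i) (l ! i))) ` {..<length l}"
  by (simp add: answer_atoms_def set_numbered image_image)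

lemma set_query_atoms_enc:
  "set (query_atoms (enc_omq (q, T, D, as))) =
     (\<lambda>\<alpha>. Nd (atom_key \<alpha>) (Nd (enc_nat (arg1 \<alpha>)) (enc_nat (arg2 \<alpha>)))) ` set (atoms q) \<union>
     (\<lambda>i. Nd (answer_key (enc_unary (length (ans_vars q) - i)))
        (Nd (enc_nat (ans_vars q ! i)) (enc_nat (ans_vars q ! i)))) ` {..<length (ans_vars q)}"
  by (auto simp: query_atoms_def enc_omq_def enc_cq_def set_answer_atoms norm_enc_atom image_iff)

lemma set_data_atoms_enc:
  "set (data_atoms (enc_omq (q, T, D, as))) =
     (\<lambda>\<alpha>. Nd (atom_key \<alpha>) (Nd (enc_nat (arg1 \<alpha>)) (enc_nat (arg2 \<alpha>)))) ` set D \<union>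
     (\<lambda>i. Nd (answer_key (enc_unary (length as - i))) (Nd (enc_nat (as ! i)) (enc_nat (as ! i)))) ` {..<length as}"
  by (auto simp: data_atoms_def enc_omq_def set_answer_atoms norm_enc_atom image_iff)

definition tgd_tree :: "tgd \<Rightarrow> tree" where
  "tgd_tree \<tau> = norm_tgd (enc_tgd \<tau>)"

lemma set_tgd_trees_enc: "set (tgd_trees (enc_omq (q, T, D, as))) = tgd_tree ` set T"
  by (simp add: tgd_trees_def enc_omq_def tgd_tree_def image_image)

lemma left_tgd_tree:
  "left (tgd_tree \<tau>) = Nd (atom_key (body \<tau>)) (Nd (enc_nat (arg1 (body \<tau>))) (enc_nat (arg2 (body \<tau>))))"
  by (simp add: tgd_tree_def norm_tgd_def enc_tgd_def norm_enc_atom)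

lemma set_head_tgd_tree:
  "set (to_list (right (tgd_tree \<tau>))) =
     (\<lambda>\<alpha>. Nd (atom_key \<alpha>) (Nd (enc_nat (arg1 \<alpha>)) (enc_nat (arg2 \<alpha>)))) ` set (head \<tau>)"
  by (simp add: tgd_tree_def norm_tgd_def enc_tgd_def image_image norm_enc_atom)

text \<open>Otherwise the tgd would have three distinct variables: two outside the body, or one
  outside and two in it.\<close>

lemma tgd_vars_two:
  assumes "card (tgd_vars \<tau>) \<le> 2"
  shows "\<exists>y. \<forall>w\<in>tgd_vars \<tau>. w = arg1 (body \<tau>) \<or> w = arg2 (body \<tau>) \<or> (arg1 (body \<tau>) = arg2 (body \<tau>) \<and> w = y)"
proof (rule ccontr)
  assume neg: "\<not> ?thesis"
  let ?a = "arg1 (body \<tau>)" and ?b = "arg2 (body \<tau>)"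
  have "finite (terms_of \<alpha>)" for \<alpha> :: "nat atom" by (simp add: terms_of_args)
  then have fin: "finite (tgd_vars \<tau>)" by (simp add: tgd_vars_def)
  have ab: "?a \<in> tgd_vars \<tau>" "?b \<in> tgd_vars \<tau>" by (simp_all add: tgd_vars_def terms_of_args)
  obtain w where w: "w \<in> tgd_vars \<tau>" "w \<noteq> ?a" "w \<noteq> ?b" using neg by blast
  obtain w' where w': "w' \<in> tgd_vars \<tau>" "w' \<noteq> ?a" "w' \<noteq> ?b" "?a \<noteq> ?b \<or> w' \<noteq> w" using neg by blast
  obtain u where u: "u \<in> tgd_vars \<tau>" "u \<noteq> ?a" "u \<noteq> w"
    using ab w w' by metis
  have "card {?a, w, u} \<le> card (tgd_vars \<tau>)" using fin ab w u by (intro card_mono) auto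
  moreover have "card {?a, w, u} = 3" using w u by auto
  ultimately show False using assms by simp
qed

lemma two_vars_tgd_tree:
  assumes "card (tgd_vars \<tau>) \<le> 2"
  shows "two_vars (tgd_tree \<tau>)"
proof -
  from tgd_vars_two[OF assms] obtain y where y: "\<And>w. w \<in> tgd_vars \<tau> \<Longrightarrow>
      w = arg1 (body \<tau>) \<or> w = arg2 (body \<tau>) \<or> (arg1 (body \<tau>) = arg2 (body \<tau>) \<and> w = y)" by blast
  have "arg1 \<alpha> \<in> tgd_vars \<tau>" "arg2 \<alpha> \<in> tgd_vars \<tau>" if "\<alpha> \<in> set (head \<tau>)" for \<alpha>
    using that by (auto simp: tgd_vars_def terms_of_args)
  with y show ?thesis
    unfolding two_vars_def left_tgd_tree set_head_tgd_tree
    by (intro exI[of _ "enc_nat y"]) auto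
qed

text \<open>The model seen through keys, with unary predicates on the diagonal. Each answer
  predicate holds of the element named by one constant of the tuple only, so a satisfied answer atom
  forces the value of its answer variable.\<close>

definition interp_rel :: "'d interp \<Rightarrow> const list \<Rightarrow> tree \<Rightarrow> 'd \<Rightarrow> 'd \<Rightarrow> bool" where
  "interp_rel I as K d e \<longleftrightarrow> (\<exists>A. K = Nd Lf (enc_nat A) \<and> d = e \<and> d \<in> uint I A) \<or>
     (\<exists>P. K = Nd (Nd Lf Lf) (enc_nat P) \<and> (d, e) \<in> bint I P) \<or>
     (\<exists>i<length as. K = answer_key (enc_unary (length as - i)) \<and> d = e \<and> d = cint I (as ! i))"

lemma interp_rel_atom: "interp_rel I as (atom_key \<alpha>) (s (arg1 \<alpha>)) (s (arg2 \<alpha>)) \<longleftrightarrow> holds I s \<alpha>"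
  by (cases \<alpha>) (auto simp: interp_rel_def answer_key_def)

lemma interp_rel_answer:
  "i < length as \<Longrightarrow> interp_rel I as (answer_key (enc_unary (length as - i))) d e \<longleftrightarrow> d = e \<and> d = cint I (as ! i)"
proof -
  assume i: "i < length as"
  then have "length as - i = length as - j \<longleftrightarrow> i = j" if "j < length as" for j using that by auto
  with i show ?thesis by (auto simp: interp_rel_def answer_key_def)
qed

lemma interp_rel_univ: "is_interp I \<Longrightarrow> interp_rel I as K d e \<Longrightarrow> d \<in> univ I \<and> e \<in> univ I"
  unfolding interp_rel_def is_interp_def by blast

lemma tree_model_interp:
  assumes mod: "is_model I T D" and T: "is_ontology T"
  shows "tree_model (interp_rel I as) (\<lambda>a. cint I (inv enc_nat a)) (set (tgd_trees (enc_omq (q, T, D, as))))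
    ((\<lambda>t. (key t, arg_l t, arg_r t)) ` set (data_atoms (enc_omq (q, T, D, as))))"
proof
  have int: "is_interp I" using mod by (simp add: is_model_def)
  show "two_vars \<tau>" if "\<tau> \<in> set (tgd_trees (enc_omq (q, T, D, as)))" for \<tau>
    using that T two_vars_tgd_tree unfolding set_tgd_trees_enc is_ontology_def by auto
  show "interp_rel I as K (cint I (inv enc_nat a)) (cint I (inv enc_nat b))"
    if kab: "(K, a, b) \<in> (\<lambda>t. (key t, arg_l t, arg_r t)) ` set (data_atoms (enc_omq (q, T, D, as)))" for K a b
  proof -
    from kab consider \<alpha> where "\<alpha> \<in> set D" "K = atom_key \<alpha>" "a = enc_nat (arg1 \<alpha>)" "b = enc_nat (arg2 \<alpha>)"
      | i where "i < length as" "K = answer_key (enc_unary (length as - i))" "a = enc_nat (as ! i)" "b = enc_nat (as ! i)"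
      unfolding set_data_atoms_enc by auto
    then show ?thesis
    proof cases
      case 1
      then have "holds I (cint I) \<alpha>" using mod by (simp add: is_model_def)
      then show ?thesis using 1 by (simp add: interp_rel_atom inv_f_f[OF inj_enc_nat])
    next
      case 2
      then show ?thesis by (simp add: interp_rel_answer inv_f_f[OF inj_enc_nat])
    qed
  qed
  fix \<tau>' K d e
  assume "\<tau>' \<in> set (tgd_trees (enc_omq (q, T, D, as)))" and r: "interp_rel I as K d e" and m: "matches \<tau>' K d e"
  then obtain \<tau> where \<tau>: "\<tau> \<in> set T" "\<tau>' = tgd_tree \<tau>" unfolding set_tgd_trees_enc by blast
  let ?a = "arg1 (body \<tau>)" and ?b = "arg2 (body \<tau>)"
  from T \<tau>(1) have "card (tgd_vars \<tau>) \<le> 2" by (simp add: is_ontology_def)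
  from tgd_vars_two[OF this] obtain y where y: "\<And>w. w \<in> tgd_vars \<tau> \<Longrightarrow> w = ?a \<or> w = ?b \<or> (?a = ?b \<and> w = y)"
    by blast
  define s where "s w = (if w = ?a then d else if w = ?b then e else cint I 0)" for w
  have K: "K = atom_key (body \<tau>)" and ab: "?a = ?b \<Longrightarrow> d = e"
    using m unfolding matches_def \<tau>(2) left_tgd_tree by simp_all
  have sab: "s ?a = d" "s ?b = e" using ab by (auto simp: s_def)
  have "holds I s (body \<tau>)" using r interp_rel_atom[of I as "body \<tau>" s] unfolding K sab by blast
  moreover have "\<forall>w. s w \<in> univ I"
    using interp_rel_univ[OF int r] int by (simp add: s_def is_interp_def)
  moreover have "sat_tgd I \<tau>" using mod \<tau>(1) by (simp add: is_model_def)
  ultimately obtain s' where s': "\<forall>w\<in>terms_of (body \<tau>). s' w = s w" "\<forall>\<psi>\<in>set (head \<tau>). holds I s' \<psi>"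
    unfolding sat_tgd_def by blast
  have sub: "subst \<tau>' (s' y) d e (enc_nat w) = s' w" if "w \<in> tgd_vars \<tau>" for w
    using y[OF that] s'(1) sab unfolding subst_def \<tau>(2) left_tgd_tree by (auto simp: terms_of_args)
  have "interp_rel I as (key h) (subst \<tau>' (s' y) d e (arg_l h)) (subst \<tau>' (s' y) d e (arg_r h))"
    if h: "h \<in> set (to_list (right \<tau>'))" for h
  proof -
    from h obtain \<alpha> where \<alpha>: "\<alpha> \<in> set (head \<tau>)" "h = Nd (atom_key \<alpha>) (Nd (enc_nat (arg1 \<alpha>)) (enc_nat (arg2 \<alpha>)))"
      unfolding \<tau>(2) set_head_tgd_tree by blast
    then have "arg1 \<alpha> \<in> tgd_vars \<tau>" "arg2 \<alpha> \<in> tgd_vars \<tau>" by (auto simp: tgd_vars_def terms_of_args)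
    with \<alpha> s'(2) show ?thesis by (simp add: sub interp_rel_atom)
  qed
  then show "\<exists>c. \<forall>h\<in>set (to_list (right \<tau>')).
      interp_rel I as (key h) (subst \<tau>' c d e (arg_l h)) (subst \<tau>' c d e (arg_r h))" by blast
qed

lemma cq_vars_args: "cq_vars q = (\<Union>\<alpha>\<in>set (atoms q). {arg1 \<alpha>, arg2 \<alpha>})"
  by (simp add: cq_vars_def terms_of_args)

lemma entails_if_accepts:
  assumes T: "is_ontology T" and len: "length as = length (ans_vars q)"
    and vars: "set (ans_vars q) \<subseteq> cq_vars q"
    and acc: "accepts R L (enc_omq (q, T, D, as))"
  shows "entails T D q as"
  unfolding entails_def
proof (intro allI impI)
  fix I :: "nat interp" assume mod: "is_model I T D"
  then have int: "is_interp I" by (simp add: is_model_def)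
  from accepts_sound[OF tree_model_interp[OF mod T] acc] obtain s where
    s: "\<And>t. t \<in> set (query_atoms (enc_omq (q, T, D, as))) \<Longrightarrow> interp_rel I as (key t) (s (arg_l t)) (s (arg_r t))"
    by blast
  \<comment> \<open>Outside the query variables nothing keeps \<open>s\<close> within the domain,
    hence the default value.\<close>
  define s' where "s' v = (if v \<in> cq_vars q then s (enc_nat v) else cint I 0)" for v
  have at: "interp_rel I as (atom_key \<alpha>) (s (enc_nat (arg1 \<alpha>))) (s (enc_nat (arg2 \<alpha>)))" if "\<alpha> \<in> set (atoms q)" for \<alpha>
    using s[of "Nd (atom_key \<alpha>) (Nd (enc_nat (arg1 \<alpha>)) (enc_nat (arg2 \<alpha>)))"] that
    unfolding set_query_atoms_enc by auto
  have "s' v \<in> univ I" for v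
  proof (cases "v \<in> cq_vars q")
    case True
    then obtain \<alpha> where \<alpha>: "\<alpha> \<in> set (atoms q)" "v = arg1 \<alpha> \<or> v = arg2 \<alpha>" unfolding cq_vars_args by blast
    with interp_rel_univ[OF int at[OF \<alpha>(1)]] True show ?thesis by (auto simp: s'_def)
  qed (use int in \<open>simp add: s'_def is_interp_def\<close>)
  moreover have "holds I s' \<alpha>" if \<alpha>: "\<alpha> \<in> set (atoms q)" for \<alpha>
  proof -
    have "s' (arg1 \<alpha>) = s (enc_nat (arg1 \<alpha>))" "s' (arg2 \<alpha>) = s (enc_nat (arg2 \<alpha>))"
      using \<alpha> by (auto simp: s'_def cq_vars_args)
    with at[OF \<alpha>] show ?thesis by (metis interp_rel_atom)
  qed
  moreover have "map s' (ans_vars q) = map (cint I) as"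
  proof (rule nth_equalityI)
    fix i assume "i < length (map s' (ans_vars q))"
    then have i: "i < length (ans_vars q)" by simp
    let ?v = "enc_nat (ans_vars q ! i)"
    have "Nd (answer_key (enc_unary (length as - i))) (Nd ?v ?v) \<in> set (query_atoms (enc_omq (q, T, D, as)))"
      unfolding set_query_atoms_enc using i len by auto
    from s[OF this] have "s ?v = cint I (as ! i)"
      using interp_rel_answer[of i as I "s ?v" "s ?v"] i len by simp
    moreover have "ans_vars q ! i \<in> cq_vars q" using i vars by auto
    ultimately show "map s' (ans_vars q) ! i = map (cint I) as ! i" using i len by (simp add: s'_def)
  qed (simp add: len)
  ultimately show "sat_cq I q as" unfolding sat_cq_def by blast
qed

text \<open>The real chase, made into an interpretation \<open>J\<close>, is itself a model, so
  entailment yields a homomorphism of the query into it. The plan for this homomorphism is the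
  certificate.\<close>

lemma accepts_if_entails:
  assumes T: "is_ontology T" and len: "length as = length (ans_vars q)"
    and vars: "set (ans_vars q) \<subseteq> cq_vars q" and tree: "tree_shaped q" and ent: "entails T D q as"
  shows "\<exists>R L. accepts R L (enc_omq (q, T, D, as)) \<and> length R \<le> card (cq_vars q) \<and> length L \<le> card (cq_vars q) \<and>
    (\<forall>e\<in>set R \<union> set L. \<exists>u\<in>enc_nat ` cq_vars q. \<exists>v\<in>enc_nat ` cq_vars q. e = Nd u v)"
proof -
  let ?x = "enc_omq (q, T, D, as)"
  define Ch where "Ch = chase Nul (set (tgd_trees ?x)) (ground Ind ?x)"
  define J where "J = \<lparr>univ = UNIV, cint = (\<lambda>c. Ind (enc_nat c)), uint = (\<lambda>A. {d. (Nd Lf (enc_nat A), d, d) \<in> Ch}),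
      bint = (\<lambda>P. {(d, e). (Nd (Nd Lf Lf) (enc_nat P), d, e) \<in> Ch})\<rparr>"
  have holds: "holds J s \<alpha> \<longleftrightarrow> (atom_key \<alpha>, s (arg1 \<alpha>), s (arg2 \<alpha>)) \<in> Ch" for s and \<alpha> :: "nat atom"
    by (cases \<alpha>) (auto simp: J_def)
  have J: "univ J = UNIV" "cint J = (\<lambda>c. Ind (enc_nat c))" by (simp_all add: J_def)
  have data: "(key t, Ind (arg_l t), Ind (arg_r t)) \<in> Ch" if "t \<in> set (data_atoms ?x)" for t
    unfolding Ch_def by (rule chase_data) (use that in \<open>force simp: ground_def\<close>)
  have "sat_tgd J \<tau>" if \<tau>: "\<tau> \<in> set T" for \<tau>
    unfolding sat_tgd_def
  proof (intro allI impI, elim conjE)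
    fix s assume "holds J s (body \<tau>)"
    let ?a = "s (arg1 (body \<tau>))" and ?b = "s (arg2 (body \<tau>))"
    define s' where "s' v = subst (tgd_tree \<tau>) (Nul (tgd_tree \<tau>) ?a) ?a ?b (enc_nat v)" for v
    have body: "(atom_key (body \<tau>), ?a, ?b) \<in> Ch" using \<open>holds J s (body \<tau>)\<close> by (simp add: holds)
    have "matches (tgd_tree \<tau>) (atom_key (body \<tau>)) ?a ?b"
      unfolding matches_def left_tgd_tree by simp
    then have head: "(key h, subst (tgd_tree \<tau>) (Nul (tgd_tree \<tau>) ?a) ?a ?b (arg_l h),
        subst (tgd_tree \<tau>) (Nul (tgd_tree \<tau>) ?a) ?a ?b (arg_r h)) \<in> Ch"
      if "h \<in> set (to_list (right (tgd_tree \<tau>)))" for h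
      unfolding Ch_def by (intro chase_step) (use body \<tau> that in \<open>auto simp: Ch_def set_tgd_trees_enc\<close>)
    have "holds J s' \<psi>" if \<psi>: "\<psi> \<in> set (head \<tau>)" for \<psi>
    proof -
      have "Nd (atom_key \<psi>) (Nd (enc_nat (arg1 \<psi>)) (enc_nat (arg2 \<psi>))) \<in> set (to_list (right (tgd_tree \<tau>)))"
        unfolding set_head_tgd_tree using \<psi> by blast
      from head[OF this] show ?thesis by (simp add: holds s'_def)
    qed
    moreover have "\<forall>v\<in>terms_of (body \<tau>). s' v = s v"
      by (auto simp: s'_def subst_def left_tgd_tree terms_of_args)
    ultimately show "\<exists>s'. (\<forall>v. s' v \<in> univ J) \<and> (\<forall>v\<in>terms_of (body \<tau>). s' v = s v) \<and>
        (\<forall>\<psi>\<in>set (head \<tau>). holds J s' \<psi>)"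
      unfolding J by blast
  qed
  moreover have "holds J (cint J) \<alpha>" if "\<alpha> \<in> set D" for \<alpha>
    using data[of "Nd (atom_key \<alpha>) (Nd (enc_nat (arg1 \<alpha>)) (enc_nat (arg2 \<alpha>)))"] that
    unfolding set_data_atoms_enc holds J by auto
  moreover have "is_interp J" by (auto simp: is_interp_def J_def)
  ultimately have "is_model J T D" by (simp add: is_model_def)
  \<comment> \<open>The domain of \<open>J\<close> consists of \<open>elem\<close> terms, whereas
    \<open>entails\<close> ranges over models on numbers.\<close>
  from entails_sat_cq[OF ent this] obtain s where s: "map s (ans_vars q) = map (\<lambda>c. Ind (enc_nat c)) as"
      "\<And>\<alpha>. \<alpha> \<in> set (atoms q) \<Longrightarrow> (atom_key \<alpha>, s (arg1 \<alpha>), s (arg2 \<alpha>)) \<in> Ch"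
    unfolding sat_cq_def holds J by blast
  define h where "h t = s (inv enc_nat t)" for t
  have h_enc: "h (enc_nat v) = s v" for v by (simp add: h_def inv_f_f[OF inj_enc_nat])
  have "(key t, h (arg_l t), h (arg_r t)) \<in> Ch" if "t \<in> set (query_atoms ?x)" for t
  proof -
    from that consider \<alpha> where "\<alpha> \<in> set (atoms q)" "t = Nd (atom_key \<alpha>) (Nd (enc_nat (arg1 \<alpha>)) (enc_nat (arg2 \<alpha>)))"
      | i where "i < length (ans_vars q)" "t = Nd (answer_key (enc_unary (length (ans_vars q) - i)))
        (Nd (enc_nat (ans_vars q ! i)) (enc_nat (ans_vars q ! i)))"
      unfolding set_query_atoms_enc by blast
    then show ?thesis
    proof cases
      case 1
      then show ?thesis using s(2) by (simp add: h_enc)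
    next
      case (2 i)
      have "s (ans_vars q ! i) = Ind (enc_nat (as ! i))"
        using s(1) 2(1) len by (metis nth_map)
      moreover have "Nd (answer_key (enc_unary (length as - i))) (Nd (enc_nat (as ! i)) (enc_nat (as ! i)))
          \<in> set (data_atoms ?x)"
        unfolding set_data_atoms_enc using 2(1) len by auto
      from data[OF this] have "(answer_key (enc_unary (length as - i)), Ind (enc_nat (as ! i)), Ind (enc_nat (as ! i))) \<in> Ch"
        by simp
      ultimately show ?thesis using 2 len by (simp add: h_enc)
    qed
  qed
  note h = this[unfolded Ch_def]
  have two: "\<forall>\<tau>\<in>set (tgd_trees ?x). two_vars \<tau>"
    using T two_vars_tgd_tree unfolding set_tgd_trees_enc is_ontology_def by auto
  have fin: "finite (cq_vars q)" by (simp add: cq_vars_args)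
  have "\<exists>par rank. forest_like (gaifman q) par rank"
  proof (rule acyclic_forest_like[OF fin])
    show "gaifman q \<subseteq> cq_vars q \<times> cq_vars q" by (auto simp: gaifman_def cq_vars_def)
    show "sym (gaifman q)" by (auto simp: gaifman_def sym_def)
    show "irrefl (gaifman q)" by (auto simp: gaifman_def irrefl_def)
    show "\<nexists>c. is_cycle (gaifman q) c" using tree by (simp add: tree_shaped_def is_tree_def)
  qed
  then obtain par rank where "forest_like (gaifman q) par rank" by blast
  from forest_like_inj_image[OF this inj_enc_nat]
  have f: "forest_like (map_prod enc_nat enc_nat ` gaifman q) (enc_nat \<circ> par \<circ> inv enc_nat) (rank \<circ> inv enc_nat)" .
  \<comment> \<open>Unary atoms and answer atoms contribute loops only, so every other edge is a
    Gaifman edge.\<close>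
  have sub: "(u, v) \<in> map_prod enc_nat enc_nat ` gaifman q"
    if uv: "(u, v) \<in> (\<lambda>t. (arg_l t, arg_r t)) ` set (query_atoms ?x)" "u \<noteq> v" for u v
  proof -
    from uv obtain \<alpha> where \<alpha>: "\<alpha> \<in> set (atoms q)" "u = enc_nat (arg1 \<alpha>)" "v = enc_nat (arg2 \<alpha>)"
      unfolding set_query_atoms_enc by auto
    then have "(arg1 \<alpha>, arg2 \<alpha>) \<in> gaifman q" using uv(2) by (auto simp: gaifman_def terms_of_args)
    then show ?thesis unfolding \<alpha>(2,3) by (rule map_prod_imageI)
  qed
  have forest: "forest_like ((\<lambda>t. (arg_l t, arg_r t)) ` set (query_atoms ?x))
      (enc_nat \<circ> par \<circ> inv enc_nat) (rank \<circ> inv enc_nat)"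
    unfolding forest_like_def
  proof (intro allI impI)
    fix u v assume uv: "(u, v) \<in> (\<lambda>t. (arg_l t, arg_r t)) ` set (query_atoms ?x)" "u \<noteq> v"
    from f[unfolded forest_like_def, rule_format, OF sub[OF uv] uv(2)]
    show "v = (enc_nat \<circ> par \<circ> inv enc_nat) u \<and> (rank \<circ> inv enc_nat) v < (rank \<circ> inv enc_nat) u \<or>
        u = (enc_nat \<circ> par \<circ> inv enc_nat) v \<and> (rank \<circ> inv enc_nat) u < (rank \<circ> inv enc_nat) v" .
  qed
  have V: "enc_nat ` cq_vars q = set (args_of (query_atoms ?x))"
    using vars unfolding set_args_of set_query_atoms_enc cq_vars_args by (fastforce simp: image_iff)
  have card: "card (enc_nat ` cq_vars q) = card (cq_vars q)"
    by (rule card_image) (simp add: inj_on_def)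
  have "Nd (Nd Lf (Nd Lf Lf)) Lf \<notin> enc_nat ` cq_vars q"
    using enc_nat_neq[of _ Lf] by (auto dest: sym)
  from accepts_complete[OF two h forest V this] show ?thesis unfolding card by blast
qed

section \<open>Running time\<close>

lemma ptime_list_comp: "ptime_list F \<Longrightarrow> ptime g \<Longrightarrow> ptime_list (\<lambda>x. F (g x))"
  unfolding ptime_list_def by (rule ptime_comp)

lemma ptime_norm_atom: "ptime f \<Longrightarrow> ptime (\<lambda>x. norm_atom (f x))"
  unfolding norm_atom_def by (intro ptime_intros)

lemma ptime_norm_tgd: "ptime f \<Longrightarrow> ptime (\<lambda>x. norm_tgd (f x))"
  unfolding norm_tgd_def by (intro ptime_intros ptime_norm_atom)

lemma tree_size_enc_unary: "tree_size (enc_unary n) = 2 * n + 1"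
  by (induction n) auto

lemma ptime_numbered:
  assumes "ptime_list l"
  shows "ptime_list (\<lambda>x. numbered (l x))"
  unfolding numbered_def
proof (rule ptime_foldr[OF assms])
  show "ptime_list (\<lambda>x. [])" by (rule ptime_list_Nil)
  show "ptime_list (\<lambda>y. Nd (of_list (map (\<lambda>_. Lf) (left y # to_list (left (right y))))) (left y) #
      to_list (left (right y)))"
    by (intro ptime_intros)
  let ?s = "\<lambda>x. tree_size (of_list (l x))"
  have s: "poly_bounded input_size ?s"
    using assms unfolding ptime_list_def ptime_def tractable_def by blast
  show "poly_bounded input_size (\<lambda>x. ?s x * (3 * ?s x + 3) + 1)"
    by (intro poly_bounded_add poly_bounded_mult poly_bounded_const s) simp_all
  fix x ys zs assume l: "l x = ys @ zs"
  have len: "length zs \<le> ?s x" using length_le_tree_size[of "l x"] by (simp add: l)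
  have "tree_size e \<le> 3 * ?s x + 2" if "e \<in> set (numbered zs)" for e
  proof -
    from that obtain i where i: "i < length zs" "e = Nd (enc_unary (length zs - i)) (zs ! i)"
      unfolding set_numbered by auto
    have "tree_size (zs ! i) \<le> ?s x" using i(1) by (intro tree_size_member) (simp add: l)
    with i len show ?thesis by (simp add: tree_size_enc_unary)
  qed
  from tree_size_of_list_le[OF this, of "numbered zs"]
  have "tree_size (of_list (numbered zs)) \<le> length zs * (3 * ?s x + 3) + 1"
    by (simp add: length_numbered algebra_simps)
  also have "\<dots> \<le> ?s x * (3 * ?s x + 3) + 1" using len by (intro add_right_mono mult_right_mono) simp_all
  finally show "tree_size (of_list (foldr (\<lambda>a acc. Nd (of_list (map (\<lambda>_. Lf) (a # acc))) a # acc) zs []))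
      \<le> ?s x * (3 * ?s x + 3) + 1"
    unfolding numbered_def .
qed

lemma ptime_answer_atoms: "ptime_list l \<Longrightarrow> ptime_list (\<lambda>x. answer_atoms (l x))"
  unfolding answer_atoms_def answer_key_def by (intro ptime_intros ptime_numbered)

lemma ptime_args_of: "ptime_list l \<Longrightarrow> ptime_list (\<lambda>x. args_of (l x))"
  unfolding args_of_def by (intro ptime_intros)

lemma ptime_query_atoms: "ptime_list query_atoms"
  unfolding query_atoms_def by (intro ptime_intros ptime_norm_atom ptime_answer_atoms)

lemma ptime_data_atoms: "ptime_list data_atoms"
  unfolding data_atoms_def by (intro ptime_intros ptime_norm_atom ptime_answer_atoms)

lemma ptime_tgd_trees: "ptime_list tgd_trees"
  unfolding tgd_trees_def by (intro ptime_intros ptime_norm_tgd)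

lemma ptime_data_facts: "ptime_list data_facts"
  unfolding data_facts_def individual_def by (intro ptime_intros ptime_data_atoms)

lemma ptime_elements: "ptime_list elements"
  unfolding elements_def by (intro ptime_intros ptime_args_of ptime_data_facts ptime_tgd_trees)

lemma ptime_keys: "ptime_list keys"
  unfolding keys_def by (intro ptime_intros ptime_data_facts ptime_tgd_trees)

lemma ptime_candidates: "ptime_list candidates"
  unfolding candidates_def by (intro ptime_intros ptime_keys ptime_elements[THEN ptime_list_comp])

lemma ptime_consequence:
  "ptime g \<Longrightarrow> ptime t \<Longrightarrow> ptime h \<Longrightarrow> ptime (\<lambda>x. consequence (g x) (t x) (h x))"
  unfolding consequence_def subst_def null_child_def next_level_def by (intro ptime_intros)

lemma ptime_derivable:
  assumes "ptime f" "ptime_list S" "ptime g"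
  shows "ptime_pred (\<lambda>x. derivable (f x) (S x) (g x))"
  unfolding derivable_def matches_def
  by (intro ptime_intros ptime_data_facts[THEN ptime_list_comp] ptime_tgd_trees[THEN ptime_list_comp]
      ptime_consequence assms(2)[THEN ptime_list_comp]
      assms(1)[THEN ptime_comp] assms(3)[THEN ptime_comp])

lemma ptime_facts: "ptime_list facts"
  unfolding facts_def
proof (rule ptime_list_filter_iteration[OF ptime_candidates ptime_candidates ptime_list_Nil])
  show "tree_size (of_list []) \<le> tree_size (of_list (candidates x))" for x
    using tree_size_pos by simp
  show "ptime_pred (\<lambda>y. derivable (left y) (to_list (left (right (right y)))) (right (right (right y))))"
    by (intro ptime_derivable ptime_intros)
qed

lemma ptime_renamed:
  assumes "ptime_list R" "ptime_list Q"
  shows "ptime_list (\<lambda>x. renamed (R x) (Q x))"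
  unfolding renamed_def by (intro ptime_intros assms[THEN ptime_list_comp] assms)

lemma ptime_start_table: "ptime_list start_table"
  unfolding start_table_def
  by (intro ptime_intros ptime_args_of ptime_facts[THEN ptime_list_comp] ptime_query_atoms)

lemma ptime_compatible:
  assumes "ptime_list Q" "ptime_list F" "ptime u" "ptime b" "ptime p" "ptime a"
  shows "ptime_pred (\<lambda>x. compatible (Q x) (F x) (u x) (b x) (p x) (a x))"
  unfolding compatible_def covered_def oriented_def next_level_def
  by (intro ptime_intros assms(1) assms(2)[THEN ptime_list_comp] assms(3-6)[THEN ptime_comp])

lemma ptime_survives:
  assumes "ptime_list Q" "ptime_list F" "ptime e" "ptime_list tb" "ptime m"
  shows "ptime_pred (\<lambda>x. survives (Q x) (F x) (e x) (tb x) (m x))"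
  unfolding survives_def
  by (intro ptime_intros ptime_compatible assms(1,2,4)[THEN ptime_list_comp] assms(3,5)[THEN ptime_comp])

lemma ptime_eliminate:
  assumes "ptime_list Q" "ptime_list F" "ptime_list tb0" "ptime_list L"
  shows "ptime_list (\<lambda>x. eliminate (Q x) (F x) (tb0 x) (L x))"
  unfolding eliminate_def
  by (rule ptime_list_filter_iteration[OF assms(3,4,3)])
    (simp, intro ptime_survives ptime_intros assms(1,2)[THEN ptime_list_comp])

lemma ptime_accepts:
  assumes "ptime_list R" "ptime_list L" "ptime g"
  shows "ptime_pred (\<lambda>x. accepts (R x) (L x) (g x))"
proof -
  have "ptime_pred (\<lambda>x. of_list (eliminate (renamed (R x) (query_atoms (g x))) (facts (g x)) (start_table (g x)) (L x)) \<noteq> Lf)"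
    by (intro ptime_pred_not ptime_pred_eq ptime_const ptime_of_list ptime_eliminate ptime_renamed assms
        ptime_query_atoms[THEN ptime_list_comp] ptime_facts[THEN ptime_list_comp]
        ptime_start_table[THEN ptime_list_comp])
  then have 3: "ptime_pred (\<lambda>x. eliminate (renamed (R x) (query_atoms (g x))) (facts (g x)) (start_table (g x)) (L x) \<noteq> [])"
    by simp
  have 1: "ptime_pred (\<lambda>x. \<forall>t\<in>set (query_atoms (g x)). (\<exists>e\<in>set (R x). left e = arg_l t) \<and> (\<exists>e\<in>set (R x). left e = arg_r t))"
    by (intro ptime_intros assms(1)[THEN ptime_list_comp] assms ptime_query_atoms[THEN ptime_list_comp])
  have 2: "ptime_pred (\<lambda>x. \<forall>t\<in>set (renamed (R x) (query_atoms (g x))). \<exists>l\<in>set (L x). covered t (left l) (right l))"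
    unfolding covered_def
    by (intro ptime_intros ptime_renamed assms(2)[THEN ptime_list_comp] assms ptime_query_atoms[THEN ptime_list_comp])
  show ?thesis unfolding accepts_def by (intro ptime_pred_conj 1 2 3)
qed

section \<open>Enumeration of the certificates\<close>

text \<open>All trees of bounded depth over the variables of the query; every certificate is among them.\<close>

definition cert_step :: "tree list \<Rightarrow> tree list" where
  "cert_step S = S @ concat (map (\<lambda>a. map (\<lambda>b. Nd a b) S) S)"

definition cert_base :: "tree \<Rightarrow> tree list" where
  "cert_base x = Lf # args_of (map norm_atom (atom_part x))"

text \<open>With k atoms the query has at most 2k variables. One round forms the pairs that are
  entries, up to 2k rounds form the cells of the two lists, and one more round pairs the lists: 2k +
  2 in all. The leaf in the base ends the lists.\<close>

definition certs :: "tree \<Rightarrow> tree list" where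
  "certs x = foldr (\<lambda>_ S. cert_step S) (atom_part x @ atom_part x @ [Lf, Lf]) (cert_base x)"

lemma foldr_const_funpow: "foldr (\<lambda>_. f) l b = (f ^^ length l) b"
  by (induction l) auto

lemma certs_funpow: "certs x = (cert_step ^^ (2 * length (atom_part x) + 2)) (cert_base x)"
  unfolding certs_def foldr_const_funpow by (simp add: mult_2)

lemma set_cert_step: "set (cert_step S) = set S \<union> {Nd a b | a b. a \<in> set S \<and> b \<in> set S}"
  unfolding cert_step_def by auto

lemma certs_mono: "m \<le> n \<Longrightarrow> set ((cert_step ^^ m) S) \<subseteq> set ((cert_step ^^ n) S)"
  by (rule lift_Suc_mono_le[of "\<lambda>n. set ((cert_step ^^ n) S)"]) (auto simp: set_cert_step)

lemma Nd_in_certs: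
  "a \<in> set ((cert_step ^^ n) S) \<Longrightarrow> b \<in> set ((cert_step ^^ n) S) \<Longrightarrow> Nd a b \<in> set ((cert_step ^^ Suc n) S)"
  by (auto simp: set_cert_step)

lemma of_list_in_certs:
  "set l \<subseteq> set ((cert_step ^^ n) S) \<Longrightarrow> Lf \<in> set S \<Longrightarrow> of_list l \<in> set ((cert_step ^^ (n + length l)) S)"
proof (induction l)
  case Nil
  then show ?case using certs_mono[of 0 n S] by auto
next
  case (Cons a l)
  have "a \<in> set ((cert_step ^^ (n + length l)) S)" using Cons.prems certs_mono[of n "n + length l" S] by auto
  moreover have "of_list l \<in> set ((cert_step ^^ (n + length l)) S)" using Cons by simp
  ultimately show ?case using Nd_in_certs[of a "n + length l" S "of_list l"] by simp
qed

text \<open>With n elements the step gives n + n^2, and adding one on both sides makes this a clean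
  squaring, which iterates to an exponent \<open>2 ^ n\<close>.\<close>

lemma length_cert_step: "length (cert_step S) + 1 \<le> (length S + 1) ^ 2"
proof -
  have "length (cert_step S) = length S + length S * length S"
    by (simp add: cert_step_def length_concat comp_def sum_list_triv)
  then show ?thesis by (simp add: power2_eq_square algebra_simps)
qed

lemma length_certs: "length ((cert_step ^^ n) S) + 1 \<le> (length S + 1) ^ (2 ^ n)"
proof (induction n)
  case (Suc n)
  have "length ((cert_step ^^ Suc n) S) + 1 \<le> (length ((cert_step ^^ n) S) + 1) ^ 2"
    using length_cert_step by simp
  also have "\<dots> \<le> ((length S + 1) ^ (2 ^ n)) ^ 2" using Suc by (rule power_mono) simp
  finally show ?case by (simp add: power_mult[symmetric] mult.commute)
qed simp

lemma tree_size_certs: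
  "(\<And>a. a \<in> set S \<Longrightarrow> tree_size a \<le> s) \<Longrightarrow> c \<in> set ((cert_step ^^ n) S) \<Longrightarrow> tree_size c + 1 \<le> 2 ^ n * (s + 1)"
proof (induction n arbitrary: c)
  case (Suc n)
  from Suc.prems(2) consider "c \<in> set ((cert_step ^^ n) S)"
    | a b where "c = Nd a b" "a \<in> set ((cert_step ^^ n) S)" "b \<in> set ((cert_step ^^ n) S)"
    by (auto simp: set_cert_step)
  then show ?case
  proof cases
    case 1
    then show ?thesis using Suc.IH[OF Suc.prems(1)] by fastforce
  next
    case 2
    from Suc.IH[OF Suc.prems(1) 2(2)] Suc.IH[OF Suc.prems(1) 2(3)] 2(1) show ?thesis by simp
  qed
qed simp

text \<open>Let d = 2k + 2, which is the number of rounds and one more than the length of the base.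
  There are at most d^(2^d) \<le> 2^(d 2^d) certificates, each of size at most 2^d times the input
  size, and d 2^d + d \<le> 2^(2d + 1) = 2^(4k + 5).\<close>

definition cert_bound :: "nat \<Rightarrow> nat" where
  "cert_bound k = 2 ^ 2 ^ (4 * k + 5)"

lemma tree_size_certs_le:
  assumes "n \<le> 2 * length (atom_part x) + 2"
  shows "tree_size (of_list ((cert_step ^^ n) (cert_base x))) \<le> cert_bound (length (atom_part x)) * input_size x"
proof -
  define d where "d = 2 * length (atom_part x) + 2"
  have len0: "length (cert_base x) + 1 = d"
    by (simp add: cert_base_def args_of_def length_concat comp_def sum_list_triv d_def)
  have size0: "tree_size a \<le> tree_size x" if "a \<in> set (cert_base x)" for a
  proof -
    from that consider "a = Lf" | t where "t \<in> set (atom_part x)" "a \<in> {arg_l (norm_atom t), arg_r (norm_atom t)}"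
      by (auto simp: cert_base_def set_args_of)
    then show ?thesis
    proof cases
      case 1
      then show ?thesis using tree_size_pos[of x] by simp
    next
      case (2 t)
      have "tree_size t \<le> tree_size (right (left x))" using tree_size_member[OF 2(1)] by simp
      also have "\<dots> \<le> tree_size x" using tree_size_right tree_size_left by (meson le_trans)
      finally have "tree_size t \<le> tree_size x" .
      moreover have "tree_size a \<le> tree_size t"
        using 2(2) tree_size_right[of t] tree_size_right[of "right t"] tree_size_left[of "right (right t)"]
          tree_size_right[of "right (right t)"]
        by (auto simp: norm_atom_def split: if_splits)
      ultimately show ?thesis by simp
    qed
  qed
  have n: "n \<le> d" using assms by (simp add: d_def)
  let ?S = "(cert_step ^^ n) (cert_base x)"
  have "length ?S + 1 \<le> d ^ 2 ^ n" using length_certs[of n "cert_base x"] unfolding len0 .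
  also have "\<dots> \<le> d ^ 2 ^ d" using n by (intro power_increasing) (simp_all add: d_def)
  also have "\<dots> \<le> (2 ^ d) ^ 2 ^ d" by (intro power_mono) (simp_all add: less_imp_le)
  finally have len: "length ?S \<le> 2 ^ (d * 2 ^ d)" by (simp add: power_mult)
  have "tree_size c \<le> 2 ^ d * (tree_size x + 1) - 1" if "c \<in> set ?S" for c
  proof -
    have "tree_size c + 1 \<le> 2 ^ n * (tree_size x + 1)" by (rule tree_size_certs[OF size0 that])
    also have "\<dots> \<le> 2 ^ d * (tree_size x + 1)" using n by (intro mult_right_mono power_increasing) simp_all
    finally show ?thesis by simp
  qed
  from tree_size_of_list_le[OF this, of ?S]
  have "tree_size (of_list ?S) \<le> length ?S * (2 ^ d * (tree_size x + 1)) + 1" by simp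
  also have "\<dots> \<le> 2 ^ (d * 2 ^ d) * (2 ^ d * (tree_size x + 1)) + 1"
    using len by (intro add_right_mono mult_right_mono) simp_all
  also have "\<dots> = 2 ^ (d * 2 ^ d + d) * (tree_size x + 1) + 1" by (simp only: power_add mult.assoc)
  also have "\<dots> \<le> 2 ^ (d * 2 ^ d + d) * (tree_size x + 1) + 2 ^ (d * 2 ^ d + d)" by simp
  also have "\<dots> = 2 ^ (d * 2 ^ d + d) * input_size x" by (simp add: input_size_def algebra_simps)
  also have "\<dots> \<le> 2 ^ 2 ^ (4 * length (atom_part x) + 5) * input_size x"
  proof (intro mult_right_mono power_increasing)
    have d: "d \<le> 2 ^ d" by (simp add: less_imp_le)
    then have "d * 2 ^ d + d \<le> 2 ^ d * 2 ^ d + 2 ^ d * 2 ^ d"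
      by (intro add_mono mult_right_mono) (auto intro: le_trans[OF d])
    also have "\<dots> = 2 ^ (2 * d + 1)" by (simp add: mult_2 power_add)
    also have "2 * d + 1 = 4 * length (atom_part x) + 5" by (simp add: d_def)
    finally show "d * 2 ^ d + d \<le> 2 ^ (4 * length (atom_part x) + 5)" .
  qed simp_all
  finally show ?thesis by (simp add: cert_bound_def)
qed

text \<open>A product of a function of the parameter and the input size: any power of it is again
  such a product up to a power in each factor, which is the form that fixed-parameter tractability
  asks for.\<close>

definition cert_measure :: "tree \<Rightarrow> nat" where
  "cert_measure x = cert_bound (length (atom_part x)) * input_size x"

lemma dominates_cert_measure: "dominates_size cert_measure"
  unfolding dominates_size_def cert_measure_def cert_bound_def by simp

lemma tractable_certs: "tractable cert_measure (\<lambda>x. of_list (certs x))"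
  unfolding certs_def
proof (rule tractable_foldr[OF dominates_cert_measure])
  show "tractable cert_measure (\<lambda>x. of_list (atom_part x @ atom_part x @ [Lf, Lf]))"
    by (intro ptime_imp_tractable dominates_cert_measure ptime_intros)
  show "ptime_list cert_base"
    unfolding cert_base_def by (intro ptime_intros ptime_args_of ptime_norm_atom)
  show "ptime_list (\<lambda>y. cert_step (to_list (left (right y))))"
    unfolding cert_step_def by (intro ptime_intros)
  show "poly_bounded cert_measure cert_measure"
    unfolding poly_bounded_def by (intro exI[of _ 1]) simp
  fix x ys zs assume l: "atom_part x @ atom_part x @ [Lf, Lf] = ys @ zs"
  have "length zs \<le> length (atom_part x @ atom_part x @ [Lf, Lf])" unfolding l by simp
  then have "length zs \<le> 2 * length (atom_part x) + 2" by simp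
  from tree_size_certs_le[OF this]
  show "tree_size (of_list (foldr (\<lambda>a acc. cert_step acc) zs (cert_base x))) \<le> cert_measure x"
    unfolding foldr_const_funpow cert_measure_def .
qed

definition decide :: "tree \<Rightarrow> bool" where
  "decide x \<longleftrightarrow> (\<exists>w\<in>set (certs x). accepts (to_list (left w)) (to_list (right w)) x)"

lemma tractable_decide: "tractable cert_measure (\<lambda>x. enc_bool (decide x))"
proof -
  have "ptime_pred (\<lambda>y. \<exists>w\<in>set (to_list (left y)). accepts (to_list (left w)) (to_list (right w)) (right y))"
    by (intro ptime_intros ptime_accepts)
  then have "ptime (\<lambda>y. enc_bool (\<exists>w\<in>set (to_list (left y)). accepts (to_list (left w)) (to_list (right w)) (right y)))"
    by (simp add: ptime_pred_def)
  from tractable_comp[OF dominates_cert_measure this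
      tractable_Nd[OF dominates_cert_measure tractable_certs tractable_id[OF dominates_cert_measure]]]
  show ?thesis by (simp add: decide_def)
qed

lemma decide_enc_omq:
  assumes "(q, T, D, as) \<in> tree_omq_instances"
  shows "decide (enc_omq (q, T, D, as)) \<longleftrightarrow> entails T D q as"
proof
  let ?x = "enc_omq (q, T, D, as)"
  have T: "is_ontology T" and len: "length as = length (ans_vars q)" and vars: "set (ans_vars q) \<subseteq> cq_vars q"
    and tree: "tree_shaped q"
    using assms by (simp_all add: tree_omq_instances_def is_cq_def)
  show "entails T D q as" if "decide ?x"
    using that entails_if_accepts[OF T len vars] unfolding decide_def by blast
  assume "entails T D q as"
  from accepts_if_entails[OF T len vars tree this] obtain R L where
    RL: "accepts R L ?x" "length R \<le> card (cq_vars q)" "length L \<le> card (cq_vars q)"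
      "\<And>e. e \<in> set R \<union> set L \<Longrightarrow> \<exists>u\<in>enc_nat ` cq_vars q. \<exists>v\<in>enc_nat ` cq_vars q. e = Nd u v"
    by blast
  let ?k = "length (atoms q)" and ?B = "cert_base ?x"
  have part: "atom_part ?x = map enc_atom (atoms q)" by (simp add: enc_omq_def enc_cq_def)
  have "cq_vars q = set (concat (map (\<lambda>\<alpha>. [arg1 \<alpha>, arg2 \<alpha>]) (atoms q)))" by (auto simp: cq_vars_args)
  then have "card (cq_vars q) \<le> length (concat (map (\<lambda>\<alpha>. [arg1 \<alpha>, arg2 \<alpha>]) (atoms q)))"
    by (metis card_length)
  then have card: "card (cq_vars q) \<le> 2 * ?k" by (simp add: length_concat comp_def sum_list_triv)
  have base: "enc_nat v \<in> set ?B" if "v \<in> cq_vars q" for v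
    using that unfolding cert_base_def part cq_vars_args by (auto simp: set_args_of norm_enc_atom)
  have Lf: "Lf \<in> set ?B" by (simp add: cert_base_def)
  have pair: "e \<in> set ((cert_step ^^ 1) ?B)" if "e \<in> set R \<union> set L" for e
    using RL(4)[OF that] base by (auto simp: set_cert_step)
  have list: "of_list l \<in> set ((cert_step ^^ (2 * ?k + 1)) ?B)"
    if "set l \<subseteq> set R \<union> set L" "length l \<le> card (cq_vars q)" for l
  proof -
    have "of_list l \<in> set ((cert_step ^^ (1 + length l)) ?B)"
      by (rule of_list_in_certs[OF _ Lf]) (use that(1) pair in blast)
    then show ?thesis using certs_mono[of "1 + length l" "2 * ?k + 1" ?B] that(2) card by auto
  qed
  have "Nd (of_list R) (of_list L) \<in> set (certs ?x)"
    using Nd_in_certs[OF list[of R] list[of L]] RL(2,3) unfolding certs_funpow part by simp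
  then show "decide ?x"
    unfolding decide_def using RL(1) by (intro bexI[of _ "Nd (of_list R) (of_list L)"]) simp_all
qed

section \<open>Computability of the parameter function\<close>

lemma to_list_enc_unary: "to_list (enc_unary n) = replicate n Lf"
  by (induction n) auto

lemma of_list_replicate_Lf: "of_list (replicate n Lf) = enc_unary n"
  by (induction n) auto

lemma ptime_unary_mult: "\<exists>F. ptime F \<and> (\<forall>n. F (enc_unary n) = enc_unary (c * n))"
proof (induction c)
  case 0
  then show ?case by (intro exI[of _ "\<lambda>x. Lf"]) (simp add: ptime_const)
next
  case (Suc c)
  then obtain F where F: "ptime F" "\<And>n. F (enc_unary n) = enc_unary (c * n)" by blast
  have "ptime (\<lambda>x. of_list (to_list x @ to_list (F x)))"
    by (intro ptime_intros F)
  moreover have "of_list (to_list (enc_unary n) @ to_list (F (enc_unary n))) = enc_unary (Suc c * n)" for n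
    unfolding F(2) to_list_enc_unary replicate_add[symmetric] of_list_replicate_Lf by simp
  ultimately show ?case by (intro exI[of _ "\<lambda>x. of_list (to_list x @ to_list (F x))"]) blast
qed

text \<open>The list is doubled once for each unary digit. The result is exponentially long, so this
  leaves \<open>ptime\<close>; some time bound exists all the same, and termination is all that
  \<open>computable\<close> needs.\<close>

lemma computes_unary_exp:
  assumes "computes_within F \<tau>"
  shows "\<exists>G \<sigma>. computes_within G \<sigma> \<and> (\<forall>x n. F x = enc_unary n \<longrightarrow> G x = enc_unary (2 ^ n))"
proof -
  define B where "B = (\<lambda>x :: tree. enc_unary 1)"
  define S where "S = (\<lambda>y. of_list (to_list (left (right y)) @ to_list (left (right y))))"
  have "ptime B" unfolding B_def by (rule ptime_const)
  moreover have "ptime S" unfolding S_def by (intro ptime_intros)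
  ultimately obtain \<beta> \<sigma> where BS: "computes_within B \<beta>" "computes_within S \<sigma>"
    unfolding ptime_def tractable_def by blast
  have exp: "tree_fold B S p (enc_unary n) = enc_unary (2 ^ n)" for p n
    by (induction n)
      (simp_all add: B_def S_def to_list_enc_unary replicate_add[symmetric] of_list_replicate_Lf mult_2)
  from computes_comp[OF computes_Nd[OF assms computes_id] computes_fold[OF BS]]
  obtain \<tau>' where "computes_within (\<lambda>x. tree_fold B S x (F x)) \<tau>'" by auto
  then show ?thesis using exp by (intro exI[of _ "\<lambda>x. tree_fold B S x (F x)"] exI[of _ \<tau>']) simp
qed

text \<open>The value is \<open>2 ^ (c * 2 ^ (4 * k + 5))\<close>, so two exponentiations with a
  multiplication by the constant \<open>c\<close> between them produce it.\<close>

lemma computable_cert_bound_power: "computable (\<lambda>k. cert_bound k ^ c)"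
proof -
  obtain F4 where F4: "ptime F4" "\<And>n. F4 (enc_unary n) = enc_unary (4 * n)" using ptime_unary_mult by metis
  obtain Fc where Fc: "ptime Fc" "\<And>n. Fc (enc_unary n) = enc_unary (c * n)" using ptime_unary_mult by metis
  define F where "F x = of_list (to_list (F4 x) @ to_list (enc_unary 5))" for x
  have "ptime F" unfolding F_def by (intro ptime_intros F4)
  then obtain \<tau> where "computes_within F \<tau>" unfolding ptime_def tractable_def by blast
  moreover have F: "F (enc_unary n) = enc_unary (4 * n + 5)" for n
    unfolding F_def F4(2) to_list_enc_unary replicate_add[symmetric] of_list_replicate_Lf ..
  ultimately obtain G \<sigma> where G: "computes_within G \<sigma>" "\<And>n. G (enc_unary n) = enc_unary (2 ^ (4 * n + 5))"
    using computes_unary_exp by metis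
  obtain \<gamma> where "computes_within Fc \<gamma>" using Fc(1) unfolding ptime_def tractable_def by blast
  from computes_unary_exp[OF computes_comp[OF G(1) this]] obtain H \<eta> where
    H: "computes_within H \<eta>" "\<And>x n. Fc (G x) = enc_unary n \<Longrightarrow> H x = enc_unary (2 ^ n)" by blast
  have "H (enc_unary k) = enc_unary (cert_bound k ^ c)" for k
    using H(2)[of "enc_unary k" "c * 2 ^ (4 * k + 5)"]
    by (simp add: G(2) Fc(2) cert_bound_def power_mult[symmetric] mult.commute)
  then show ?thesis using computes_within_runs[OF H(1)] unfolding computable_def by metis
qed

theorem theorem18:
  "fixed_parameter_tractable tree_omq_instances enc_omq
     (\<lambda>(q, T, D, as). entails T D q as) (\<lambda>(q, T, D, as). cq_size q)"
proof -
  from tractable_decide obtain \<tau> c where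
    \<tau>: "computes_within (\<lambda>x. enc_bool (decide x)) \<tau>" "\<And>x. \<tau> x \<le> cert_measure x ^ c"
    unfolding tractable_def poly_bounded_def by blast
  from computes_within_runs[OF \<tau>(1)] obtain \<Pi> where
    \<Pi>: "\<And>x. \<exists>t\<le>\<tau> x + 2. runs \<Pi> x (enc_bool (decide x)) t" by blast
  have "\<exists>t. runs \<Pi> (enc_omq i) (enc_bool (case i of (q, T, D, as) \<Rightarrow> entails T D q as)) t \<and>
      t \<le> cert_bound (case i of (q, T, D, as) \<Rightarrow> cq_size q) ^ (c + 2) *
        poly ([:2, 1:] ^ (c + 2)) (tree_size (enc_omq i))"
    if "i \<in> tree_omq_instances" for i
  proof -
    obtain q T D as where i: "i = (q, T, D, as)" by (cases i)
    obtain t where t: "t \<le> \<tau> (enc_omq i) + 2" "runs \<Pi> (enc_omq i) (enc_bool (decide (enc_omq i))) t"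
      using \<Pi> by blast
    let ?m = "cert_measure (enc_omq i)"
    have m: "2 \<le> ?m" by (rule dominates_size_ge_2[OF dominates_cert_measure])
    \<comment> \<open>The two steps for the outer call are at most \<open>?m\<close>; absorbing this
      summand raises the exponent from \<open>c\<close> to \<open>c + 2\<close>.\<close>
    have "t \<le> ?m ^ c + ?m ^ 1" using t(1) \<tau>(2)[of "enc_omq i"] m by simp
    also have "\<dots> \<le> ?m ^ (c + 2)" using power_add_le[OF m, of c 1] by simp
    also have "?m = cert_bound (cq_size q) * (tree_size (enc_omq i) + 2)"
      unfolding cert_measure_def input_size_def i by (simp add: enc_omq_def enc_cq_def cq_size_def)
    finally have "t \<le> cert_bound (cq_size q) ^ (c + 2) * (tree_size (enc_omq i) + 2) ^ (c + 2)"
      unfolding power_mult_distrib .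
    moreover have poly: "poly [:2, 1:] n = n + 2" for n :: nat by simp
    moreover have dec: "decide (enc_omq (q, T, D, as)) = entails T D q as"
      using decide_enc_omq that unfolding i by blast
    ultimately show ?thesis
      using t(2) unfolding i poly_power prod.case poly dec by blast
  qed
  then show ?thesis
    unfolding fixed_parameter_tractable_def using computable_cert_bound_power[of "c + 2"] by blast
qed

end
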